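(* For every integer $k\ge 0$ let $$S_k=\sum_{n=1}^\infty\frac{p_n^k}{n!},$$ where $p_n$ denotes the $n$-th prime number. Then the real numbers $1,S_0,S_1,S_2,\ldots$ are linearly independent over $\mathbb{Q}$.
   Context: Primes are indexed by $p_1=2,\ p_2=3,\ p_3=5,\ldots$. *)

theory Defs
  imports
    Complex_Main
    "HOL-Library.Infinite_Set"
    "HOL-Computational_Algebra.Primes"
    "HOL-Computational_Algebra.Squarefree"
begin

(* enumerate counts from 0; primes are numbered from 1, so nth_prime 1 = 2 and
   the value at 0 is irrelevant *)
definition nth_prime :: "nat \<Rightarrow> nat" where
  "nth_prime n = enumerate {p. prime p} (n - 1)"

(* the series index is shifted by one because suminf starts at 0; convergence is
   summable_prime_sum below *)
definition prime_sum :: "nat \<Rightarrow> real" where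
  "prime_sum k = (\<Sum>n. real (nth_prime (Suc n)) ^ k / fact (Suc n))"

lemma nth_prime_range: "nth_prime ` {1..} = {p. prime p}"
proof -
  have "nth_prime ` {1..} = range (enumerate {p::nat. prime p})"
  proof (intro equalityI subsetI)
    fix x assume "x \<in> range (enumerate {p::nat. prime p})"
    then obtain n where "x = enumerate {p::nat. prime p} n" by blast
    then have "x = nth_prime (Suc n)" by (simp add: nth_prime_def)
    then show "x \<in> nth_prime ` {1..}" by auto
  qed (auto simp: nth_prime_def)
  then show ?thesis using range_enumerate[OF primes_infinite] by simp
qed

lemma nth_prime_strict_mono: "strict_mono_on {1..} nth_prime"
  by (rule strict_mono_onI)
    (auto simp: nth_prime_def primes_infinite intro!: enumerate_mono)

lemma le_two_power_card_primes:
  fixes M :: nat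
  assumes "M > 0"
  shows "M \<le> 2 ^ card {p. prime p \<and> p \<le> M\<^sup>2}"
proof -
  let ?P = "{p::nat. prime p \<and> p \<le> M\<^sup>2}"
  let ?f = "\<lambda>n::nat. (prime_factors (squarefree_part n), square_part n)"
  have fin: "finite ?P" by simp
  have inj: "inj_on ?f {1..M\<^sup>2}"
  proof (rule inj_onI)
    fix m n :: nat
    assume mn: "m \<in> {1..M\<^sup>2}" "n \<in> {1..M\<^sup>2}" "?f m = ?f n"
    have prod: "squarefree_part x = \<Prod>(prime_factors (squarefree_part x))" for x :: nat
    proof -
      have "multiplicity p (squarefree_part x) = 1" if "p \<in> prime_factors (squarefree_part x)" for p
        using that squarefree_factorial_semiring'[of "squarefree_part x"] by simp
      then have "\<Prod>(prime_factors (squarefree_part x)) =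
          (\<Prod>p\<in>prime_factors (squarefree_part x). p ^ multiplicity p (squarefree_part x))"
        by (intro prod.cong) auto
      then show ?thesis by (subst (asm) prod_prime_factors) simp_all
    qed
    have "squarefree_part m = squarefree_part n"
      using mn prod[of m] prod[of n] by simp
    then show "m = n" using mn by (metis squarefree_decompose prod.inject)
  qed
  have sub: "?f ` {1..M\<^sup>2} \<subseteq> Pow ?P \<times> {1..M}"
  proof
    fix x assume "x \<in> ?f ` {1..M\<^sup>2}"
    then obtain n where n: "n \<ge> 1" "n \<le> M\<^sup>2" "x = ?f n" by auto
    have d: "n = squarefree_part n * square_part n ^ 2"
      by (rule squarefree_decompose)
    have pos: "squarefree_part n > 0" "square_part n > 0"
      using n(1) d by (auto intro!: Nat.gr0I)
    have "square_part n ^ 2 \<le> M\<^sup>2" "squarefree_part n \<le> M\<^sup>2"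
      using pos n(2) d by (metis dvd_triv_left dvd_triv_right dvd_imp_le n(1) order_trans less_le_trans zero_less_one)+
    then show "x \<in> Pow ?P \<times> {1..M}"
      using pos n(3) by (auto simp: in_prime_factors_iff power2_nat_le_eq_le dest!: dvd_imp_le)
  qed
  have "M\<^sup>2 = card (?f ` {1..M\<^sup>2})" using card_image[OF inj] by simp
  also have "\<dots> \<le> card (Pow ?P \<times> {1..M})" using sub by (intro card_mono) auto
  also have "\<dots> = 2 ^ card ?P * M" using fin by (simp add: card_Pow card_cartesian_product)
  finally show ?thesis using assms by (simp add: power2_eq_square)
qed

lemma nth_prime_le: "nth_prime (Suc n) \<le> 4 ^ Suc n"
proof (rule ccontr)
  let ?e = "enumerate {p::nat. prime p}"
  assume "\<not> ?thesis"
  then have gt: "?e n > 4 ^ Suc n" by (simp add: nth_prime_def)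
  have sq: "(2 ^ Suc n)\<^sup>2 = (4::nat) ^ Suc n"
    by (metis power_mult power_mult_distrib num_double numeral_times_numeral power2_eq_square mult.commute)
  have "{p. prime p \<and> p \<le> 4 ^ Suc n} \<subseteq> ?e ` {..<n}"
  proof
    fix p :: nat assume p: "p \<in> {p. prime p \<and> p \<le> 4 ^ Suc n}"
    then obtain i where i: "p = ?e i" using range_enumerate[OF primes_infinite] by blast
    then have "?e i < ?e n" using gt p by simp
    then show "p \<in> ?e ` {..<n}" using i by (simp add: primes_infinite)
  qed
  then have "card {p::nat. prime p \<and> p \<le> 4 ^ Suc n} \<le> n"
    by (metis card_lessThan finite_lessThan surj_card_le)
  then have "(2::nat) ^ card {p::nat. prime p \<and> p \<le> 4 ^ Suc n} < 2 ^ Suc n"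
    by (intro power_strict_increasing) auto
  with le_two_power_card_primes[of "2 ^ Suc n"] sq show False by simp
qed

lemma summable_prime_sum: "summable (\<lambda>n. real (nth_prime (Suc n)) ^ k / fact (Suc n))"
proof (rule summable_comparison_test')
  have "summable (\<lambda>n. inverse (fact n) * (4 ^ k :: real) ^ n)" by (rule summable_exp)
  then show "summable (\<lambda>n. inverse (fact (Suc n)) * (4 ^ k :: real) ^ Suc n)"
    by (subst summable_Suc_iff)
next
  fix n :: nat
  have "real (nth_prime (Suc n)) \<le> 4 ^ Suc n"
    using nth_prime_le[of n] by (metis of_nat_le_iff of_nat_power of_nat_numeral)
  then have "real (nth_prime (Suc n)) ^ k \<le> (4 ^ Suc n) ^ k" by (intro power_mono) auto
  also have "\<dots> = (4 ^ k) ^ Suc n" by (metis power_mult mult.commute)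
  finally show "norm (real (nth_prime (Suc n)) ^ k / fact (Suc n))
      \<le> inverse (fact (Suc n)) * (4 ^ k) ^ Suc n"
    by (simp add: field_simps del: fact_Suc power_Suc)
qed

(* independent is a predicate on sets: a family of reals is linearly independent
   over the rationals iff it is injective and its range is rat_real.independent *)
global_interpretation rat_real: vector_space "\<lambda>q. (*) (real_of_rat q)"
  by unfold_locales (simp_all add: algebra_simps of_rat_add of_rat_mult)

end

theory Submission
  imports Defs "HOL-Computational_Algebra.Polynomial" "HOL-Library.Multiset"
begin

text \<open>
  Suppose that \<open>\<Sum> Q(p\<^sub>n) / n!\<close> is an integer for an integer polynomial \<open>Q\<close> of degree \<open>k \<ge> 1\<close>. Then
  \<open>t\<^sub>N = (N - 1)! \<Sum>\<^bsub>n \<ge> N\<^esub> Q(p\<^sub>n) / n!\<close> is an integer, \<open>t\<^bsub>N + 1\<^esub> = N t\<^sub>N - Q(p\<^sub>N)\<close>, and \<open>t\<^sub>N\<close> is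
  approximated by a rational function of \<open>N\<close>, \<open>p\<^sub>N\<close> and the next few prime gaps.

  Chebyshev's bound \<open>p\<^sub>n \<le> n\<^bsup>1 + o(1)\<^esup>\<close> and the pigeonhole principle give a \<open>2k\<close>-dimensional cube of points
  \<open>(N, p\<^sub>N)\<close>, with sides small compared to \<open>N\<close>, at which the next prime gaps agree. The \<open>k\<close>-th differences
  of \<open>t\<close> along this cube are integers of absolute value below \<open>1\<close>, hence \<open>0\<close>. Feeding this into the recurrence forces
  \<open>k\<close> of the directions to have a common slope \<open>\<lambda> = D / a\<close>. Along these directions the main term of the
  \<open>k\<close>-th difference of \<open>t\<^sub>N\<close> is proportional to \<open>(p\<^sub>N - \<lambda> N)\<^sup>k / N\<^bsup>k + 1\<^esup>\<close>, so that \<open>p\<^sub>N - \<lambda> N\<close> is small.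

  Now \<open>p\<^sub>M = (D M + z\<^sub>M) / a\<close> with small integers \<open>z\<^sub>M\<close> for all \<open>M\<close> close to \<open>N\<close>. Clearing denominators turns the
  integrality of \<open>t\<^sub>M\<close> into a divisibility between polynomials in \<open>M\<close> with small coefficients, which must
  be a polynomial identity; its top coefficient determines \<open>z\<^bsub>M + k - 1\<^esub>\<close> from
  \<open>z\<^sub>M, \<dots>, z\<^bsub>M + k - 2\<^esub>\<close>. Since \<open>N\<close> and \<open>N + a\<close> have the same gaps, the gaps continue periodically,
  \<open>p\<^bsub>M + a\<^esub> = p\<^sub>M + D\<close>, for so long that some arithmetic progression \<open>p\<^sub>N + i D\<close> of primes reaches a multiple
  of \<open>D + 1\<close>.
\<close>

text \<open>The order \<open>k\<close> of the differences is forced by sizes: up to small factors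
  \<open>t\<close> at \<open>N\<close> grows like \<open>N ^ (k - 1)\<close>, and each difference
  with short steps saves a factor \<open>N\<close>, so the \<open>k\<close>-th is the first to fall
  below 1. That these differences vanish does not yet restrict the primes, because the recurrence
  multiplies \<open>t\<close> by \<open>N\<close>. The cure is to combine two directions so that the
  coordinate \<open>N\<close> is annihilated. One pair per difference is the reason for
  \<open>2 * k\<close> directions, and each pair leaves a determinant comparing its two slopes.

  The scales are fixed in a strict order. All exponents depend only on \<open>k\<close> and the
  growth exponent of \<open>t\<close>; the constant in the bound for the primes depends only on
  these exponents; the base \<open>Y\<close> is taken last, and every length is a fixed power of it.
  The points lie near \<open>X = Y ^ \<Delta>\<close>, where prime gaps are below \<open>Y\<close>
  on average, the sides of the cube are at most \<open>B = Y ^ \<beta>\<close>, and \<open>X\<close>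
  is a high power of \<open>B\<close>. Thus any fixed power of \<open>B\<close> still counts as
  small.\<close>

subsection \<open>Growth of the primes\<close>

text \<open>These are the entries of Leibniz's harmonic triangle, scaled by \<open>L\<close>. Each
  entry is the one above it minus its left neighbour, so integrality spreads from the first column,
  where it is assumed. For a common multiple \<open>L\<close> of 1 to \<open>n\<close> it means that
  \<open>k * (n choose k)\<close> divides \<open>L\<close>.\<close>

lemma leibniz_harmonic_Ints:
  fixes n k :: nat and L :: real
  assumes "\<And>i. 1 \<le> i \<Longrightarrow> i \<le> n \<Longrightarrow> L / real i \<in> \<int>" "1 \<le> k" "k \<le> n"
  shows "L / (real k * real (n choose k)) \<in> \<int>"
  using assms(2,1,3)
proof (induction k arbitrary: n rule: dec_induct)
  case base
  then show ?case by simp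
next
  case (step k)
  then obtain n' where n: "n = Suc n'" by (cases n) auto
  define A where "A = real (n' choose (k - 1))"
  define C where "C = real (n' choose k)"
  have k: "k \<ge> 1" "k \<le> n'" using step n by auto
  have pos: "A > 0" "C > 0" using k by (auto simp: A_def C_def)
  obtain k' where k': "k = Suc k'" using k by (cases k) auto
  have e1: "real (Suc k) * real (n choose Suc k) = real n * C"
    unfolding n C_def of_nat_mult[symmetric] Suc_times_binomial ..
  have e2: "real k * real (n choose k) = real n * A"
    unfolding n A_def k' of_nat_mult[symmetric] Suc_times_binomial diff_Suc_1 ..
  have e3: "real k * C = (real n - real k) * A"
  proof -
    have "Suc k' * (n' choose Suc k') = (n' choose k') * (n' - k')"
      unfolding binomial_absorption[of k' n'] binomial_absorb_comp[of n' k', symmetric] by (rule mult.commute)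
    then have "real k * C = A * real (n' - k')"
      unfolding A_def C_def k' diff_Suc_1 of_nat_mult[symmetric] by (simp only:)
    also have "real (n' - k') = real n - real k" using k(2) n k' by (simp add: of_nat_diff)
    finally show ?thesis by simp
  qed
  have "L / (real k * C) - L / (real n * A) = L / (real n * C)"
  proof -
    have nz: "real n \<noteq> 0" "real k \<noteq> 0" "A \<noteq> 0" "C \<noteq> 0" using n k pos by auto
    have "L / (real k * C) - L / (real n * A) = (L * (real n * A) - L * (real k * C)) / ((real k * C) * (real n * A))"
      by (rule diff_frac_eq) (use nz in simp_all)
    also have "L * (real n * A) - L * (real k * C) = L * (real k * A)"
      unfolding e3 by (simp add: left_diff_distrib right_diff_distrib)
    also have "(real k * C) * (real n * A) = (real n * C) * (real k * A)" by (simp only: ac_simps)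
    finally show ?thesis using nz by simp
  qed
  moreover have "L / (real k * C) \<in> \<int>" unfolding C_def
    using step.prems n k by (intro step.IH) auto
  moreover have "L / (real n * A) \<in> \<int>" unfolding e2[symmetric]
    using step.prems n k by (intro step.IH) auto
  ultimately show ?case unfolding e1 by (metis Ints_diff)
qed

text \<open>\<open>L\<close> is the least common multiple: \<open>p ^ e p\<close> is the largest
  power of \<open>p\<close> up to \<open>n\<close>, and each of these factors is at most
  \<open>n\<close>.\<close>

lemma ex_common_multiple_le:
  fixes n :: nat
  assumes "n > 0"
  shows "\<exists>L>0. (\<forall>i. 1 \<le> i \<longrightarrow> i \<le> n \<longrightarrow> i dvd L) \<and> L \<le> n ^ card {p. prime p \<and> p \<le> n}"
proof -
  let ?P = "{p::nat. prime p \<and> p \<le> n}"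
  have "\<exists>e. p ^ e \<le> n \<and> n < p ^ Suc e" if "p \<in> ?P" for p
    using ex_power_ivl1[of p n] that assms prime_ge_2_nat[of p] by (auto simp: less_eq_Suc_le)
  then obtain e where e: "\<And>p. p \<in> ?P \<Longrightarrow> p ^ e p \<le> n \<and> n < p ^ Suc (e p)" by metis
  define L where "L = (\<Prod>p\<in>?P. p ^ e p)"
  have "L > 0" unfolding L_def by (intro prod_pos) (auto intro: prime_gt_0_nat)
  moreover have "i dvd L" if i: "1 \<le> i" "i \<le> n" for i
  proof -
    have le: "multiplicity p i \<le> e p" if p: "p \<in> ?P" for p
    proof (rule ccontr)
      assume "\<not> ?thesis"
      then have "p ^ Suc (e p) dvd p ^ multiplicity p i" by (intro le_imp_power_dvd) simp
      then have "p ^ Suc (e p) dvd i" using multiplicity_dvd dvd_trans by blast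
      then show False using i e[OF p] by (auto dest: dvd_imp_le)
    qed
    have sub: "prime_factors i \<subseteq> ?P"
    proof
      fix p assume "p \<in> prime_factors i"
      then have "prime p" "p dvd i" by (auto simp: in_prime_factors_iff)
      moreover have "p \<le> i" using \<open>p dvd i\<close> i(1) by (intro dvd_imp_le) auto
      ultimately show "p \<in> ?P" using i(2) by simp
    qed
    have "i = (\<Prod>p\<in>prime_factors i. p ^ multiplicity p i)"
      using i by (subst prod_prime_factors) auto
    also have "\<dots> dvd (\<Prod>p\<in>prime_factors i. p ^ e p)"
    proof (rule prod_dvd_prod)
      fix p assume "p \<in> prime_factors i"
      then have "p \<in> ?P" using sub by blast
      then show "p ^ multiplicity p i dvd p ^ e p" by (intro le_imp_power_dvd le)
    qed
    also have "\<dots> dvd L" unfolding L_def using sub by (intro prod_dvd_prod_subset) auto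
    finally show ?thesis .
  qed
  moreover have "L \<le> n ^ card ?P"
  proof -
    have "L \<le> (\<Prod>p\<in>?P. n)" unfolding L_def using e by (intro prod_mono) auto
    then show ?thesis by simp
  qed
  ultimately show ?thesis by blast
qed

text \<open>Nair's form of Chebyshev's bound: the left side divides every common multiple of 1 to
  \<open>2 * m\<close>, in particular the small one just built.\<close>

lemma central_binomial_le_power_card_primes:
  fixes m :: nat
  assumes "m > 0"
  shows "m * (2 * m choose m) \<le> (2 * m) ^ card {p. prime p \<and> p \<le> 2 * m}"
proof -
  obtain L where L: "L > 0" "\<And>i. 1 \<le> i \<Longrightarrow> i \<le> 2 * m \<Longrightarrow> i dvd L"
    "L \<le> (2 * m) ^ card {p::nat. prime p \<and> p \<le> 2 * m}"
    using ex_common_multiple_le[of "2 * m"] assms by auto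
  define c where "c = m * (2 * m choose m)"
  have c: "c > 0" using assms by (simp add: c_def)
  have "real L / (real m * real (2 * m choose m)) \<in> \<int>"
  proof (rule leibniz_harmonic_Ints)
    fix i assume "1 \<le> i" "i \<le> 2 * m"
    then obtain d where "L = i * d" using L(2) by blast
    then show "real L / real i \<in> \<int>" using \<open>1 \<le> i\<close> by simp
  qed (use assms in auto)
  then have "real L / real c \<in> \<int>" by (simp add: c_def)
  moreover have "real L / real c > 0" using L(1) c by simp
  ultimately have "1 \<le> \<bar>real L / real c\<bar>" by (intro Ints_nonzero_abs_ge1) (use L(1) c in auto)
  then have "real L / real c \<ge> 1" by simp
  then have "real c \<le> real L" using c by (simp add: le_divide_eq)
  then have "c \<le> L" by (simp only: of_nat_le_iff)
  also note L(3)
  finally show ?thesis unfolding c_def .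
qed

lemma nth_prime_prime:
  assumes "n \<ge> 1"
  shows "prime (nth_prime n)"
proof -
  have "nth_prime n \<in> nth_prime ` {1..}" by (rule imageI) (use assms in simp)
  then show ?thesis unfolding nth_prime_range by (rule CollectD)
qed

lemma nth_prime_ge_2: "n \<ge> 1 \<Longrightarrow> nth_prime n \<ge> 2"
  by (intro prime_ge_2_nat nth_prime_prime)

lemma nth_prime_less: "1 \<le> m \<Longrightarrow> m < n \<Longrightarrow> nth_prime m < nth_prime n"
  using nth_prime_strict_mono by (simp add: strict_mono_on_def)

lemma card_primes_le_nth_prime:
  assumes "n \<ge> 1" "M \<le> nth_prime n"
  shows "card {p. prime p \<and> p \<le> M} \<le> n"
proof -
  have "{p. prime p \<and> p \<le> M} \<subseteq> nth_prime ` {1..n}"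
  proof
    fix p assume p: "p \<in> {p. prime p \<and> p \<le> M}"
    then have "p \<in> nth_prime ` {1..}" unfolding nth_prime_range by simp
    then obtain i where i: "i \<ge> 1" "p = nth_prime i" by auto
    have "\<not> n < i"
    proof
      assume "n < i"
      then have "nth_prime n < nth_prime i" using assms(1) by (intro nth_prime_less)
      then show False using p i(2) assms(2) by simp
    qed
    then show "p \<in> nth_prime ` {1..n}" using i by auto
  qed
  then have "card {p. prime p \<and> p \<le> M} \<le> card (nth_prime ` {1..n})" by (intro card_mono) auto
  also have "\<dots> \<le> n" using card_image_le[of "{1..n}" nth_prime] by simp
  finally show ?thesis .
qed

text \<open>Take for \<open>2 * m\<close> the largest even number up to the \<open>n\<close>-th
  prime, so that at most \<open>n\<close> primes are counted, compare with the lower bound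
  \<open>4 ^ m / (2 * m)\<close> for the central binomial coefficient, and take logarithms.\<close>

lemma nth_prime_le_mult_ln:
  assumes "n \<ge> 1"
  shows "real (nth_prime n) \<le> 8 * real n * ln (real (nth_prime n))"
proof -
  define p where "p = nth_prime n"
  have p2: "p \<ge> 2" using nth_prime_ge_2[OF assms] by (simp add: p_def)
  define m where "m = p div 2"
  have m: "m > 0" "2 * m \<le> p" "p \<le> 2 * m + 1" using p2 by (auto simp: m_def)
  have "4 ^ m \<le> 2 * real m * real (2 * m choose m)"
    using central_binomial_lower_bound[OF m(1)] m(1) by (simp add: field_simps)
  also have "\<dots> = 2 * real (m * (2 * m choose m))" by simp
  also have "\<dots> \<le> 2 * real ((2 * m) ^ card {p. prime p \<and> p \<le> 2 * m})"
    using central_binomial_le_power_card_primes[OF m(1)] by (intro mult_left_mono) (simp_all only: of_nat_le_iff)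
  also have "\<dots> \<le> real p * real p ^ n"
  proof (intro mult_mono)
    have "(2 * m) ^ card {p. prime p \<and> p \<le> 2 * m} \<le> (2 * m) ^ n"
      using card_primes_le_nth_prime[OF assms, of "2 * m"] m by (intro power_increasing) (auto simp: p_def)
    also have "\<dots> \<le> p ^ n" using m by (intro power_mono) auto
    finally show "real ((2 * m) ^ card {p. prime p \<and> p \<le> 2 * m}) \<le> real p ^ n"
      by (metis of_nat_le_iff of_nat_power)
  qed (use p2 in auto)
  finally have le: "(4::real) ^ m \<le> real p ^ Suc n" by simp
  have "real m * ln 4 = ln (4 ^ m)" by (simp add: ln_realpow)
  also have "\<dots> \<le> ln (real p ^ Suc n)" using le p2 by (subst ln_le_cancel_iff) auto
  also have "\<dots> = real (Suc n) * ln (real p)" using p2 by (simp only: ln_realpow)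
  finally have "real m * ln 4 \<le> real (Suc n) * ln (real p)" .
  moreover have "ln (4::real) \<ge> 1"
  proof -
    have "exp 1 \<le> (4::real)" using exp_le by simp
    then show ?thesis by (simp add: ln_ge_iff)
  qed
  then have "real m * 1 \<le> real m * ln 4" by (intro mult_left_mono) auto
  moreover have "real p \<le> 4 * real m" using m by linarith
  moreover have "real (Suc n) * ln (real p) \<le> (2 * real n) * ln (real p)"
    using assms p2 by (intro mult_right_mono) auto
  ultimately show ?thesis unfolding p_def by linarith
qed

lemma ln_power_le:
  fixes p :: real
  assumes "p \<ge> 1" "m > 0"
  shows "ln p ^ m \<le> real m ^ m * p"
proof -
  have "ln p / real m \<le> exp (ln p / real m)"
    using exp_ge_add_one_self[of "ln p / real m"] by linarith
  then have "(ln p / real m) ^ m \<le> exp (ln p / real m) ^ m"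
    using assms by (intro power_mono) auto
  also have "\<dots> = exp (real m * (ln p / real m))" by (rule exp_of_nat_mult[symmetric])
  also have "real m * (ln p / real m) = ln p" using assms by simp
  also have "exp (ln p) = p" using assms by simp
  finally show ?thesis using assms by (simp add: power_divide pos_divide_le_eq mult.commute)
qed

text \<open>The bound \<open>n powr (1 + 1 / d)\<close>, up to a constant, without real exponents.
  The power \<open>Suc d\<close> of the logarithm costs a single factor of the prime, which is why
  the left side has one power less than the right.\<close>

lemma nth_prime_power_bound:
  "\<exists>K>0. \<forall>n\<ge>1. real (nth_prime n) ^ d \<le> K * real n ^ Suc d"
proof (intro exI conjI allI impI)
  show "(8 * real (Suc d)) ^ Suc d > 0" by (intro zero_less_power) simp
next
  fix n :: nat assume n: "n \<ge> 1"
  define p where "p = real (nth_prime n)"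
  define m where "m = Suc d"
  have p2: "p \<ge> 2" using nth_prime_ge_2[OF n] by (simp add: p_def)
  have "p * p ^ d = p ^ m" by (simp add: m_def)
  also have "\<dots> \<le> (8 * real n * ln p) ^ m"
    using nth_prime_le_mult_ln[OF n] p2 unfolding p_def by (intro power_mono) auto
  also have "\<dots> = (8 * real n) ^ m * ln p ^ m" by (rule power_mult_distrib)
  also have "\<dots> \<le> (8 * real n) ^ m * (real m ^ m * p)"
    using ln_power_le[of p m] p2 by (intro mult_left_mono) (auto simp: m_def)
  also have "\<dots> = p * ((8 * real m) ^ m * real n ^ m)"
    by (simp only: power_mult_distrib ac_simps)
  finally have "p ^ d \<le> (8 * real m) ^ m * real n ^ m"
    by (rule mult_left_le_imp_le) (use p2 in simp)
  then show "real (nth_prime n) ^ d \<le> (8 * real (Suc d)) ^ Suc d * real n ^ Suc d"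
    unfolding p_def m_def .
qed

subsection \<open>Iterated differences\<close>

definition fshift :: "real \<times> real \<Rightarrow> (real \<Rightarrow> real \<Rightarrow> real) \<Rightarrow> real \<Rightarrow> real \<Rightarrow> real" where
  "fshift d f = (\<lambda>y x. f (y + fst d) (x + snd d))"

primrec fdiff :: "(real \<times> real) list \<Rightarrow> (real \<Rightarrow> real \<Rightarrow> real) \<Rightarrow> real \<Rightarrow> real \<Rightarrow> real" where
  "fdiff [] f = f"
| "fdiff (d # ds) f = fdiff ds (\<lambda>y x. fshift d f y x - f y x)"

text \<open>Exactly the points at which \<open>fdiff\<close> samples its argument.\<close>

primrec cube_pts :: "(real \<times> real) list \<Rightarrow> real \<Rightarrow> real \<Rightarrow> (real \<times> real) set" where
  "cube_pts [] y x = {(y, x)}"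
| "cube_pts (d # ds) y x = cube_pts ds y x \<union> cube_pts ds (y + fst d) (x + snd d)"

lemma fdiff_add: "fdiff ds (\<lambda>y x. f y x + g y x) y x = fdiff ds f y x + fdiff ds g y x"
proof (induction ds arbitrary: f g)
  case (Cons d ds)
  have "(\<lambda>y x. fshift d (\<lambda>y x. f y x + g y x) y x - (f y x + g y x)) =
      (\<lambda>y x. (fshift d f y x - f y x) + (fshift d g y x - g y x))"
    by (simp add: fshift_def algebra_simps)
  then show ?case by (simp add: Cons)
qed simp

lemma fdiff_cmult: "fdiff ds (\<lambda>y x. c * f y x) y x = c * fdiff ds f y x"
proof (induction ds arbitrary: f)
  case (Cons d ds)
  have "(\<lambda>y x. fshift d (\<lambda>y x. c * f y x) y x - c * f y x) = (\<lambda>y x. c * (fshift d f y x - f y x))"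
    by (simp add: fshift_def algebra_simps)
  then show ?case by (simp add: Cons)
qed simp

lemma fdiff_diff: "fdiff ds (\<lambda>y x. f y x - g y x) y x = fdiff ds f y x - fdiff ds g y x"
  using fdiff_add[of ds f "\<lambda>y x. (-1) * g y x" y x] fdiff_cmult[of ds "-1" g y x] by simp

lemma fdiff_zero: "fdiff ds (\<lambda>y x. 0) y x = 0"
  using fdiff_cmult[of ds 0 "\<lambda>_ _. 0" y x] by simp

lemma fdiff_sum: "fdiff ds (\<lambda>y x. \<Sum>i\<in>A. f i y x) y x = (\<Sum>i\<in>A. fdiff ds (f i) y x)"
  by (induction A rule: infinite_finite_induct) (simp_all add: fdiff_zero fdiff_add)

lemma fdiff_fshift: "fdiff ds (fshift d f) y x = fdiff ds f (y + fst d) (x + snd d)"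
proof (induction ds arbitrary: f)
  case (Cons e ds)
  have "(\<lambda>y x. fshift e (fshift d f) y x - fshift d f y x) = fshift d (\<lambda>y x. fshift e f y x - f y x)"
    by (simp add: fshift_def algebra_simps)
  then show ?case by (simp add: Cons)
qed (simp add: fshift_def)

text \<open>The recursion applies the first direction innermost. Differences commute with shifts, so
  it may also be applied outermost, which suits inductions over the base point.\<close>

lemma fdiff_Cons: "fdiff (d # ds) f y x = fdiff ds f (y + fst d) (x + snd d) - fdiff ds f y x"
  by (simp add: fdiff_diff fdiff_fshift)

lemma fdiff_Ints:
  assumes "\<And>y x. f y x \<in> \<int>"
  shows "fdiff ds f y x \<in> \<int>"
  by (induction ds arbitrary: y x) (simp_all only: fdiff_Cons fdiff.simps(1) assms Ints_diff)

lemma fdiff_cong: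
  assumes "\<And>y' x'. (y', x') \<in> cube_pts ds y x \<Longrightarrow> f y' x' = g y' x'"
  shows "fdiff ds f y x = fdiff ds g y x"
  using assms
proof (induction ds arbitrary: y x)
  case (Cons d ds)
  have "fdiff ds f (y + fst d) (x + snd d) = fdiff ds g (y + fst d) (x + snd d)"
    by (rule Cons.IH) (simp add: Cons.prems)
  moreover have "fdiff ds f y x = fdiff ds g y x"
    by (rule Cons.IH) (simp add: Cons.prems)
  ultimately show ?case unfolding fdiff_Cons by simp
qed simp

lemma fdiff_abs_le:
  assumes "\<And>y' x'. (y', x') \<in> cube_pts ds y x \<Longrightarrow> \<bar>f y' x'\<bar> \<le> c"
  shows "\<bar>fdiff ds f y x\<bar> \<le> 2 ^ length ds * c"
  using assms
proof (induction ds arbitrary: y x)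
  case (Cons d ds)
  have "\<bar>fdiff ds f (y + fst d) (x + snd d)\<bar> \<le> 2 ^ length ds * c" "\<bar>fdiff ds f y x\<bar> \<le> 2 ^ length ds * c"
    using Cons by auto
  moreover have "2 ^ length (d # ds) * c = 2 ^ length ds * c + 2 ^ length ds * c" by simp
  ultimately show ?case unfolding fdiff_Cons by linarith
qed simp

text \<open>All corners lie on the line of slope \<open>l\<close> through the base point, so the
  second variable can be eliminated.\<close>

lemma fdiff_line:
  assumes "\<And>d. d \<in> set ds \<Longrightarrow> snd d = l * fst d"
  shows "fdiff ds f y x = fdiff ds (\<lambda>y' _. f y' (l * y' + (x - l * y))) y x"
  using assms
proof (induction ds arbitrary: y x)
  case (Cons d ds)
  have e: "x + snd d - l * (y + fst d) = x - l * y" using Cons.prems[of d] by (simp add: algebra_simps)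
  have "fdiff ds f (y + fst d) (x + snd d) = fdiff ds (\<lambda>y' _. f y' (l * y' + (x - l * y))) (y + fst d) (x + snd d)"
    using Cons.IH[of "y + fst d" "x + snd d"] Cons.prems unfolding e by simp
  moreover have "fdiff ds f y x = fdiff ds (\<lambda>y' _. f y' (l * y' + (x - l * y))) y x"
    using Cons by simp
  ultimately show ?case unfolding fdiff_Cons by simp
qed simp

lemma coeff_pcompose_diff:
  fixes P :: "'a::comm_ring_1 poly"
  assumes "degree P \<le> Suc d"
  shows "coeff (P \<circ>\<^sub>p [:z, 1:] - P) d = of_nat (Suc d) * z * coeff P (Suc d)"
    "degree (P \<circ>\<^sub>p [:z, 1:] - P) \<le> d"
proof -
  have deg: "degree (R \<circ>\<^sub>p [:z, 1:]) \<le> degree R" for R :: "'a poly"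
    using degree_pcompose_le[of R "[:z, 1:]"] by (simp add: order_trans)
  \<comment> \<open>The vanishing of coefficient \<open>Suc d\<close> is carried along because the
    induction step reads off this coefficient for the shorter polynomial.\<close>
  have "degree P \<le> Suc d \<Longrightarrow> coeff (P \<circ>\<^sub>p [:z, 1:] - P) d = of_nat (Suc d) * z * coeff P (Suc d)
      \<and> coeff (P \<circ>\<^sub>p [:z, 1:] - P) (Suc d) = 0" for d
  proof (induction P arbitrary: d)
    case 0
    then show ?case by simp
  next
    case (pCons c P)
    let ?R = "P \<circ>\<^sub>p [:z, 1:]"
    have eq: "pCons c P \<circ>\<^sub>p [:z, 1:] - pCons c P = smult z ?R + pCons 0 (?R - P)"
      by (simp add: pcompose_pCons algebra_simps)
    have dP: "degree P \<le> d" using pCons by (cases "P = 0") auto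
    have c: "coeff ?R i = 0" if "i > degree P" for i using deg[of P] that by (intro coeff_eq_0) simp
    have top: "coeff ?R d = coeff P d"
    proof (cases d)
      case 0
      then have "P = [:coeff P 0:]" using dP by (metis degree_0_id le_0_eq)
      then show ?thesis using 0 by (metis pcompose_const)
    next
      case (Suc d')
      then show ?thesis using pCons.IH[of d'] dP by simp
    qed
    show ?case
    proof (cases d)
      case 0
      then show ?thesis unfolding eq using dP top c by (simp add: coeff_eq_0)
    next
      case (Suc d')
      have "coeff (?R - P) d' = of_nat (Suc d') * z * coeff P (Suc d')" "coeff (?R - P) d = 0"
        using pCons.IH[of d'] dP Suc by auto
      then show ?thesis unfolding eq using Suc top c dP by (simp add: algebra_simps coeff_eq_0)
    qed
  qed
  from this[OF assms] show "coeff (P \<circ>\<^sub>p [:z, 1:] - P) d = of_nat (Suc d) * z * coeff P (Suc d)"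
    and *: "degree (P \<circ>\<^sub>p [:z, 1:] - P) \<le> d"
  proof -
    assume a: "coeff (P \<circ>\<^sub>p [:z, 1:] - P) d = of_nat (Suc d) * z * coeff P (Suc d)
      \<and> coeff (P \<circ>\<^sub>p [:z, 1:] - P) (Suc d) = 0"
    then show "coeff (P \<circ>\<^sub>p [:z, 1:] - P) d = of_nat (Suc d) * z * coeff P (Suc d)" by blast
    have "degree (P \<circ>\<^sub>p [:z, 1:] - P) \<le> Suc d"
      using degree_diff_le_max[of "P \<circ>\<^sub>p [:z, 1:]" P] deg[of P] assms by simp
    show "degree (P \<circ>\<^sub>p [:z, 1:] - P) \<le> d"
    proof (rule degree_le, intro allI impI)
      fix i assume "d < i"
      then consider "i = Suc d" | "degree (P \<circ>\<^sub>p [:z, 1:] - P) < i"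
        using \<open>degree (P \<circ>\<^sub>p [:z, 1:] - P) \<le> Suc d\<close> by linarith
      then show "coeff (P \<circ>\<^sub>p [:z, 1:] - P) i = 0"
        using a by cases (blast, rule coeff_eq_0)
    qed
  qed
qed

lemma fdiff_poly_fst:
  assumes "degree P < length ds"
  shows "fdiff ds (\<lambda>y x. poly P y) y x = 0"
  using assms
proof (induction ds arbitrary: P)
  case (Cons d ds)
  let ?R = "P \<circ>\<^sub>p [:fst d, 1:] - P"
  have eq: "(\<lambda>y x. fshift d (\<lambda>y x. poly P y) y x - poly P y) = (\<lambda>y x. poly ?R y)"
    by (simp add: fshift_def poly_pcompose add.commute)
  show ?case
  proof (cases "degree P")
    case 0
    then obtain c where "P = [:c:]" by (metis degree_0_id)
    then have "?R = 0" by (simp add: pcompose_const)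
    then show ?thesis unfolding fdiff.simps eq by (simp add: fdiff_zero)
  next
    case (Suc d')
    then have "degree ?R \<le> d'" by (intro coeff_pcompose_diff(2)) simp
    then have "degree ?R < length ds" using Suc Cons.prems by simp
    then show ?thesis unfolding fdiff.simps eq by (rule Cons.IH)
  qed
qed simp

section \<open>Symbol calculus on a cone of points (y, x)\<close>

definition dirs :: "real \<Rightarrow> (real \<times> real) list \<Rightarrow> bool" where
  "dirs B ds \<longleftrightarrow> (\<forall>d\<in>set ds. 1 \<le> fst d \<and> fst d \<le> B \<and> 0 \<le> snd d \<and> snd d \<le> B)"

lemma dirs_Nil: "dirs B []" by (simp add: dirs_def)

lemma dirs_Cons: "dirs B (d # ds) \<longleftrightarrow> 1 \<le> fst d \<and> fst d \<le> B \<and> 0 \<le> snd d \<and> snd d \<le> B \<and> dirs B ds"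
  by (auto simp: dirs_def)

lemma cube_pts_ge:
  assumes "(y', x') \<in> cube_pts ds y x" "dirs B ds"
  shows "y \<le> y'"
  using assms
proof (induction ds arbitrary: y x)
  case (Cons d ds)
  then consider "(y', x') \<in> cube_pts ds y x" | "(y', x') \<in> cube_pts ds (y + fst d) (x + snd d)"
    by auto
  then show ?case
  proof cases
    case 1
    then show ?thesis using Cons by (simp add: dirs_Cons)
  next
    case 2
    then have "y + fst d \<le> y'" using Cons by (simp add: dirs_Cons)
    then show ?thesis using Cons.prems by (simp add: dirs_Cons)
  qed
qed simp

text \<open>\<open>B\<close> bounds slopes and step lengths. As \<open>B\<close> is at least 2,
  numerical constants are absorbed into powers of \<open>B\<close> and only exponents are tracked.
  \<open>B \<le> N\<close> ensures that a shift at most doubles \<open>y\<close>.\<close>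

locale cone =
  fixes B N :: real
  assumes B2: "2 \<le> B" and BN: "B \<le> N"
begin

text \<open>The symbol class of order \<open>m\<close>: each difference lowers the order of growth by one,
  on a cone that is invariant under the shifts.\<close>
definition symb :: "nat \<Rightarrow> int \<Rightarrow> nat \<Rightarrow> (real \<Rightarrow> real \<Rightarrow> real) \<Rightarrow> bool" where
  "symb c m E f \<longleftrightarrow> (\<forall>ds y x. length ds \<le> c \<longrightarrow> dirs B ds \<longrightarrow> N \<le> y \<longrightarrow> 0 \<le> x \<longrightarrow> x \<le> B * y \<longrightarrow>
     \<bar>fdiff ds f y x\<bar> \<le> B ^ E * y powr (real_of_int m - real (length ds)))"

lemma symbD:
  assumes "symb c m E f" "length ds \<le> c" "dirs B ds" "N \<le> y" "0 \<le> x" "x \<le> B * y"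
  shows "\<bar>fdiff ds f y x\<bar> \<le> B ^ E * y powr (real_of_int m - real (length ds))"
  using assms unfolding symb_def by blast

lemma Bge1: "1 \<le> B ^ e" using B2 by (intro one_le_power) simp

lemma Bmono: "e \<le> e' \<Longrightarrow> B ^ e \<le> B ^ e'" using B2 by (intro power_increasing) auto

lemma le_Bpow: "real n \<le> B ^ n"
proof -
  have "real n \<le> 2 ^ n" using less_exp[of n] by (metis less_imp_le of_nat_le_iff of_nat_numeral of_nat_power)
  also have "\<dots> \<le> B ^ n" using B2 by (intro power_mono) auto
  finally show ?thesis .
qed

lemma N1: "2 \<le> N" using B2 BN by simp

lemma symb_mono:
  assumes "symb c m E f" "c' \<le> c" "m \<le> m'" "E \<le> E'"
  shows "symb c' m' E' f"
  unfolding symb_def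
proof (intro allI impI)
  fix ds and y x :: real assume a: "length ds \<le> c'" "dirs B ds" "N \<le> y" "0 \<le> x" "x \<le> B * y"
  have "\<bar>fdiff ds f y x\<bar> \<le> B ^ E * y powr (real_of_int m - real (length ds))"
    using symbD[OF assms(1)] a assms(2) by simp
  also have "\<dots> \<le> B ^ E' * y powr (real_of_int m' - real (length ds))"
    using assms a(3) N1 B2 by (intro mult_mono Bmono powr_mono) auto
  finally show "\<bar>fdiff ds f y x\<bar> \<le> B ^ E' * y powr (real_of_int m' - real (length ds))" .
qed

text \<open>For a nonnegative exponent the doubling of \<open>y\<close> costs at most
  \<open>2 ^ nat m\<close>; for a negative one, moving outwards only helps. The cone is preserved
  since \<open>fst d \<ge> 1\<close> and \<open>snd d \<le> B\<close>.\<close>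

lemma symb_fshift:
  assumes "symb c m E f" "dirs B [d]"
  shows "symb c m (E + nat m) (fshift d f)"
  unfolding symb_def
proof (intro allI impI)
  fix ds and y x :: real assume a: "length ds \<le> c" "dirs B ds" "N \<le> y" "0 \<le> x" "x \<le> B * y"
  have d: "1 \<le> fst d" "fst d \<le> B" "0 \<le> snd d" "snd d \<le> B" using assms(2) by (auto simp: dirs_Cons)
  have y: "2 \<le> y" "B \<le> y" using a N1 BN by auto
  define e where "e = real_of_int m - real (length ds)"
  have "B * 1 \<le> B * fst d" using d B2 by (intro mult_left_mono) auto
  then have "x + snd d \<le> B * (y + fst d)" using a d unfolding distrib_left by linarith
  then have "\<bar>fdiff ds (fshift d f) y x\<bar> \<le> B ^ E * (y + fst d) powr e"
    unfolding fdiff_fshift e_def using a d by (intro symbD[OF assms(1)]) auto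
  also have "(y + fst d) powr e \<le> B ^ nat m * y powr e"
  proof (cases "e \<ge> 0")
    case True
    have "(y + fst d) powr e \<le> (2 * y) powr e" using True y d by (intro powr_mono2) auto
    also have "\<dots> = 2 powr e * y powr e" using y by (simp add: powr_mult)
    also have "2 powr e \<le> 2 powr real (nat m)" unfolding e_def by (intro powr_mono) auto
    also have "\<dots> = 2 ^ nat m" by (simp add: powr_realpow)
    also have "\<dots> \<le> B ^ nat m" using B2 by (intro power_mono) auto
    finally show ?thesis by (simp add: mult_right_mono)
  next
    case False
    have "(y + fst d) powr e \<le> y powr e" using False y d by (intro powr_mono2') auto
    also have "\<dots> \<le> B ^ nat m * y powr e" using Bge1[of "nat m"] mult_right_mono[of 1 "B ^ nat m" "y powr e"] by simp
    finally show ?thesis .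
  qed
  then have "B ^ E * (y + fst d) powr e \<le> B ^ (E + nat m) * y powr e"
    using B2 by (simp add: power_add mult.assoc mult_left_mono)
  finally show "\<bar>fdiff ds (fshift d f) y x\<bar> \<le> B ^ (E + nat m) * y powr (real_of_int m - real (length ds))"
    unfolding e_def .
qed

lemma symb_diff1:
  assumes "symb (Suc c) m E f" "dirs B [d]"
  shows "symb c (m - 1) E (\<lambda>y x. fshift d f y x - f y x)"
  unfolding symb_def
proof (intro allI impI)
  fix ds and y x :: real assume a: "length ds \<le> c" "dirs B ds" "N \<le> y" "0 \<le> x" "x \<le> B * y"
  have "\<bar>fdiff (d # ds) f y x\<bar> \<le> B ^ E * y powr (real_of_int m - real (length (d # ds)))"
    using a assms(2) by (intro symbD[OF assms(1)]) (auto simp: dirs_Cons)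
  then show "\<bar>fdiff ds (\<lambda>y x. fshift d f y x - f y x) y x\<bar> \<le> B ^ E * y powr (real_of_int (m - 1) - real (length ds))"
    by (simp add: algebra_simps)
qed

text \<open>Leibniz rule: each difference falls on one factor and lowers its order by one. It costs
  \<open>M\<close> powers of \<open>B\<close> for shifting the other factor and one more for having
  two summands. \<open>M\<close> is separate from \<open>m\<close> because the order of
  \<open>f\<close> drops during the induction while the cost per difference has to stay
  fixed.\<close>

lemma fdiff_mult_bound:
  assumes "symb (length ds) m E f" "symb (length ds) m' E' g" "nat m \<le> M"
    "dirs B ds" "N \<le> y" "0 \<le> x" "x \<le> B * y"
  shows "\<bar>fdiff ds (\<lambda>y x. f y x * g y x) y x\<bar>
      \<le> B ^ (E + E' + length ds * Suc M) * y powr (real_of_int (m + m') - real (length ds))"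
  using assms
proof (induction ds arbitrary: f g m m' E E')
  case Nil
  have "\<bar>f y x\<bar> \<le> B ^ E * y powr m" "\<bar>g y x\<bar> \<le> B ^ E' * y powr m'"
    using symbD[OF Nil(1), of "[]" y x] symbD[OF Nil(2), of "[]" y x] Nil by (auto simp: dirs_Nil)
  then have "\<bar>f y x\<bar> * \<bar>g y x\<bar> \<le> (B ^ E * y powr m) * (B ^ E' * y powr m')"
    using B2 by (intro mult_mono) auto
  also have "\<dots> = B ^ (E + E') * y powr (real_of_int (m + m'))"
    by (simp add: power_add powr_add)
  finally show ?case by (simp add: abs_mult)
next
  case (Cons d ds)
  let ?F = "\<lambda>y x. fshift d f y x - f y x" and ?G = "\<lambda>y x. fshift d g y x - g y x"
  let ?l = "length ds"
  have d: "dirs B [d]" "dirs B ds" using Cons.prems(4) by (auto simp: dirs_Cons dirs_Nil)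
  have eq: "(\<lambda>y x. fshift d (\<lambda>y x. f y x * g y x) y x - f y x * g y x) =
      (\<lambda>y x. fshift d f y x * ?G y x + ?F y x * g y x)"
    by (simp add: fshift_def algebra_simps)
  have f: "symb (Suc ?l) m E f" "symb (Suc ?l) m' E' g" using Cons.prems by auto
  have s: "symb ?l m (E + M) (fshift d f)" "symb ?l (m' - 1) E' ?G" "symb ?l (m - 1) E ?F" "symb ?l m' E' g"
  proof -
    show "symb ?l m (E + M) (fshift d f)"
      using symb_fshift[OF f(1) d(1)] by (rule symb_mono) (use Cons.prems in auto)
    show "symb ?l (m' - 1) E' ?G" using symb_diff1[OF f(2) d(1)] .
    show "symb ?l (m - 1) E ?F" using symb_diff1[OF f(1) d(1)] .
    show "symb ?l m' E' g" using f(2) by (rule symb_mono) auto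
  qed
  define P where "P = y powr (real_of_int (m + m') - real (Suc ?l))"
  define b where "b = B ^ (E + M + E' + ?l * Suc M)"
  have b1: "\<bar>fdiff ds (\<lambda>y x. fshift d f y x * ?G y x) y x\<bar> \<le> b * P"
    using Cons.IH[OF s(1) s(2)] Cons.prems d by (simp add: P_def b_def algebra_simps)
  have "\<bar>fdiff ds (\<lambda>y x. ?F y x * g y x) y x\<bar> \<le> B ^ (E + E' + ?l * Suc M) * P"
    using Cons.IH[OF s(3) s(4)] Cons.prems d by (simp add: P_def algebra_simps)
  also have "\<dots> \<le> b * P" unfolding b_def P_def by (intro mult_right_mono Bmono) auto
  finally have b2: "\<bar>fdiff ds (\<lambda>y x. ?F y x * g y x) y x\<bar> \<le> b * P" .
  have "\<bar>fdiff (d # ds) (\<lambda>y x. f y x * g y x) y x\<bar> \<le> 2 * (b * P)"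
    unfolding fdiff.simps eq fdiff_add using b1 b2 by linarith
  also have "\<dots> \<le> B * (b * P)" using B2 by (intro mult_right_mono) (auto simp: b_def P_def)
  also have "\<dots> = B ^ (E + E' + length (d # ds) * Suc M) * P"
    unfolding b_def by (simp add: power_add power_mult mult_ac)
  finally show ?case by (simp add: P_def)
qed

lemma symb_mult:
  assumes "symb c m E f" "symb c m' E' g"
  shows "symb c (m + m') (E + E' + c * Suc (nat m)) (\<lambda>y x. f y x * g y x)"
  unfolding symb_def
proof (intro allI impI)
  fix ds and y x :: real assume a: "length ds \<le> c" "dirs B ds" "N \<le> y" "0 \<le> x" "x \<le> B * y"
  have s: "symb (length ds) m E f" "symb (length ds) m' E' g"
    using assms a(1) by (auto elim: symb_mono)
  have "\<bar>fdiff ds (\<lambda>y x. f y x * g y x) y x\<bar>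
      \<le> B ^ (E + E' + length ds * Suc (nat m)) * y powr (real_of_int (m + m') - real (length ds))"
    using fdiff_mult_bound[OF s order_refl a(2-5)] .
  also have "\<dots> \<le> B ^ (E + E' + c * Suc (nat m)) * y powr (real_of_int (m + m') - real (length ds))"
    using a by (intro mult_right_mono Bmono add_left_mono mult_le_mono1) auto
  finally show "\<bar>fdiff ds (\<lambda>y x. f y x * g y x) y x\<bar>
      \<le> B ^ (E + E' + c * Suc (nat m)) * y powr (real_of_int (m + m') - real (length ds))" .
qed

lemma symb_add:
  assumes "symb c m E f" "symb c m E g"
  shows "symb c m (Suc E) (\<lambda>y x. f y x + g y x)"
  unfolding symb_def
proof (intro allI impI)
  fix ds and y x :: real assume a: "length ds \<le> c" "dirs B ds" "N \<le> y" "0 \<le> x" "x \<le> B * y"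
  define P where "P = B ^ E * y powr (real_of_int m - real (length ds))"
  have "\<bar>fdiff ds (\<lambda>y x. f y x + g y x) y x\<bar> \<le> 2 * P"
    unfolding fdiff_add P_def using symbD[OF assms(1) a] symbD[OF assms(2) a] by linarith
  also have "\<dots> \<le> B * P" using B2 by (intro mult_right_mono) (auto simp: P_def)
  finally show "\<bar>fdiff ds (\<lambda>y x. f y x + g y x) y x\<bar> \<le> B ^ Suc E * y powr (real_of_int m - real (length ds))"
    by (simp add: P_def)
qed

lemma symb_zero: "symb c m E (\<lambda>y x. 0)"
  using B2 by (auto simp: symb_def fdiff_zero)

lemma symb_sum:
  assumes "finite A" "\<And>i. i \<in> A \<Longrightarrow> symb c m E (f i)"
  shows "symb c m (E + card A) (\<lambda>y x. \<Sum>i\<in>A. f i y x)"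
  using assms
proof (induction A rule: finite_induct)
  case empty
  then show ?case by (simp add: symb_zero)
next
  case (insert a A)
  have "symb c m E (f a)" using insert by blast
  then have "symb c m (E + card A) (f a)" by (rule symb_mono) auto
  moreover have "symb c m (E + card A) (\<lambda>y x. \<Sum>i\<in>A. f i y x)"
    using insert by blast
  ultimately have "symb c m (E + card A) (f a)" "symb c m (E + card A) (\<lambda>y x. \<Sum>i\<in>A. f i y x)" .
  from symb_add[OF this] show ?case using insert by simp
qed

lemma symb_cmult:
  assumes "symb c m E f" "\<bar>a\<bar> \<le> B ^ E'"
  shows "symb c m (E' + E) (\<lambda>y x. a * f y x)"
  unfolding symb_def
proof (intro allI impI)
  fix ds and y x :: real assume h: "length ds \<le> c" "dirs B ds" "N \<le> y" "0 \<le> x" "x \<le> B * y"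
  have "\<bar>a\<bar> * \<bar>fdiff ds f y x\<bar> \<le> B ^ E' * (B ^ E * y powr (real_of_int m - real (length ds)))"
    using symbD[OF assms(1) h] assms(2) B2 by (intro mult_mono) auto
  then show "\<bar>fdiff ds (\<lambda>y x. a * f y x) y x\<bar> \<le> B ^ (E' + E) * y powr (real_of_int m - real (length ds))"
    by (simp add: fdiff_cmult abs_mult power_add mult.assoc)
qed

lemma symb_one: "symb c 0 0 (\<lambda>y x. 1)"
  unfolding symb_def
proof (intro allI impI)
  fix ds and y x :: real assume "N \<le> y"
  then show "\<bar>fdiff ds (\<lambda>y x. 1) y x\<bar> \<le> B ^ 0 * y powr (real_of_int 0 - real (length ds))"
    using N1 by (cases ds) (simp_all add: fshift_def fdiff_zero)
qed

lemma fdiff_affine: "length ds \<ge> 2 \<Longrightarrow> fdiff ds (\<lambda>y x. y * a + x * b + c) y x = 0"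
proof (cases ds)
  case (Cons d ds')
  assume "length ds \<ge> 2"
  then obtain e ds'' where ds': "ds' = e # ds''" using Cons by (cases ds') auto
  show ?thesis unfolding Cons ds' by (simp add: fshift_def algebra_simps fdiff_zero)
qed simp

lemma symb_affine:
  assumes "\<And>y x. N \<le> y \<Longrightarrow> 0 \<le> x \<Longrightarrow> x \<le> B * y \<Longrightarrow> \<bar>y * a + x * b + k\<bar> \<le> B ^ E * y"
    "\<And>d. dirs B [d] \<Longrightarrow> \<bar>fst d * a + snd d * b\<bar> \<le> B ^ E"
  shows "symb c 1 E (\<lambda>y x. y * a + x * b + k)"
  unfolding symb_def
proof (intro allI impI)
  fix ds and y x :: real assume h: "length ds \<le> c" "dirs B ds" "N \<le> y" "0 \<le> x" "x \<le> B * y"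
  have y: "y > 0" using h N1 by simp
  consider "ds = []" | d where "ds = [d]" | "length ds \<ge> 2"
    by (cases ds; cases "tl ds") auto
  then show "\<bar>fdiff ds (\<lambda>y x. y * a + x * b + k) y x\<bar> \<le> B ^ E * y powr (real_of_int 1 - real (length ds))"
  proof cases
    case 1
    then show ?thesis using assms(1)[OF h(3-5)] y by simp
  next
    case 2
    then show ?thesis using assms(2)[of d] h y by (simp add: fshift_def algebra_simps)
  next
    case 3
    then show ?thesis using B2 by (simp add: fdiff_affine)
  qed
qed

lemma symb_snd:
  assumes "0 \<le> b" "b \<le> B"
  shows "symb c 1 2 (\<lambda>y x. x + b)"
proof -
  have "symb c 1 2 (\<lambda>y x. y * 0 + x * 1 + b)"
  proof (rule symb_affine)
    fix y x assume h: "N \<le> y" "0 \<le> x" "x \<le> B * y"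
    have "B * 1 \<le> B * y" using h N1 B2 by (intro mult_left_mono) auto
    then have "x + b \<le> 2 * (B * y)" using h assms by linarith
    also have "\<dots> \<le> B * (B * y)" using B2 h N1 by (intro mult_right_mono) auto
    finally show "\<bar>y * 0 + x * 1 + b\<bar> \<le> B ^ 2 * y" using h assms by (simp add: power2_eq_square)
  next
    fix d :: "real \<times> real" assume "dirs B [d]"
    then have "\<bar>fst d * 0 + snd d * 1\<bar> \<le> B ^ 1" by (simp add: dirs_Cons)
    also have "\<dots> \<le> B ^ 2" by (intro Bmono) simp
    finally show "\<bar>fst d * 0 + snd d * 1\<bar> \<le> B ^ 2" .
  qed
  then show ?thesis by simp
qed

lemma fdiff_inverse_Cons:
  assumes "dirs B (d # ds)" "N \<le> y" "0 \<le> a"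
  shows "fdiff (d # ds) (\<lambda>y x. 1 / (y + a)) y x = - fst d * fdiff ds (\<lambda>y x. 1 / (y + a) * (1 / (y + (a + fst d)))) y x"
proof -
  have d: "1 \<le> fst d" "dirs B ds" using assms by (auto simp: dirs_Cons)
  have "fdiff (d # ds) (\<lambda>y x. 1 / (y + a)) y x = fdiff ds (\<lambda>y x. - fst d * (1 / (y + a) * (1 / (y + (a + fst d))))) y x"
    unfolding fdiff.simps
  proof (rule fdiff_cong)
    fix y' x' assume "(y', x') \<in> cube_pts ds y x"
    then have "y \<le> y'" using cube_pts_ge d(2) by blast
    then have nz: "y' + a > 0" "y' + a + fst d > 0" using assms N1 d by auto
    then have "1 / (y' + a + fst d) - 1 / (y' + a) = - fst d / ((y' + a) * (y' + a + fst d))"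
      by (simp add: field_simps)
    then show "fshift d (\<lambda>y x. 1 / (y + a)) y' x' - 1 / (y' + a) = - fst d * (1 / (y' + a) * (1 / (y' + (a + fst d))))"
      by (simp add: fshift_def algebra_simps)
  qed
  then show ?thesis by (simp only: fdiff_cmult)
qed

text \<open>A difference of the inverse is \<open>- fst d\<close> times a product of two inverses.
  So the exponent for \<open>Suc c\<close> has to be at least \<open>1 + 2 * 4 ^ c + c\<close>, and
  \<open>4 ^ Suc c\<close> is.\<close>

lemma symb_inverse:
  assumes "0 \<le> a"
  shows "symb c (-1) (4 ^ c) (\<lambda>y x. 1 / (y + a))"
  using assms
proof (induction c arbitrary: a)
  case 0
  show ?case unfolding symb_def
  proof (intro allI impI)
    fix ds :: "(real \<times> real) list" and y x :: real assume h: "length ds \<le> 0" "dirs B ds" "N \<le> y" "0 \<le> x" "x \<le> B * y"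
    have "1 / (y + a) \<le> 1 / y" using h N1 0 by (intro divide_left_mono) auto
    also have "\<dots> \<le> B * (1 / y)" using h N1 B2 mult_right_mono[of 1 B "1 / y"] by simp
    finally show "\<bar>fdiff ds (\<lambda>y x. 1 / (y + a)) y x\<bar> \<le> B ^ 4 ^ 0 * y powr (real_of_int (- 1) - real (length ds))"
      using h N1 0 by (simp add: powr_minus_divide)
  qed
next
  case (Suc c)
  show ?case unfolding symb_def
  proof (intro allI impI)
    fix ds :: "(real \<times> real) list" and y x :: real assume h: "length ds \<le> Suc c" "dirs B ds" "N \<le> y" "0 \<le> x" "x \<le> B * y"
    show "\<bar>fdiff ds (\<lambda>y x. 1 / (y + a)) y x\<bar> \<le> B ^ 4 ^ Suc c * y powr (real_of_int (- 1) - real (length ds))"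
    proof (cases ds)
      case Nil
      have "\<bar>fdiff ds (\<lambda>y x. 1 / (y + a)) y x\<bar> \<le> B ^ 4 ^ c * y powr (real_of_int (- 1) - real (length ds))"
        using Nil h by (intro symbD[OF Suc.IH]) (auto simp: Suc.prems)
      also have "\<dots> \<le> B ^ 4 ^ Suc c * y powr (real_of_int (- 1) - real (length ds))"
        by (intro mult_right_mono Bmono power_increasing) auto
      finally show ?thesis .
    next
      case (Cons d ds')
      have d: "1 \<le> fst d" "fst d \<le> B" "dirs B ds'" using h Cons by (auto simp: dirs_Cons)
      have "fdiff ds (\<lambda>y x. 1 / (y + a)) y x = fdiff ds' (\<lambda>y x. - fst d * (1 / (y + a) * (1 / (y + (a + fst d))))) y x"
        using fdiff_inverse_Cons[of d ds' y a x] h Suc.prems unfolding Cons by (simp only: fdiff_cmult)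
      moreover have "symb c (-1 + -1) (1 + (4 ^ c + 4 ^ c + c * Suc (nat (-1)))) (\<lambda>y x. - fst d * (1 / (y + a) * (1 / (y + (a + fst d)))))"
        using Suc d by (intro symb_cmult symb_mult) auto
      ultimately have "\<bar>fdiff ds (\<lambda>y x. 1 / (y + a)) y x\<bar> \<le> B ^ (1 + (4 ^ c + 4 ^ c + c)) * y powr (real_of_int (-1 + -1) - real (length ds'))"
        using symbD[of c "-1 + -1" "1 + (4 ^ c + 4 ^ c + c * Suc (nat (-1)))"] h d Cons by simp
      also have "\<dots> \<le> B ^ 4 ^ Suc c * y powr (real_of_int (-1 + -1) - real (length ds'))"
      proof (intro mult_right_mono Bmono)
        have "c < 4 ^ c" by (rule less_exp[THEN less_le_trans]) (simp add: power_mono)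
        then show "1 + (4 ^ c + 4 ^ c + c) \<le> (4 :: nat) ^ Suc c" by simp
      qed auto
      also have "real_of_int (-1 + -1) - real (length ds') = real_of_int (-1) - real (length ds)"
        using Cons by simp
      finally show ?thesis .
    qed
  qed
qed

lemma symb_power:
  assumes "symb c 1 E f"
  shows "symb c (int e) (e * (E + 2 * c)) (\<lambda>y x. f y x ^ e)"
proof (induction e)
  case 0
  then show ?case using symb_one by simp
next
  case (Suc e)
  have "symb c (1 + int e) (E + e * (E + 2 * c) + c * Suc (nat 1)) (\<lambda>y x. f y x * f y x ^ e)"
    by (intro symb_mult assms Suc)
  then show ?case by (simp add: algebra_simps)
qed

lemma symb_prod_inverse:
  assumes "0 \<le> a"
  shows "symb c (- int (Suc j)) (Suc j * (4 ^ c + c)) (\<lambda>y x. \<Prod>i\<le>j. 1 / (y + a + real i))"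
proof (induction j)
  case 0
  have "symb c (-1) (4 ^ c + c) (\<lambda>y x. 1 / (y + a))"
    using symb_inverse[OF assms] by (rule symb_mono) auto
  then show ?case by simp
next
  case (Suc j)
  have "symb c (-1) (4 ^ c) (\<lambda>y x. 1 / (y + (a + real (Suc j))))"
    using assms by (intro symb_inverse) auto
  from symb_mult[OF Suc this] have "symb c (- int (Suc j) + -1) (Suc j * (4 ^ c + c) + 4 ^ c + c)
      (\<lambda>y x. \<Prod>i\<le>Suc j. 1 / (y + a + real i))"
    by (simp add: add.assoc)
  moreover have "- int (Suc j) + -1 = - int (Suc (Suc j))" by simp
  moreover have "Suc j * (4 ^ c + c) + 4 ^ c + c = Suc (Suc j) * (4 ^ c + c)" by simp
  ultimately show ?case by (simp only:)
qed

end

section \<open>Complete monotonicity and lower bounds for differences\<close>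

context cone
begin

text \<open>Discrete complete monotonicity. The symbol classes only give upper bounds; this class
  provides the lower bound for the main term.\<close>

definition cmono :: "nat \<Rightarrow> (real \<Rightarrow> real \<Rightarrow> real) \<Rightarrow> bool" where
  "cmono c f \<longleftrightarrow> (\<forall>ds y x. length ds \<le> c \<longrightarrow> dirs B ds \<longrightarrow> N \<le> y \<longrightarrow> 0 \<le> (-1) ^ length ds * fdiff ds f y x)"

lemma cmonoD: "cmono c f \<Longrightarrow> length ds \<le> c \<Longrightarrow> dirs B ds \<Longrightarrow> N \<le> y \<Longrightarrow> 0 \<le> (-1) ^ length ds * fdiff ds f y x"
  unfolding cmono_def by blast

lemma cmono_mono: "cmono c f \<Longrightarrow> c' \<le> c \<Longrightarrow> cmono c' f"
  unfolding cmono_def by (meson le_trans)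

lemma cmono_fshift:
  assumes "cmono c f" "dirs B [d]"
  shows "cmono c (fshift d f)"
  unfolding cmono_def fdiff_fshift
proof (intro allI impI)
  fix ds and y x :: real assume "length ds \<le> c" "dirs B ds" "N \<le> y"
  then show "0 \<le> (-1) ^ length ds * fdiff ds f (y + fst d) (x + snd d)"
    using assms(2) by (intro cmonoD[OF assms(1)]) (auto simp: dirs_Cons)
qed

lemma cmono_diff1:
  assumes "cmono (Suc c) f" "dirs B [d]"
  shows "cmono c (\<lambda>y x. f y x - fshift d f y x)"
  unfolding cmono_def
proof (intro allI impI)
  fix ds and y x :: real assume "length ds \<le> c" "dirs B ds" "N \<le> y"
  then have "0 \<le> (-1) ^ length (d # ds) * fdiff (d # ds) f y x"
    using assms(2) by (intro cmonoD[OF assms(1)]) (auto simp: dirs_Cons)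
  then show "0 \<le> (-1) ^ length ds * fdiff ds (\<lambda>y x. f y x - fshift d f y x) y x"
    by (simp add: fdiff_diff right_diff_distrib)
qed

text \<open>The Leibniz rule arranged so that both summands are nonnegative for completely monotone
  factors.\<close>

lemma fdiff_Cons_mult:
  "(-1) ^ length (d # ds) * fdiff (d # ds) (\<lambda>y x. f y x * g y x) y x =
    (-1) ^ length ds * fdiff ds (\<lambda>y x. (f y x - fshift d f y x) * fshift d g y x) y x +
    (-1) ^ length ds * fdiff ds (\<lambda>y x. f y x * (g y x - fshift d g y x)) y x"
proof -
  have "(\<lambda>y x. fshift d (\<lambda>y x. f y x * g y x) y x - f y x * g y x) =
     (\<lambda>y x. (-1) * ((f y x - fshift d f y x) * fshift d g y x + f y x * (g y x - fshift d g y x)))"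
    by (simp add: fshift_def algebra_simps)
  then show ?thesis
    by (simp only: fdiff.simps fdiff_cmult fdiff_add length_Cons power_Suc) (simp add: algebra_simps)
qed

lemma cmono_mult_nonneg:
  assumes "cmono (length ds) f" "cmono (length ds) g" "dirs B ds" "N \<le> y"
  shows "0 \<le> (-1) ^ length ds * fdiff ds (\<lambda>y x. f y x * g y x) y x"
  using assms
proof (induction ds arbitrary: f g)
  case Nil
  have "0 \<le> f y x" "0 \<le> g y x"
    using cmonoD[OF Nil(1), of "[]"] cmonoD[OF Nil(2), of "[]"] Nil by (auto simp: dirs_Nil)
  then show ?case by simp
next
  case (Cons d ds)
  have d: "dirs B [d]" "dirs B ds" using Cons.prems by (auto simp: dirs_Cons dirs_Nil)
  have c: "cmono (Suc (length ds)) f" "cmono (Suc (length ds)) g" using Cons.prems by auto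
  show ?case unfolding fdiff_Cons_mult
    using Cons.prems d c
    by (intro add_nonneg_nonneg Cons.IH cmono_diff1 cmono_fshift) (auto elim: cmono_mono)
qed

lemma cmono_mult: "cmono c f \<Longrightarrow> cmono c g \<Longrightarrow> cmono c (\<lambda>y x. f y x * g y x)"
  unfolding cmono_def[of _ "\<lambda>y x. f y x * g y x"]
  by (auto intro!: cmono_mult_nonneg elim: cmono_mono)

text \<open>By monotonicity, the term in which every difference falls on \<open>f\<close> is a lower bound.\<close>
lemma cmono_mult_lower:
  assumes "cmono (length ds) f" "cmono (length ds) g" "dirs B ds" "N \<le> y"
  shows "(-1) ^ length ds * fdiff ds f y x * g (y + sum_list (map fst ds)) (x + sum_list (map snd ds))
     \<le> (-1) ^ length ds * fdiff ds (\<lambda>y x. f y x * g y x) y x"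
  using assms
proof (induction ds arbitrary: f g)
  case Nil
  then show ?case by simp
next
  case (Cons d ds)
  have d: "dirs B [d]" "dirs B ds" using Cons.prems by (auto simp: dirs_Cons dirs_Nil)
  have c: "cmono (Suc (length ds)) f" "cmono (Suc (length ds)) g" using Cons.prems by auto
  have c': "cmono (length ds) f" "cmono (length ds) (fshift d g)"
    using c d by (auto elim: cmono_mono intro!: cmono_fshift)
  have "(-1) ^ length (d # ds) * fdiff (d # ds) f y x * g (y + sum_list (map fst (d # ds))) (x + sum_list (map snd (d # ds)))
    = (-1) ^ length ds * fdiff ds (\<lambda>y x. f y x - fshift d f y x) y x
      * fshift d g (y + sum_list (map fst ds)) (x + sum_list (map snd ds))"
    by (simp add: fdiff_diff fshift_def algebra_simps)
  also have "\<dots> \<le> (-1) ^ length ds * fdiff ds (\<lambda>y x. (f y x - fshift d f y x) * fshift d g y x) y x"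
    using Cons.prems c' d c by (intro Cons.IH cmono_diff1) auto
  also have "\<dots> \<le> \<dots> + (-1) ^ length ds * fdiff ds (\<lambda>y x. f y x * (g y x - fshift d g y x)) y x"
    using cmono_mult_nonneg[OF c'(1) cmono_diff1[OF c(2) d(1)] d(2) Cons.prems(4)] by simp
  also have "\<dots> = (-1) ^ length (d # ds) * fdiff (d # ds) (\<lambda>y x. f y x * g y x) y x"
    by (rule fdiff_Cons_mult[symmetric])
  finally show ?case .
qed

lemma cmono_inverse:
  assumes "0 \<le> a"
  shows "cmono c (\<lambda>y x. 1 / (y + a))"
  using assms
proof (induction c arbitrary: a)
  case 0
  then show ?case using N1 by (auto simp: cmono_def)
next
  case (Suc c)
  show ?case unfolding cmono_def
  proof (intro allI impI)
    fix ds and y x :: real assume h: "length ds \<le> Suc c" "dirs B ds" "N \<le> y"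
    show "0 \<le> (-1) ^ length ds * fdiff ds (\<lambda>y x. 1 / (y + a)) y x"
    proof (cases ds)
      case Nil
      then show ?thesis using cmonoD[OF Suc.IH, of a ds y x] Suc.prems h by simp
    next
      case (Cons d ds')
      have d: "1 \<le> fst d" "dirs B ds'" using h Cons by (auto simp: dirs_Cons)
      have "cmono c (\<lambda>y x. 1 / (y + a) * (1 / (y + (a + fst d))))"
        using Suc d by (intro cmono_mult) auto
      then have "0 \<le> (-1) ^ length ds' * fdiff ds' (\<lambda>y x. 1 / (y + a) * (1 / (y + (a + fst d)))) y x"
        using h d Cons by (intro cmonoD) auto
      then have "0 \<le> fst d * ((-1) ^ length ds' * fdiff ds' (\<lambda>y x. 1 / (y + a) * (1 / (y + (a + fst d)))) y x)"
        by (rule mult_nonneg_nonneg[rotated]) (use d in simp)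
      also have "\<dots> = (-1) ^ length ds * fdiff ds (\<lambda>y x. 1 / (y + a)) y x"
        using fdiff_inverse_Cons[of d ds' y a x] h Suc.prems Cons by simp
      finally show ?thesis .
    qed
  qed
qed

text \<open>The discrete counterpart of the derivatives of \<open>1 / y\<close>. One difference
  produces a product of two inverses; letting all remaining differences fall on the first and
  evaluating the second at the far corner gives one more power of the inverse there. The factors
  \<open>fst d \<ge> 1\<close> are discarded.\<close>

lemma fdiff_inverse_lower:
  assumes "dirs B ds" "N \<le> y" "0 \<le> a"
  shows "1 / (y + a + sum_list (map fst ds)) ^ Suc (length ds) \<le> (-1) ^ length ds * fdiff ds (\<lambda>y x. 1 / (y + a)) y x"
  using assms
proof (induction ds)
  case Nil
  then show ?case by simp
next
  case (Cons d ds)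
  have d: "1 \<le> fst d" "dirs B ds" using Cons.prems by (auto simp: dirs_Cons)
  define S where "S = y + a + sum_list (map fst (d # ds))"
  define S' where "S' = y + a + sum_list (map fst ds)"
  have "0 \<le> sum_list (map fst ds)" using d(2) by (intro sum_list_nonneg) (force simp: dirs_def)
  then have S: "0 < S'" "S' \<le> S" using Cons.prems d N1 by (auto simp: S_def S'_def)
  have "1 / S ^ Suc (length (d # ds)) = 1 / S ^ Suc (length ds) * (1 / S)" by simp
  also have "\<dots> \<le> 1 / S' ^ Suc (length ds) * (1 / S)"
    using S by (intro mult_right_mono divide_left_mono power_mono) auto
  also have "\<dots> \<le> (-1) ^ length ds * fdiff ds (\<lambda>y x. 1 / (y + a)) y x * (1 / S)"
    using Cons.IH[OF d(2) Cons.prems(2,3)] S by (intro mult_right_mono) (auto simp: S'_def)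
  also have "1 / S = 1 / (y + sum_list (map fst ds) + (a + fst d))"
    by (simp add: S_def algebra_simps)
  also have "(-1) ^ length ds * fdiff ds (\<lambda>y x. 1 / (y + a)) y x * \<dots>
      \<le> (-1) ^ length ds * fdiff ds (\<lambda>y x. 1 / (y + a) * (1 / (y + (a + fst d)))) y x"
    using Cons.prems d by (intro cmono_mult_lower[where x = x and g = "\<lambda>y x. 1 / (y + (a + fst d))"] cmono_inverse) auto
  also have "\<dots> \<le> fst d * \<dots>"
  proof -
    have "0 \<le> (-1) ^ length ds * fdiff ds (\<lambda>y x. 1 / (y + a) * (1 / (y + (a + fst d)))) y x"
      using Cons.prems d by (intro cmono_mult_nonneg cmono_inverse) auto
    then show ?thesis using d(1) mult_right_mono[of 1 "fst d"] by fastforce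
  qed
  also have "\<dots> = (-1) ^ length (d # ds) * fdiff (d # ds) (\<lambda>y x. 1 / (y + a)) y x"
    unfolding fdiff_inverse_Cons[OF Cons.prems] by simp
  finally show ?case unfolding S_def .
qed

end

subsection \<open>Differences along weighted pairs\<close>

text \<open>For a pair \<open>(a, b)\<close> this is a discrete derivative along
  \<open>fst b * a - fst a * b\<close>, a vector whose first coordinate is 0 and whose second is the
  determinant that vanishes when \<open>a\<close> and \<open>b\<close> are parallel.\<close>

primrec nabla :: "((real \<times> real) \<times> (real \<times> real)) list \<Rightarrow> (real \<Rightarrow> real \<Rightarrow> real) \<Rightarrow> real \<Rightarrow> real \<Rightarrow> real" where
  "nabla [] f = f"
| "nabla (p # ps) f = nabla ps (\<lambda>y x. fst (snd p) * (fshift (fst p) f y x - f y x) - fst (fst p) * (fshift (snd p) f y x - f y x))"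

text \<open>A recursive form of the condition that all differences taking one direction from each
  pair vanish. It is closed under the combinations formed by \<open>nabla\<close>.\<close>

primrec vanish :: "((real \<times> real) \<times> (real \<times> real)) list \<Rightarrow> (real \<Rightarrow> real \<Rightarrow> real) \<Rightarrow> real \<Rightarrow> real \<Rightarrow> bool" where
  "vanish [] f y x \<longleftrightarrow> f y x = 0"
| "vanish (p # ps) f y x \<longleftrightarrow>
    vanish ps (\<lambda>y x. fshift (fst p) f y x - f y x) y x \<and> vanish ps (\<lambda>y x. fshift (snd p) f y x - f y x) y x"

lemma vanish_linear:
  assumes "vanish ps f y x" "vanish ps g y x"
  shows "vanish ps (\<lambda>y x. a * f y x + b * g y x) y x"
  using assms
proof (induction ps arbitrary: f g)
  case (Cons p ps)
  have "(\<lambda>y x. fshift d (\<lambda>y x. a * f y x + b * g y x) y x - (a * f y x + b * g y x)) =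
      (\<lambda>y x. a * (fshift d f y x - f y x) + b * (fshift d g y x - g y x))" for d
    by (simp add: fshift_def algebra_simps)
  then show ?case using Cons by simp
qed simp

lemma nabla_linear:
  "nabla ps (\<lambda>y x. a * f y x + b * g y x) y x = a * nabla ps f y x + b * nabla ps g y x"
proof (induction ps arbitrary: f g)
  case (Cons p ps)
  let ?n = "\<lambda>f y x. fst (snd p) * (fshift (fst p) f y x - f y x) - fst (fst p) * (fshift (snd p) f y x - f y x)"
  have "?n (\<lambda>y x. a * f y x + b * g y x) = (\<lambda>y x. a * ?n f y x + b * ?n g y x)"
    by (simp add: fshift_def algebra_simps)
  then show ?case using Cons by simp
qed simp

lemma nabla_vanish: "vanish ps f y x \<Longrightarrow> nabla ps f y x = 0"
proof (induction ps arbitrary: f)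
  case (Cons p ps)
  then have "vanish ps (\<lambda>y x. fst (snd p) * (fshift (fst p) f y x - f y x)
      + (- fst (fst p)) * (fshift (snd p) f y x - f y x)) y x"
    by (intro vanish_linear) auto
  then show ?case using Cons.IH by simp
qed simp

text \<open>The weights are chosen such that \<open>nabla\<close> kills the coordinate \<open>y\<close>; hence multiplication
  by \<open>y\<close> does not raise the order.\<close>
lemma nabla_mult_fst: "vanish ps f y x \<Longrightarrow> nabla ps (\<lambda>y x. y * f y x) y x = 0"
proof (induction ps arbitrary: f)
  case (Cons p ps)
  let ?a = "fst p" and ?b = "snd p"
  let ?n = "\<lambda>f y x. fst ?b * (fshift ?a f y x - f y x) - fst ?a * (fshift ?b f y x - f y x)"
  let ?g = "\<lambda>y x. (fshift ?a f y x - f y x) - (fshift ?b f y x - f y x)"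
  have v: "vanish ps (\<lambda>y x. c * (fshift ?a f y x - f y x) + e * (fshift ?b f y x - f y x)) y x" for c e
    using Cons.prems by (intro vanish_linear) auto
  have "?n (\<lambda>y x. y * f y x) = (\<lambda>y x. 1 * (y * ?n f y x) + (fst ?a * fst ?b) * ?g y x)"
    by (simp add: fshift_def algebra_simps)
  then have "nabla (p # ps) (\<lambda>y x. y * f y x) y x =
      1 * nabla ps (\<lambda>y x. y * ?n f y x) y x + (fst ?a * fst ?b) * nabla ps ?g y x"
    by (simp only: nabla.simps nabla_linear)
  moreover have "nabla ps (\<lambda>y x. y * ?n f y x) y x = 0"
    using v[of "fst ?b" "- fst ?a"] by (intro Cons.IH) simp
  moreover have "nabla ps ?g y x = 0"
    using v[of 1 "-1"] by (intro nabla_vanish) simp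
  ultimately show ?case by simp
qed simp

lemma vanish_fdiff:
  assumes "\<And>ds. list_all2 (\<lambda>d p. d = fst p \<or> d = snd p) ds ps \<Longrightarrow> fdiff ds f y x = 0"
  shows "vanish ps f y x"
  using assms
proof (induction ps arbitrary: f)
  case Nil
  then show ?case using Nil[of "[]"] by simp
next
  case (Cons p ps)
  have "vanish ps (\<lambda>y x. fshift d f y x - f y x) y x" if "d = fst p \<or> d = snd p" for d
  proof (rule Cons.IH)
    fix ds assume "list_all2 (\<lambda>d p. d = fst p \<or> d = snd p) ds ps"
    then show "fdiff ds (\<lambda>y x. fshift d f y x - f y x) y x = 0"
      using Cons.prems[of "d # ds"] that by simp
  qed
  then show ?case by simp
qed

text \<open>Each pair lowers the degree in \<open>x\<close> by one and multiplies the top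
  coefficient by the old degree and by the determinant of the pair.\<close>

lemma nabla_poly_snd:
  assumes "degree P \<le> length ps"
  shows "nabla ps (\<lambda>y x. poly P x) y x =
    fact (length ps) * coeff P (length ps) * (\<Prod>p\<leftarrow>ps. fst (snd p) * snd (fst p) - fst (fst p) * snd (snd p))"
  using assms
proof (induction ps arbitrary: P)
  case Nil
  then have "P = [:coeff P 0:]" by (metis degree_0_id le_0_eq list.size(3))
  then have "poly P x = coeff P 0" by (metis mult_zero_right poly_pCons poly_0 add.right_neutral)
  then show ?case by simp
next
  case (Cons p ps)
  let ?R = "\<lambda>z. P \<circ>\<^sub>p [:z, 1:] - P"
  define c where "c = fst (snd p) * snd (fst p) - fst (fst p) * snd (snd p)"
  define P' where "P' = smult (fst (snd p)) (?R (snd (fst p))) - smult (fst (fst p)) (?R (snd (snd p)))"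
  have dP: "degree P \<le> Suc (length ps)" using Cons.prems by simp
  have eq: "(\<lambda>y x. fst (snd p) * (fshift (fst p) (\<lambda>y x. poly P x) y x - poly P x)
      - fst (fst p) * (fshift (snd p) (\<lambda>y x. poly P x) y x - poly P x)) = (\<lambda>y x. poly P' x)"
    by (simp add: fshift_def poly_pcompose add.commute P'_def)
  have "degree (smult a (?R z)) \<le> length ps" for a z
    by (rule order_trans[OF degree_smult_le coeff_pcompose_diff(2)[OF dP]])
  then have "degree P' \<le> length ps" unfolding P'_def by (intro degree_diff_le)
  moreover have "coeff P' (length ps) = of_nat (Suc (length ps)) * coeff P (Suc (length ps)) * c"
    unfolding P'_def coeff_diff coeff_smult[symmetric]
    by (simp only: coeff_smult coeff_diff[symmetric] coeff_pcompose_diff(1)[OF dP] c_def) (simp add: algebra_simps)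
  ultimately have "nabla (p # ps) (\<lambda>y x. poly P x) y x = fact (length ps) *
      (of_nat (Suc (length ps)) * coeff P (Suc (length ps)) * c) *
      (\<Prod>p\<leftarrow>ps. fst (snd p) * snd (fst p) - fst (fst p) * snd (snd p))"
    unfolding nabla.simps eq using Cons.IH[of P'] by (simp only:)
  then show ?case
    by (simp only: length_Cons list.map prod_list.Cons fact_Suc c_def[symmetric] ac_simps)
qed

text \<open>Applying \<open>nabla\<close> to the relation kills \<open>y * f\<close> and
  \<open>g\<close>, hence also \<open>poly P x\<close>. By \<open>nabla_poly_snd\<close> what is
  left of \<open>P\<close> is a nonzero multiple of the product of the determinants, so one of them
  is 0.\<close>

lemma exists_equal_slopes:
  assumes rel: "\<And>y' x'. (y', x') \<in> cube_pts (map fst ps @ map snd ps) y x \<Longrightarrow> y' * f y' x' = poly P x' + g y' x'"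
    and f: "\<And>ds. list_all2 (\<lambda>d p. d = fst p \<or> d = snd p) ds ps \<Longrightarrow> fdiff ds f y x = 0"
    and g: "\<And>ds. list_all2 (\<lambda>d p. d = fst p \<or> d = snd p) ds ps \<Longrightarrow> fdiff ds g y x = 0"
    and sub: "\<And>ds. list_all2 (\<lambda>d p. d = fst p \<or> d = snd p) ds ps \<Longrightarrow> cube_pts ds y x \<subseteq> cube_pts (map fst ps @ map snd ps) y x"
    and P: "degree P \<le> length ps" "coeff P (length ps) \<noteq> 0"
  shows "\<exists>p\<in>set ps. fst (snd p) * snd (fst p) = fst (fst p) * snd (snd p)"
proof -
  \<comment> \<open>The relation is known only at the corners of the cube, so its defect is kept as
    a function whose differences at the base point vanish.\<close>
  define h where "h = (\<lambda>y x. y * f y x - (poly P x + g y x))"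
  have "vanish ps h y x"
  proof (rule vanish_fdiff)
    fix ds assume "list_all2 (\<lambda>d p. d = fst p \<or> d = snd p) ds ps"
    then have "fdiff ds h y x = fdiff ds (\<lambda>y x. 0) y x"
      using sub rel by (intro fdiff_cong) (auto simp: h_def)
    then show "fdiff ds h y x = 0" by (simp add: fdiff_zero)
  qed
  then have h0: "nabla ps h y x = 0" by (rule nabla_vanish)
  have f0: "nabla ps (\<lambda>y x. y * f y x) y x = 0" using f by (intro nabla_mult_fst vanish_fdiff)
  have g0: "nabla ps g y x = 0" using g by (intro nabla_vanish vanish_fdiff)
  have eq: "(\<lambda>y x. poly P x) = (\<lambda>y x. 1 * (y * f y x) + (-1) * (1 * g y x + 1 * h y x))"
    by (simp add: h_def algebra_simps)
  have "nabla ps (\<lambda>y x. poly P x) y x = 0"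
    unfolding eq nabla_linear f0 g0 h0 by simp
  then have "(\<Prod>p\<leftarrow>ps. fst (snd p) * snd (fst p) - fst (fst p) * snd (snd p)) = 0"
    using nabla_poly_snd[OF P(1), of y x] P(2) by simp
  then have "0 \<in> (\<lambda>p. fst (snd p) * snd (fst p) - fst (fst p) * snd (snd p)) ` set ps"
    by (simp only: prod_list_zero_iff set_map)
  then obtain p where "p \<in> set ps" "0 = fst (snd p) * snd (fst p) - fst (fst p) * snd (snd p)"
    by (rule imageE)
  then show ?thesis by (intro bexI[of _ p]) simp_all
qed

text \<open>The first \<open>r\<close> terms of the expansion of \<open>t\<close> at
  \<open>y + h\<close> that arises from unrolling the recurrence. Here \<open>x\<close> is the prime
  with index \<open>y\<close>, and \<open>x + d j\<close> the one with index
  \<open>y + h + j\<close>; while the gaps stay the same, \<open>y\<close> and \<open>x\<close> are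
  the only variables.\<close>

definition approx :: "nat \<Rightarrow> nat \<Rightarrow> (nat \<Rightarrow> real) \<Rightarrow> (nat \<Rightarrow> real) \<Rightarrow> real \<Rightarrow> real \<Rightarrow> real \<Rightarrow> real" where
  "approx k r q d h y x = (\<Sum>j<r. (\<Sum>e\<le>k. q e * (x + d j) ^ e) * (\<Prod>i\<le>j. 1 / (y + h + real i)))"

context cone
begin

lemma symb_approx:
  assumes "\<And>e. e \<le> k \<Longrightarrow> \<bar>q e\<bar> \<le> B" "\<And>j. j < r \<Longrightarrow> 0 \<le> d j \<and> d j \<le> B" "0 \<le> h"
  shows "symb k (int k - 1) (1 + k * (2 + 2 * k) + Suc k + r * (4 ^ k + k) + k * Suc k + r) (approx k r q d h)"
proof -
  let ?A = "1 + k * (2 + 2 * k) + Suc k" and ?C = "r * (4 ^ k + k)"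
  have "symb k (int k - 1) (?A + ?C + k * Suc k) (\<lambda>y x. (\<Sum>e\<le>k. q e * (x + d j) ^ e) * (\<Prod>i\<le>j. 1 / (y + h + real i)))"
    if "j < r" for j
  proof -
    have "symb k (int k) (1 + k * (2 + 2 * k)) (\<lambda>y x. q e * (x + d j) ^ e)" if e: "e \<le> k" for e
    proof (rule symb_cmult)
      have "symb k (int e) (e * (2 + 2 * k)) (\<lambda>y x. (x + d j) ^ e)"
        using assms(2)[OF \<open>j < r\<close>] by (intro symb_power symb_snd) auto
      then show "symb k (int k) (k * (2 + 2 * k)) (\<lambda>y x. (x + d j) ^ e)"
        by (rule symb_mono) (use e mult_le_mono1[of e k "2 + 2 * k"] in simp_all)
    qed (use assms(1)[OF e] in simp)
    then have "symb k (int k) (1 + k * (2 + 2 * k) + card {..k}) (\<lambda>y x. \<Sum>e\<le>k. q e * (x + d j) ^ e)"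
      by (intro symb_sum) auto
    then have s: "symb k (int k) ?A (\<lambda>y x. \<Sum>e\<le>k. q e * (x + d j) ^ e)" by simp
    have "symb k (- int (Suc j)) (Suc j * (4 ^ k + k)) (\<lambda>y x. \<Prod>i\<le>j. 1 / (y + h + real i))"
      by (rule symb_prod_inverse[OF assms(3)])
    then have p: "symb k (- 1) ?C (\<lambda>y x. \<Prod>i\<le>j. 1 / (y + h + real i))"
      by (rule symb_mono) (use that in \<open>auto intro: mult_le_mono1 simp del: mult_Suc\<close>)
    show ?thesis using symb_mult[OF s p] by simp
  qed
  then have "symb k (int k - 1) (?A + ?C + k * Suc k + card {..<r})
      (\<lambda>y x. \<Sum>j<r. (\<Sum>e\<le>k. q e * (x + d j) ^ e) * (\<Prod>i\<le>j. 1 / (y + h + real i)))"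
    by (intro symb_sum) auto
  then show ?thesis by (simp add: approx_def[abs_def])
qed

text \<open>The order of the quotient alone would give the exponent \<open>i - j - 1 - k\<close>,
  which is too weak for \<open>i > j\<close>. Writing one factor \<open>y\<close> as
  \<open>(y + j) - j\<close> reduces to products of inverses and to polynomials in \<open>y\<close>
  of degree below \<open>k\<close>, which \<open>k\<close> differences annihilate.\<close>

lemma fdiff_monomial_bound:
  assumes "length ds = k" "dirs B ds" "N \<le> y" "0 \<le> x" "x \<le> B * y" "i \<le> k" "j \<le> r"
  shows "\<bar>fdiff ds (\<lambda>y x. y ^ i * (\<Prod>l\<le>j. 1 / (y + real l))) y x\<bar>
    \<le> B ^ (Suc r * (4 ^ k + k) + i * (r + 2)) * y powr (- 1 - real k)"
  using assms(6,7)
proof (induction i arbitrary: j)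
  case 0
  have y: "y \<ge> 1" using assms N1 by simp
  have "\<bar>fdiff ds (\<lambda>y x. \<Prod>l\<le>j. 1 / (y + 0 + real l)) y x\<bar>
      \<le> B ^ (Suc j * (4 ^ k + k)) * y powr (real_of_int (- int (Suc j)) - real (length ds))"
    using assms by (intro symbD[OF symb_prod_inverse]) auto
  also have "\<dots> \<le> B ^ (Suc r * (4 ^ k + k)) * y powr (- 1 - real k)"
    using 0 y assms(1) B2 by (intro mult_mono Bmono powr_mono mult_le_mono1) auto
  finally show ?case by simp
next
  case (Suc i)
  define b where "b = B ^ (Suc r * (4 ^ k + k) + i * (r + 2)) * y powr (- 1 - real k)"
  have b0: "b \<ge> 0" using B2 by (simp add: b_def)
  have pos: "y' > 0" if "(y', x') \<in> cube_pts ds y x" for y' x'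
    using cube_pts_ge[OF that assms(2)] assms N1 by simp
  have "\<bar>fdiff ds (\<lambda>y x. y ^ Suc i * (\<Prod>l\<le>j. 1 / (y + real l))) y x\<bar> \<le> (real r + 1) * b"
  proof (cases j)
    case 0
    have "fdiff ds (\<lambda>y x. y ^ Suc i * (\<Prod>l\<le>j. 1 / (y + real l))) y x = fdiff ds (\<lambda>y x. poly (monom 1 i) y) y x"
    proof (rule fdiff_cong)
      fix y' x' assume "(y', x') \<in> cube_pts ds y x"
      then show "y' ^ Suc i * (\<Prod>l\<le>j. 1 / (y' + real l)) = poly (monom 1 i) y'"
        using pos[of y' x'] by (simp add: 0 poly_monom)
    qed
    also have "\<dots> = 0" using Suc.prems assms(1) by (intro fdiff_poly_fst) (simp add: degree_monom_eq)
    finally show ?thesis using b0 by simp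
  next
    case (Suc j')
    let ?u = "\<lambda>j y (x::real). y ^ i * (\<Prod>l\<le>j. 1 / (y + real l))"
    have "fdiff ds (\<lambda>y x. y ^ Suc i * (\<Prod>l\<le>j. 1 / (y + real l))) y x = fdiff ds (\<lambda>y x. ?u j' y x - real j * ?u j y x) y x"
    proof (rule fdiff_cong)
      fix y' x' assume "(y', x') \<in> cube_pts ds y x"
      then have "y' > 0" by (rule pos)
      define A where "A = y' ^ i * (\<Prod>l\<le>j'. 1 / (y' + real l))"
      have "A * (y' / (y' + real j)) = A - real j * (A * (1 / (y' + real j)))"
        using \<open>y' > 0\<close> by (simp add: field_simps)
      then show "y' ^ Suc i * (\<Prod>l\<le>j. 1 / (y' + real l)) = ?u j' y' x' - real j * ?u j y' x'"
        unfolding Suc prod.atMost_Suc A_def by (simp add: mult_ac)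
    qed
    also have "\<dots> = fdiff ds (?u j') y x - real j * fdiff ds (?u j) y x"
      by (simp only: fdiff_diff fdiff_cmult)
    also have "\<bar>\<dots>\<bar> \<le> b + real j * b"
    proof -
      have "\<bar>fdiff ds (?u j') y x\<bar> \<le> b" "\<bar>fdiff ds (?u j) y x\<bar> \<le> b"
        unfolding b_def by (rule Suc.IH; use Suc.prems Suc in simp)+
      moreover from this(2) have "real j * \<bar>fdiff ds (?u j) y x\<bar> \<le> real j * b" by (intro mult_left_mono) auto
      ultimately show ?thesis by (intro order_trans[OF abs_triangle_ineq4]) (simp add: abs_mult)
    qed
    also have "\<dots> = (real j + 1) * b" by (simp add: algebra_simps)
    also have "\<dots> \<le> (real r + 1) * b" using Suc.prems b0 by (intro mult_right_mono) auto
    finally show ?thesis .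
  qed
  also have "\<dots> \<le> B ^ (r + 2) * b"
  proof (intro mult_right_mono b0)
    have "real (r + 1) \<le> B ^ (r + 1)" by (rule le_Bpow)
    also have "\<dots> \<le> B ^ (r + 2)" by (intro Bmono) simp
    finally show "real r + 1 \<le> B ^ (r + 2)" by simp
  qed
  also have "\<dots> = B ^ (Suc r * (4 ^ k + k) + Suc i * (r + 2)) * y powr (- 1 - real k)"
    by (simp add: b_def power_add mult_ac)
  finally show ?case .
qed

text \<open>Put \<open>w = x - l * y\<close> and substitute the line. The difference becomes a sum
  over triples \<open>(j, e, i)\<close>, whose term \<open>(0, k, 0)\<close> is
  \<open>q k * w ^ k\<close> times the \<open>k\<close>-th difference of \<open>1 / y\<close>, at
  least about \<open>w ^ k / y ^ (k + 1)\<close> in size. Every other term has a lower power of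
  \<open>w\<close> or an additional factor \<open>1 / y\<close>. Hence a large \<open>w\<close>
  would make the main term exceed the bound assumed in \<open>small\<close>.\<close>

lemma line_bound:
  assumes ds: "length ds = k" "dirs B ds" "\<And>d. d \<in> set ds \<Longrightarrow> snd d = l * fst d"
    and k: "k \<ge> 1" "r \<ge> 1" and l: "0 \<le> l" "l \<le> B"
    and q: "\<And>e. e \<le> k \<Longrightarrow> \<bar>q e\<bar> \<le> B" "\<bar>q k\<bar> \<ge> 1"
    and d: "d 0 = 0" "\<And>j. j < r \<Longrightarrow> 0 \<le> d j \<and> d j \<le> B"
    and xy: "N \<le> y" "0 \<le> x" "x \<le> B * y"
    and small: "\<bar>fdiff ds (approx k r q d 0) y x\<bar> \<le> B ^ E * y powr (- 2 - real k)"
    and large: "B ^ (E + (k + 1 + (1 + 3 * k + (Suc r * (4 ^ k + k) + k * (r + 2)) + r * Suc k * Suc k)) + 2) \<le> y"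
      "real k * B \<le> y"
  shows "\<bar>x - l * y\<bar> \<le> B ^ (k + 1 + (1 + 3 * k + (Suc r * (4 ^ k + k) + k * (r + 2)) + r * Suc k * Suc k) + 1)"
proof (rule ccontr)
  \<comment> \<open>Exponents of \<open>B\<close>: \<open>Eu\<close> for the differences of
    monomials, \<open>E4\<close> adds the coefficients, \<open>E5\<close> the number of terms, and
    \<open>E6\<close> the loss in the lower bound for the main term.\<close>
  define Eu where "Eu = Suc r * (4 ^ k + k) + k * (r + 2)"
  define E4 where "E4 = 1 + 3 * k + Eu"
  define E5 where "E5 = E4 + r * Suc k * Suc k"
  define E6 where "E6 = k + 1 + E5"
  define w where "w = x - l * y"
  define W where "W = \<bar>w\<bar>"
  define U where "U = y powr (- 1 - real k)"
  define u where "u = (\<lambda>i j y (x::real). y ^ i * (\<Prod>l\<le>j. 1 / (y + real l)))"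
  define \<kappa> where "\<kappa> = (\<lambda>j e i. q e * (real (e choose i) * l ^ i * (w + d j) ^ (e - i)))"
  define Z where "Z = (SIGMA j:{..<r}. SIGMA e:{..k}. {..e})"
  define T where "T = (\<lambda>(j, e, i). \<kappa> j e i * fdiff ds (u i j) y x)"
  assume "\<not> ?thesis"
  then have Wgt: "W > B ^ (E6 + 1)" by (simp add: W_def w_def E6_def E5_def E4_def Eu_def add.assoc)
  have y: "y \<ge> 2" using xy N1 by simp
  have U: "U > 0" using y by (simp add: U_def)
  have Uy: "y powr (- 2 - real k) = U / y"
  proof -
    have "- 2 - real k = - 1 - real k - 1" by simp
    then show ?thesis using powr_diff[of y "- 1 - real k" 1] y by (simp only: U_def powr_one)
  qed
  have WB: "W \<ge> B" using Wgt Bmono[of 1 "E6 + 1"] by simp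
  then have W: "W \<ge> 1" using B2 by simp
  have finZ: "finite Z" by (auto simp: Z_def)
  have cardZ: "card Z \<le> r * Suc k * Suc k"
  proof -
    have "Z \<subseteq> {..<r} \<times> {..k} \<times> {..k}" by (auto simp: Z_def)
    then have "card Z \<le> card ({..<r} \<times> {..k} \<times> {..k})" by (intro card_mono) auto
    then show ?thesis by (simp only: card_cartesian_product card_lessThan card_atMost mult.assoc)
  qed
  have z0: "(0, k, 0) \<in> Z" using k by (auto simp: Z_def)
  have expand: "fdiff ds (approx k r q d 0) y x = sum T Z"
  proof -
    have "fdiff ds (approx k r q d 0) y x = fdiff ds (\<lambda>y' _. approx k r q d 0 y' (l * y' + w)) y x"
      unfolding w_def by (rule fdiff_line[OF ds(3)])
    also have "(\<lambda>y' _. approx k r q d 0 y' (l * y' + w)) = (\<lambda>y x. \<Sum>(j, e, i)\<in>Z. \<kappa> j e i * u i j y x)"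
    proof (intro ext)
      fix y x :: real
      have "(l * y + w + d j) ^ e = (\<Sum>i\<le>e. real (e choose i) * l ^ i * (w + d j) ^ (e - i) * y ^ i)" for e j
        unfolding add.assoc binomial_ring[of "l * y"] by (simp add: power_mult_distrib mult_ac)
      then have "approx k r q d 0 y (l * y + w) = (\<Sum>j<r. \<Sum>e\<le>k. \<Sum>i\<le>e. \<kappa> j e i * u i j y x)"
        unfolding approx_def \<kappa>_def u_def
        by (simp add: sum_distrib_left sum_distrib_right mult_ac)
      also have "\<dots> = (\<Sum>(j, e, i)\<in>Z. \<kappa> j e i * u i j y x)"
        unfolding Z_def by (simp add: sum.Sigma)
      finally show "approx k r q d 0 y (l * y + w) = (\<Sum>(j, e, i)\<in>Z. \<kappa> j e i * u i j y x)" .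
    qed
    also have "fdiff ds \<dots> y x = (\<Sum>z\<in>Z. fdiff ds (\<lambda>y x. case z of (j, e, i) \<Rightarrow> \<kappa> j e i * u i j y x) y x)"
      by (rule fdiff_sum)
    also have "\<dots> = sum T Z"
      by (intro sum.cong) (auto simp: T_def fdiff_cmult)
    finally show ?thesis .
  qed
  have kappa: "\<bar>\<kappa> j e i\<bar> \<le> B ^ (1 + 3 * k) * W ^ (e - i)" if "j < r" "e \<le> k" "i \<le> e" for j e i
  proof -
    have a: "real (e choose i) \<le> B ^ k"
    proof -
      have "e choose i \<le> 2 ^ e" using choose_row_sum[of e] member_le_sum[of i "{..e}" "\<lambda>i. e choose i"] that by simp
      then have "real (e choose i) \<le> 2 ^ e" by (metis of_nat_le_iff of_nat_numeral of_nat_power)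
      also have "\<dots> \<le> B ^ e" using B2 by (intro power_mono) auto
      also have "\<dots> \<le> B ^ k" using that by (intro Bmono)
      finally show ?thesis .
    qed
    have b: "l ^ i \<le> B ^ k"
      using power_mono[OF l(2,1), of i] Bmono[of i k] that by simp
    have "\<bar>w + d j\<bar> \<le> 2 * W" using d(2)[OF that(1)] WB unfolding W_def by linarith
    also have "\<dots> \<le> B * W" using B2 W by (intro mult_right_mono) auto
    finally have "\<bar>w + d j\<bar> ^ (e - i) \<le> (B * W) ^ (e - i)" by (intro power_mono) auto
    also have "\<dots> \<le> B ^ k * W ^ (e - i)"
      unfolding power_mult_distrib using that W by (intro mult_right_mono Bmono) auto
    finally have c: "\<bar>w + d j\<bar> ^ (e - i) \<le> B ^ k * W ^ (e - i)" .
    have "\<bar>\<kappa> j e i\<bar> = \<bar>q e\<bar> * (real (e choose i) * l ^ i * \<bar>w + d j\<bar> ^ (e - i))"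
      using l by (simp add: \<kappa>_def abs_mult power_abs)
    also have "\<dots> \<le> B * (B ^ k * B ^ k * (B ^ k * W ^ (e - i)))"
      using a b c q(1)[OF that(2)] l B2 W by (intro mult_mono) auto
    also have "\<dots> = B ^ (1 + 3 * k) * W ^ (e - i)"
      by (simp add: power_add power_mult numeral_3_eq_3 mult_ac power_mult_distrib)
    finally show ?thesis .
  qed
  have other: "\<bar>T z\<bar> \<le> B ^ E4 * (W ^ (k - 1) + W ^ k / y) * U" if "z \<in> Z - {(0, k, 0)}" for z
  proof -
    obtain j e i where z: "z = (j, e, i)" by (cases z) auto
    have jei: "j < r" "e \<le> k" "i \<le> e" "(j, e, i) \<noteq> (0, k, 0)" using that unfolding z Z_def by auto
    have E4: "B ^ (1 + 3 * k) * B ^ Eu = B ^ E4" by (simp add: E4_def power_add)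
    have Wy: "0 \<le> W ^ k / y" "0 \<le> W ^ (k - 1)" using W y by auto
    show ?thesis
    proof (cases "e - i \<le> k - 1")
      case True
      have "\<bar>fdiff ds (u i j) y x\<bar> \<le> B ^ (Suc r * (4 ^ k + k) + i * (r + 2)) * U"
        unfolding u_def U_def using jei ds xy by (intro fdiff_monomial_bound) auto
      also have "\<dots> \<le> B ^ Eu * U"
        unfolding Eu_def using jei U by (intro mult_right_mono Bmono add_left_mono mult_le_mono1) auto
      finally have "\<bar>T z\<bar> \<le> (B ^ (1 + 3 * k) * W ^ (e - i)) * (B ^ Eu * U)"
        unfolding z T_def prod.case abs_mult using kappa jei B2 W by (intro mult_mono) auto
      also have "\<dots> = B ^ E4 * W ^ (e - i) * U" unfolding E4[symmetric] by (simp only: ac_simps)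
      also have "\<dots> \<le> B ^ E4 * (W ^ (k - 1) + W ^ k / y) * U"
      proof (intro mult_right_mono mult_left_mono)
        have "W ^ (e - i) \<le> W ^ (k - 1)" using True W by (intro power_increasing)
        then show "W ^ (e - i) \<le> W ^ (k - 1) + W ^ k / y" using Wy by simp
      qed (use U B2 in auto)
      finally show ?thesis .
    next
      case False
      \<comment> \<open>Here the full power \<open>w ^ k\<close> occurs. As the main term is
        excluded, \<open>j \<ge> 1\<close>, which supplies the additional factor
        \<open>1 / y\<close>.\<close>
      then have e: "e = k" "i = 0" using jei k by auto
      then have j: "j \<ge> 1" using jei by (cases j) auto
      have "\<bar>fdiff ds (\<lambda>y x. \<Prod>l\<le>j. 1 / (y + 0 + real l)) y x\<bar>
          \<le> B ^ (Suc j * (4 ^ k + k)) * y powr (real_of_int (- int (Suc j)) - real (length ds))"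
        using ds xy by (intro symbD[OF symb_prod_inverse]) auto
      also have "\<dots> \<le> B ^ Eu * y powr (- 2 - real k)"
      proof (intro mult_mono Bmono powr_mono)
        have "Suc j * (4 ^ k + k) \<le> Suc r * (4 ^ k + k)" using jei by (intro mult_le_mono1) auto
        then show "Suc j * (4 ^ k + k) \<le> Eu" unfolding Eu_def by (rule trans_le_add1)
        show "real_of_int (- int (Suc j)) - real (length ds) \<le> - 2 - real k" using j ds(1) by simp
      qed (use y B2 in auto)
      also note Uy
      finally have fd: "\<bar>fdiff ds (u i j) y x\<bar> \<le> B ^ Eu * (U / y)" by (simp add: u_def e)
      then have "\<bar>T z\<bar> \<le> (B ^ (1 + 3 * k) * W ^ (e - i)) * (B ^ Eu * (U / y))"
        unfolding z T_def prod.case abs_mult using kappa jei B2 W by (intro mult_mono) auto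
      also have "\<dots> = B ^ E4 * (W ^ k / y) * U" unfolding E4[symmetric] e by simp
      also have "\<dots> \<le> B ^ E4 * (W ^ (k - 1) + W ^ k / y) * U"
        using Wy U B2 by (intro mult_right_mono mult_left_mono) auto
      finally show ?thesis .
    qed
  qed
  have rest: "\<bar>sum T (Z - {(0, k, 0)})\<bar> \<le> B ^ E5 * (W ^ (k - 1) + W ^ k / y) * U"
  proof -
    have Wy: "0 \<le> W ^ (k - 1) + W ^ k / y" using W y by auto
    have "\<bar>sum T (Z - {(0, k, 0)})\<bar> \<le> (\<Sum>z\<in>Z - {(0, k, 0)}. \<bar>T z\<bar>)" by (rule sum_abs)
    also have "\<dots> \<le> real (card (Z - {(0, k, 0)})) * (B ^ E4 * (W ^ (k - 1) + W ^ k / y) * U)"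
      using other by (intro sum_bounded_above)
    also have "\<dots> \<le> B ^ (r * Suc k * Suc k) * (B ^ E4 * (W ^ (k - 1) + W ^ k / y) * U)"
    proof (intro mult_right_mono)
      have "card (Z - {(0, k, 0)}) \<le> card Z" using finZ by (intro card_mono) auto
      then have "real (card (Z - {(0, k, 0)})) \<le> real (r * Suc k * Suc k)" using cardZ by linarith
      also have "\<dots> \<le> B ^ (r * Suc k * Suc k)" by (rule le_Bpow)
      finally show "real (card (Z - {(0, k, 0)})) \<le> B ^ (r * Suc k * Suc k)" .
    qed (use Wy U B2 in auto)
    also have "\<dots> = B ^ E5 * (W ^ (k - 1) + W ^ k / y) * U" by (simp add: E5_def power_add)
    finally show ?thesis .
  qed
  have main: "W ^ k * U \<le> B ^ (k + 1) * \<bar>T (0, k, 0)\<bar>"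
  proof -
    define S where "S = sum_list (map fst ds)"
    have "S \<le> real k * B"
    proof -
      have "S \<le> (\<Sum>d\<leftarrow>ds. B)" unfolding S_def using ds(2) by (intro sum_list_mono) (auto simp: dirs_def)
      then show ?thesis using ds(1) by (simp add: sum_list_triv)
    qed
    \<comment> \<open>The far corner is at most \<open>2 * y\<close>, so passing to it costs a
      factor 2 per power of \<open>1 / y\<close>.\<close>
    then have S: "S \<le> y" using large(2) by simp
    have S0: "0 \<le> S" unfolding S_def using ds(2) by (intro sum_list_nonneg) (force simp: dirs_def)
    have "U = 1 / y ^ Suc k" unfolding U_def using y
      by (simp add: powr_diff powr_minus_divide powr_realpow flip: powr_add)
    also have "\<dots> = 2 ^ Suc k * (1 / (2 * y) ^ Suc k)" by (simp add: power_mult_distrib)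
    also have "\<dots> \<le> B ^ Suc k * (1 / (y + 0 + S) ^ Suc k)"
      using B2 y S S0 by (intro mult_mono power_mono divide_left_mono) auto
    also have "\<dots> \<le> B ^ Suc k * \<bar>fdiff ds (\<lambda>y x. 1 / (y + 0)) y x\<bar>"
    proof (intro mult_left_mono)
      have "1 / (y + 0 + S) ^ Suc k \<le> (-1) ^ length ds * fdiff ds (\<lambda>y x. 1 / (y + 0)) y x"
        unfolding S_def using fdiff_inverse_lower[OF ds(2) xy(1) order_refl, of x] ds(1) by simp
      also have "\<dots> \<le> \<bar>fdiff ds (\<lambda>y x. 1 / (y + 0)) y x\<bar>"
        by (rule order_trans[OF abs_ge_self]) (simp add: abs_mult power_abs)
      finally show "1 / (y + 0 + S) ^ Suc k \<le> \<bar>fdiff ds (\<lambda>y x. 1 / (y + 0)) y x\<bar>" .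
    qed (use B2 in simp)
    finally have "U \<le> B ^ Suc k * \<bar>fdiff ds (u 0 0) y x\<bar>" by (simp add: u_def)
    moreover have "W ^ k \<le> \<bar>\<kappa> 0 k 0\<bar>"
      using q(2) W mult_right_mono[of 1 "\<bar>q k\<bar>" "W ^ k"] by (simp add: \<kappa>_def d(1) W_def abs_mult power_abs)
    ultimately have "W ^ k * U \<le> \<bar>\<kappa> 0 k 0\<bar> * (B ^ Suc k * \<bar>fdiff ds (u 0 0) y x\<bar>)"
      using U W by (intro mult_mono) auto
    then show ?thesis by (simp add: T_def abs_mult mult_ac)
  qed
  have "\<bar>sum T Z\<bar> \<le> B ^ E * (U / y)" using small expand by (simp only: Uy)
  moreover have "sum T Z = T (0, k, 0) + sum T (Z - {(0, k, 0)})" using finZ z0 by (rule sum.remove)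
  ultimately have "\<bar>T (0, k, 0)\<bar> \<le> B ^ E * (U / y) + B ^ E5 * (W ^ (k - 1) + W ^ k / y) * U"
    using rest by linarith
  then have "B ^ (k + 1) * \<bar>T (0, k, 0)\<bar> \<le> B ^ (k + 1) * (B ^ E * (U / y) + B ^ E5 * (W ^ (k - 1) + W ^ k / y) * U)"
    using B2 by (intro mult_left_mono) auto
  with main have "W ^ k * U \<le> (B ^ (k + 1 + E) / y + B ^ E6 * (W ^ (k - 1) + W ^ k / y)) * U"
    by (simp add: power_add E6_def distrib_left distrib_right mult_ac)
  then have key: "W ^ k \<le> B ^ (k + 1 + E) / y + B ^ E6 * (W ^ (k - 1) + W ^ k / y)"
    using U by simp
  have big: "4 * B ^ e \<le> y" if "e \<le> E + E6" for e
  proof -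
    have "4 * B ^ e \<le> B ^ 2 * B ^ (E + E6)"
      using that B2 power_mono[of 2 B 2] by (intro mult_mono Bmono) auto
    also have "\<dots> = B ^ (E + E6 + 2)" by (simp add: power_add power2_eq_square)
    also have "\<dots> \<le> y" using large(1) by (simp add: E6_def E5_def E4_def Eu_def add.assoc)
    finally show ?thesis .
  qed
  have "B ^ (k + 1 + E) / y \<le> 1 / 4"
    using big[of "k + 1 + E"] y by (simp add: E6_def field_simps)
  moreover have "B ^ E6 * (W ^ k / y) \<le> W ^ k / 4"
  proof -
    have "B ^ E6 / y \<le> 1 / 4" using big[of E6] y by (simp add: field_simps)
    then have "B ^ E6 / y * W ^ k \<le> 1 / 4 * W ^ k" using W by (intro mult_right_mono) auto
    then show ?thesis by simp
  qed
  moreover have "1 \<le> W ^ k" using W by simp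
  ultimately have "W ^ k \<le> 2 * (B ^ E6 * W ^ (k - 1))" using key unfolding distrib_left by linarith
  also have "\<dots> \<le> B * (B ^ E6 * W ^ (k - 1))" using B2 W by (intro mult_right_mono) auto
  also have "W ^ k = W * W ^ (k - 1)" using k by (cases k) auto
  finally have "W * W ^ (k - 1) \<le> B ^ (E6 + 1) * W ^ (k - 1)" by (simp add: mult_ac)
  then have "W \<le> B ^ (E6 + 1)" using W by (subst (asm) mult_le_cancel_right_pos) auto
  then show False using Wgt by simp
qed

end

subsection \<open>Remainders modulo rising factorials\<close>

definition rising :: "nat \<Rightarrow> int poly" where
  "rising r = (\<Prod>i<r. [:int i, 1:])"

lemma poly_rising: "poly (rising r) M = (\<Prod>i<r. M + int i)"
  by (simp add: rising_def poly_prod add.commute)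

lemma degree_linear_prod: "degree (\<Prod>i\<in>S. [:int i, 1:] :: int poly) = card S"
proof (induction S rule: infinite_finite_induct)
  case (insert a S)
  have "degree ([:int a, 1:] * (\<Prod>i\<in>S. [:int i, 1:])) = degree [:int a, 1:] + card S"
    using insert by (subst degree_mult_eq) (auto simp: prod_zero_iff)
  then show ?case unfolding prod.insert[OF insert(1,2)] using insert(1,2) by simp
qed simp_all

lemma degree_rising: "degree (rising r) = r"
  by (simp only: rising_def degree_linear_prod card_lessThan)

lemma coeff_rising_top: "coeff (rising r) r = 1"
proof -
  have "lead_coeff (rising r) = 1" by (simp add: rising_def lead_coeff_prod)
  then show ?thesis by (simp add: degree_rising)
qed

text \<open>The bound \<open>v\<close> is carried along because a polynomial with small coefficients
  can vanish at a huge integer only if its coefficients do.\<close>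

definition has_rem :: "nat \<Rightarrow> int \<Rightarrow> int poly \<Rightarrow> int poly \<Rightarrow> bool" where
  "has_rem r v F C \<longleftrightarrow> (\<exists>A. F = rising r * A + C) \<and> (\<forall>i\<ge>r. coeff C i = 0) \<and> (\<forall>i. \<bar>coeff C i\<bar> \<le> v)"

lemma has_remI:
  "F = rising r * A + C \<Longrightarrow> (\<And>i. i \<ge> r \<Longrightarrow> coeff C i = 0) \<Longrightarrow> (\<And>i. \<bar>coeff C i\<bar> \<le> v) \<Longrightarrow> has_rem r v F C"
  by (auto simp: has_rem_def)

lemma has_remD:
  assumes "has_rem r v F C"
  shows "\<exists>A. F = rising r * A + C" "\<And>i. i \<ge> r \<Longrightarrow> coeff C i = 0" "\<And>i. \<bar>coeff C i\<bar> \<le> v"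
  using assms by (auto simp: has_rem_def)

lemma has_rem_zero: "has_rem r 0 0 0"
  by (rule has_remI[of _ _ 0]) simp_all

lemma has_rem_one: "r \<ge> 1 \<Longrightarrow> has_rem r 1 1 1"
  by (rule has_remI[of _ _ 0]) simp_all

lemma has_rem_mono:
  assumes "has_rem r v F C" "v \<le> v'"
  shows "has_rem r v' F C"
proof -
  obtain A where "F = rising r * A + C" using has_remD(1)[OF assms(1)] by blast
  then show ?thesis
    by (rule has_remI) (use has_remD(2)[OF assms(1)] order_trans[OF has_remD(3)[OF assms(1)] assms(2)] in auto)
qed

lemma has_rem_add:
  assumes "has_rem r v F C" "has_rem r v' F' C'"
  shows "has_rem r (v + v') (F + F') (C + C')"
proof -
  obtain A A' where "F = rising r * A + C" "F' = rising r * A' + C'"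
    using assms by (auto simp: has_rem_def)
  then have "F + F' = rising r * (A + A') + (C + C')" by (simp add: algebra_simps)
  moreover have "\<bar>coeff (C + C') i\<bar> \<le> v + v'" for i
    unfolding coeff_add by (intro order_trans[OF abs_triangle_ineq] add_mono has_remD(3)[OF assms(1)] has_remD(3)[OF assms(2)])
  ultimately show ?thesis
    using has_remD(2)[OF assms(1)] has_remD(2)[OF assms(2)] by (intro has_remI) auto
qed

lemma has_rem_smult:
  assumes "has_rem r v F C"
  shows "has_rem r (\<bar>a\<bar> * v) (smult a F) (smult a C)"
proof -
  obtain A where "F = rising r * A + C" using assms by (auto simp: has_rem_def)
  then have "smult a F = rising r * smult a A + smult a C" by (simp add: smult_add_right)
  then show ?thesis
    by (rule has_remI) (use has_remD(2,3)[OF assms] in \<open>auto simp: abs_mult intro: mult_left_mono\<close>)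
qed

lemma has_rem_sum:
  assumes "finite S" "\<And>i. i \<in> S \<Longrightarrow> \<exists>C. has_rem r v (F i) C"
  shows "\<exists>C. has_rem r (int (card S) * v) (\<Sum>i\<in>S. F i) C"
  using assms
proof (induction S rule: finite_induct)
  case empty
  then show ?case using has_rem_zero by auto
next
  case (insert a S)
  then obtain C C' where "has_rem r v (F a) C" "has_rem r (int (card S) * v) (\<Sum>i\<in>S. F i) C'" by blast
  from has_rem_add[OF this] have "has_rem r (int (card (insert a S)) * v) (\<Sum>i\<in>insert a S. F i) (C + C')"
    using insert.hyps by (simp add: algebra_simps)
  then show ?case by blast
qed

definition rising_norm :: "nat \<Rightarrow> int" where
  "rising_norm r = 1 + (\<Sum>i\<le>r. \<bar>coeff (rising r) i\<bar>)"

lemma coeff_rising_bound: "\<bar>coeff (rising r) i\<bar> \<le> rising_norm r - 1"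
proof (cases "i \<le> r")
  case True
  then show ?thesis unfolding rising_norm_def using member_le_sum[of i "{..r}" "\<lambda>i. \<bar>coeff (rising r) i\<bar>"] by simp
next
  case False
  then have "coeff (rising r) i = 0" by (intro coeff_eq_0) (simp add: degree_rising)
  then show ?thesis by (simp add: rising_norm_def sum_nonneg)
qed

text \<open>Multiplication by the variable overflows by one coefficient, which is removed with a
  multiple of the monic \<open>rising r\<close>. This enlarges the coefficients by a factor of at
  most \<open>rising_norm r\<close>.\<close>

lemma has_rem_linear:
  assumes "has_rem r v F C" "r \<ge> 1"
  shows "\<exists>C'. has_rem r (\<bar>a\<bar> * v + \<bar>b\<bar> * (rising_norm r * v)) ([:a, b:] * F) C'"
proof -
  obtain A where A: "F = rising r * A + C" using assms by (auto simp: has_rem_def)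
  have C: "\<And>i. i \<ge> r \<Longrightarrow> coeff C i = 0" "\<And>i. \<bar>coeff C i\<bar> \<le> v" using assms by (auto simp: has_rem_def)
  then have v: "v \<ge> 0" by (meson abs_ge_zero order_trans)
  define c where "c = coeff C (r - 1)"
  define D where "D = pCons 0 C - smult c (rising r)"
  have "pCons 0 F = rising r * (pCons 0 A + [:c:]) + D"
    by (simp add: A D_def algebra_simps)
  moreover have "coeff D i = 0" if "i \<ge> r" for i
  proof (cases "i = r")
    case True
    then show ?thesis using assms(2) by (cases r) (simp_all add: D_def c_def coeff_rising_top)
  next
    case False
    then have "coeff (rising r) i = 0" using that by (intro coeff_eq_0) (simp add: degree_rising)
    then show ?thesis using that False C(1) by (cases i) (auto simp: D_def)
  qed
  moreover have "\<bar>coeff D i\<bar> \<le> rising_norm r * v" for i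
  proof -
    have "\<bar>coeff (pCons 0 C) i\<bar> \<le> v" using C(2) v by (cases i) auto
    moreover have "\<bar>c\<bar> * \<bar>coeff (rising r) i\<bar> \<le> v * (rising_norm r - 1)"
      using C(2) coeff_rising_bound v by (intro mult_mono) (auto simp: c_def)
    ultimately have "\<bar>coeff D i\<bar> \<le> v + v * (rising_norm r - 1)"
      unfolding D_def coeff_diff coeff_smult abs_mult[symmetric] by linarith
    then show ?thesis by (simp add: algebra_simps)
  qed
  ultimately have "has_rem r (rising_norm r * v) (pCons 0 F) D"
    unfolding has_rem_def by blast
  from has_rem_add[OF has_rem_smult[OF assms(1), of a] has_rem_smult[OF this, of b]]
  show ?thesis by (auto simp: mult_pCons_left)
qed

context
  fixes B :: int and r :: nat
  assumes r: "r \<ge> 1" and B: "rising_norm r + 1 \<le> B" "2 \<le> B"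
begin

lemma ex_has_rem_linear:
  assumes "\<exists>C. has_rem r (B ^ e) F C" "\<bar>a\<bar> \<le> B" "\<bar>b\<bar> \<le> B"
  shows "\<exists>C. has_rem r (B ^ (e + 2)) ([:a, b:] * F) C"
proof -
  have n: "rising_norm r \<ge> 0" by (simp add: rising_norm_def sum_nonneg)
  obtain C C' where "has_rem r (B ^ e) F C" "has_rem r (\<bar>a\<bar> * B ^ e + \<bar>b\<bar> * (rising_norm r * B ^ e)) ([:a, b:] * F) C'"
    using assms(1) has_rem_linear[OF _ r] by blast
  moreover have "\<bar>a\<bar> * B ^ e + \<bar>b\<bar> * (rising_norm r * B ^ e) \<le> B * B ^ e + B * (rising_norm r * B ^ e)"
    using assms B n by (intro add_mono mult_right_mono) auto
  moreover have "\<dots> = B * B ^ e * (rising_norm r + 1)" by (simp add: algebra_simps)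
  moreover have "\<dots> \<le> B * B ^ e * B" using B by (intro mult_left_mono) auto
  moreover have "\<dots> = B ^ (e + 2)" by (simp add: power_add power2_eq_square)
  ultimately have "has_rem r (\<bar>a\<bar> * B ^ e + \<bar>b\<bar> * (rising_norm r * B ^ e)) ([:a, b:] * F) C'"
    "\<bar>a\<bar> * B ^ e + \<bar>b\<bar> * (rising_norm r * B ^ e) \<le> B ^ (e + 2)" by linarith+
  then show ?thesis using has_rem_mono by blast
qed

lemma ex_has_rem_power:
  assumes "\<exists>C. has_rem r (B ^ e) F C" "\<bar>a\<bar> \<le> B" "\<bar>b\<bar> \<le> B"
  shows "\<exists>C. has_rem r (B ^ (e + 2 * m)) ([:a, b:] ^ m * F) C"
proof (induction m)
  case 0
  then show ?case using assms(1) by simp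
next
  case (Suc m)
  have "e + 2 * Suc m = e + 2 * m + 2" by simp
  then show ?case using ex_has_rem_linear[OF Suc assms(2,3)] by (simp only: power_Suc mult.assoc)
qed

lemma ex_has_rem_prod:
  assumes "finite S" "\<And>i. i \<in> S \<Longrightarrow> int i \<le> B"
  shows "\<exists>C. has_rem r (B ^ (2 * card S)) (\<Prod>i\<in>S. [:int i, 1:]) C"
  using assms
proof (induction S rule: finite_induct)
  case empty
  then show ?case using has_rem_one[OF r] by auto
next
  case (insert i S)
  then have "\<exists>C. has_rem r (B ^ (2 * card S + 2)) ([:int i, 1:] * (\<Prod>i\<in>S. [:int i, 1:])) C"
    using B by (intro ex_has_rem_linear) auto
  then show ?case using insert.hyps by (simp del: power_Suc)
qed

end

text \<open>\<open>factor\<close> is the homogenisation \<open>a\<^sup>k Q(u / a)\<close> of \<open>Q\<close>. Its argument \<open>u = a p = z + D y\<close> and its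
  coefficients are integers even though \<open>p = (D / a) y + z / a\<close> has a rational slope.\<close>
definition factor :: "nat \<Rightarrow> (nat \<Rightarrow> int) \<Rightarrow> int \<Rightarrow> int poly" where
  "factor k q a = (\<Sum>e\<le>k. monom (q e * a ^ (k - e)) e)"

text \<open>If \<open>a\<close> times the prime with index \<open>y + j\<close> is
  \<open>z j + D * y\<close>, this is \<open>a ^ k\<close> times the truncated tail at
  \<open>y\<close>, brought to the common denominator \<open>rising r\<close>.\<close>

definition numer :: "nat \<Rightarrow> nat \<Rightarrow> (nat \<Rightarrow> int) \<Rightarrow> int \<Rightarrow> int \<Rightarrow> (nat \<Rightarrow> int) \<Rightarrow> int poly" where
  "numer k r q a D z = (\<Sum>j<r. (factor k q a \<circ>\<^sub>p [:z j, D:]) * (\<Prod>i\<in>{j<..<r}. [:int i, 1:]))"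

lemma factor_pcompose: "factor k q a \<circ>\<^sub>p p = (\<Sum>e\<le>k. smult (q e * a ^ (k - e)) (p ^ e))"
  unfolding factor_def pcompose_sum
proof (intro sum.cong refl)
  fix e
  have "monom c e \<circ>\<^sub>p p = smult c (p ^ e)" for c
    by (induction e) (simp_all add: monom_Suc pcompose_pCons monom_0 pcompose_const)
  then show "monom (q e * a ^ (k - e)) e \<circ>\<^sub>p p = smult (q e * a ^ (k - e)) (p ^ e)" .
qed

lemma degree_factor: "degree (factor k q a) \<le> k"
  unfolding factor_def by (intro degree_sum_le) (auto intro: order_trans[OF degree_monom_le])

lemma coeff_factor: "coeff (factor k q a) k = q k"
proof -
  have "coeff (factor k q a) k = (\<Sum>e\<le>k. if e = k then q e * a ^ (k - e) else 0)"
    unfolding factor_def coeff_sum by (intro sum.cong) auto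
  then show ?thesis by simp
qed

text \<open>The exponent counts 2 for each of at most \<open>k + r\<close> linear factors,
  \<open>1 + k\<close> for the coefficient \<open>q e * a ^ (k - e)\<close>, and 1 for each of the
  sums over \<open>e\<close> and \<open>j\<close>.\<close>

lemma ex_has_rem_numer:
  fixes B :: int
  assumes r: "r \<ge> 1" and B: "rising_norm r + 1 \<le> B" "2 \<le> B" "int r \<le> B" "int k + 1 \<le> B"
    and q: "\<And>e. e \<le> k \<Longrightarrow> \<bar>q e\<bar> \<le> B" and a: "\<bar>a\<bar> \<le> B" "\<bar>D\<bar> \<le> B" "\<And>j. j < r \<Longrightarrow> \<bar>z j\<bar> \<le> B"
  shows "\<exists>C. has_rem r (B ^ (3 + 3 * k + 2 * r)) (numer k r q a D z) C"
proof -
  have mono: "B ^ i \<le> B ^ j" if "i \<le> j" for i j using B that by (intro power_increasing) auto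
  have rem_mono: "\<exists>C. has_rem r v' F C" if "\<exists>C. has_rem r v F C" "v \<le> v'" for v v' F
    using that has_rem_mono by blast
  have "\<exists>C. has_rem r (B ^ Suc (1 + 3 * k + 2 * r)) ((factor k q a \<circ>\<^sub>p [:z j, D:]) * (\<Prod>i\<in>{j<..<r}. [:int i, 1:])) C"
    if j: "j < r" for j
  proof -
    let ?P = "\<Prod>i\<in>{j<..<r}. [:int i, 1:] :: int poly"
    have "\<exists>C. has_rem r (B ^ (2 * card {j<..<r})) ?P C"
      using B r by (intro ex_has_rem_prod) auto
    then have P: "\<exists>C. has_rem r (B ^ (2 * r)) ?P C"
      by (rule rem_mono) (auto intro!: mono)
    have "\<exists>C. has_rem r (B ^ (1 + 3 * k + 2 * r)) (smult (q e * a ^ (k - e)) ([:z j, D:] ^ e * ?P)) C" if e: "e \<le> k" for e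
    proof -
      have "\<exists>C. has_rem r (B ^ (2 * r + 2 * e)) ([:z j, D:] ^ e * ?P) C"
        using P a j B r by (intro ex_has_rem_power) auto
      then obtain C where "has_rem r (B ^ (2 * r + 2 * e)) ([:z j, D:] ^ e * ?P) C" by blast
      from has_rem_smult[OF this, of "q e * a ^ (k - e)"]
      have "\<exists>C. has_rem r (\<bar>q e * a ^ (k - e)\<bar> * B ^ (2 * r + 2 * e)) (smult (q e * a ^ (k - e)) ([:z j, D:] ^ e * ?P)) C" by blast
      then show ?thesis
      proof (rule rem_mono)
        have "\<bar>a\<bar> ^ (k - e) \<le> B ^ (k - e)" using a by (intro power_mono) auto
        also have "\<dots> \<le> B ^ k" by (rule mono) simp
        finally have "\<bar>a\<bar> ^ (k - e) \<le> B ^ k" .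
        then have "\<bar>q e\<bar> * \<bar>a\<bar> ^ (k - e) \<le> B * B ^ k"
          using q[OF e] B by (intro mult_mono) auto
        then have "\<bar>q e * a ^ (k - e)\<bar> * B ^ (2 * r + 2 * e) \<le> (B * B ^ k) * B ^ (2 * r + 2 * k)"
          using e B by (intro mult_mono mono) (auto simp: abs_mult power_abs)
        also have "\<dots> = B ^ (1 + k + (2 * r + 2 * k))" by (simp only: power_add power_one_right)
        also have "1 + k + (2 * r + 2 * k) = 1 + 3 * k + 2 * r" by simp
        finally show "\<bar>q e * a ^ (k - e)\<bar> * B ^ (2 * r + 2 * e) \<le> B ^ (1 + 3 * k + 2 * r)" .
      qed
    qed
    note single = this
    have "\<exists>C. has_rem r (int (card {..k}) * B ^ (1 + 3 * k + 2 * r)) (\<Sum>e\<le>k. smult (q e * a ^ (k - e)) ([:z j, D:] ^ e * ?P)) C"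
      by (rule has_rem_sum[OF finite_atMost]) (rule single, simp only: atMost_iff)
    then have "\<exists>C. has_rem r (B * B ^ (1 + 3 * k + 2 * r)) (\<Sum>e\<le>k. smult (q e * a ^ (k - e)) ([:z j, D:] ^ e * ?P)) C"
    proof (rule rem_mono)
      show "int (card {..k}) * B ^ (1 + 3 * k + 2 * r) \<le> B * B ^ (1 + 3 * k + 2 * r)"
        using B by (intro mult_right_mono zero_le_power) simp_all
    qed
    then show ?thesis by (simp only: factor_pcompose sum_distrib_right mult_smult_left power_Suc[symmetric])
  qed
  note summand = this
  have "\<exists>C. has_rem r (int (card {..<r}) * B ^ Suc (1 + 3 * k + 2 * r)) (numer k r q a D z) C"
    unfolding numer_def by (rule has_rem_sum[OF finite_lessThan]) (rule summand, simp only: lessThan_iff)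
  then show ?thesis
  proof (rule rem_mono)
    have "int (card {..<r}) * B ^ Suc (1 + 3 * k + 2 * r) \<le> B * B ^ Suc (1 + 3 * k + 2 * r)"
      using B by (intro mult_right_mono zero_le_power) simp_all
    also have "\<dots> = B ^ Suc (Suc (1 + 3 * k + 2 * r))" by (rule power_Suc[symmetric])
    also have "Suc (Suc (1 + 3 * k + 2 * r)) = 3 + 3 * k + 2 * r" by simp
    finally show "int (card {..<r}) * B ^ Suc (1 + 3 * k + 2 * r) \<le> B ^ (3 + 3 * k + 2 * r)" .
  qed
qed

text \<open>At \<open>M\<close> the number \<open>poly C M + \<tau>\<close> is divisible by the
  value of \<open>rising r\<close>, but smaller in size, as \<open>C\<close> has degree below
  \<open>r\<close> and small coefficients; so it is 0. The lower terms of \<open>C\<close> and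
  \<open>\<tau>\<close> are only of order \<open>M ^ (r - 2)\<close> and cannot cancel a nonzero top
  term.\<close>

lemma has_rem_top_coeff_zero:
  assumes rem: "has_rem r v F C" and r: "r \<ge> 2" and M: "M > int r * v + u" "u \<ge> 0"
    and F: "poly F M = poly (rising r) M * s - \<tau>" and \<tau>: "\<bar>\<tau>\<bar> \<le> u * M ^ (r - 2)"
  shows "coeff C (r - 1) = 0"
proof -
  obtain A where A: "F = rising r * A + C" using rem by (auto simp: has_rem_def)
  have C: "\<And>i. i \<ge> r \<Longrightarrow> coeff C i = 0" "\<And>i. \<bar>coeff C i\<bar> \<le> v" using rem by (auto simp: has_rem_def)
  then have v: "v \<ge> 0" by (meson abs_ge_zero order_trans)
  have M1: "M \<ge> 1" using M v by (smt (verit) mult_nonneg_nonneg of_nat_0_le_iff)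
  obtain s' where r': "r = Suc (Suc s')" using r by (metis Suc_le_D numeral_2_eq_2 Suc_le_mono)
  have polyC: "poly C M = (\<Sum>i<r. coeff C i * M ^ i)"
  proof -
    have "degree C \<le> r - 1" using C(1) by (intro degree_le) auto
    then have "poly C M = (\<Sum>i\<le>r - 1. coeff C i * M ^ i)"
      unfolding poly_altdef by (intro sum.mono_neutral_left) (auto simp: coeff_eq_0)
    also have "{..r - 1} = {..<r}" using r by auto
    finally show ?thesis .
  qed
  have low: "\<bar>\<Sum>i<Suc s'. coeff C i * M ^ i\<bar> \<le> int (Suc s') * v * M ^ s'"
  proof -
    have "\<bar>\<Sum>i<Suc s'. coeff C i * M ^ i\<bar> \<le> (\<Sum>i<Suc s'. \<bar>coeff C i * M ^ i\<bar>)" by (rule sum_abs)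
    also have "\<dots> \<le> of_nat (card {..<Suc s'}) * (v * M ^ s')"
    proof (rule sum_bounded_above)
      fix i assume "i \<in> {..<Suc s'}"
      then have "M ^ i \<le> M ^ s'" using M1 by (intro power_increasing) auto
      then show "\<bar>coeff C i * M ^ i\<bar> \<le> v * M ^ s'"
        using C(2) v M1 by (simp add: abs_mult power_abs mult_mono)
    qed
    finally show ?thesis by (simp add: mult.assoc)
  qed
  have polyC': "poly C M = (\<Sum>i<Suc s'. coeff C i * M ^ i) + coeff C (r - 1) * (M * M ^ s')"
    unfolding polyC r' by simp
  have "\<bar>coeff C (r - 1) * (M * M ^ s')\<bar> \<le> v * (M * M ^ s')"
    using C(2) M1 by (simp add: abs_mult mult_right_mono)
  moreover have "int (Suc s') * v * M ^ s' \<le> int (Suc s') * v * (M * M ^ s')"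
    using v M1 by (intro mult_left_mono) auto
  moreover have "\<bar>\<tau>\<bar> \<le> u * (M * M ^ s')"
  proof -
    have "\<bar>\<tau>\<bar> \<le> u * M ^ s'" using \<tau> r' by simp
    also have "\<dots> \<le> u * (M * M ^ s')" using M M1 by (intro mult_left_mono) auto
    finally show ?thesis .
  qed
  ultimately have "\<bar>poly C M + \<tau>\<bar> \<le> int (Suc s') * v * (M * M ^ s') + v * (M * M ^ s') + u * (M * M ^ s')"
    unfolding polyC' using low by linarith
  also have "\<dots> = (int r * v + u) * (M * M ^ s')" unfolding r' by (simp add: algebra_simps)
  also have "\<dots> < M * (M * M ^ s')" using M M1 by (intro mult_strict_right_mono) auto
  also have "\<dots> = (\<Prod>i<r. M)" using r' by simp
  also have "\<dots> \<le> poly (rising r) M" unfolding poly_rising using M1 by (intro prod_mono) auto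
  finally have lt: "\<bar>poly C M + \<tau>\<bar> < poly (rising r) M" .
  have "poly C M + \<tau> = poly (rising r) M * (s - poly A M)"
    using F by (simp add: A algebra_simps)
  then have "poly (rising r) M dvd poly C M + \<tau>" by simp
  then have "poly C M + \<tau> = 0" using lt dvd_imp_le_int[of "poly C M + \<tau>" "poly (rising r) M"] by linarith
  then have "coeff C (r - 1) * (M * M ^ s') = - \<tau> - (\<Sum>i<Suc s'. coeff C i * M ^ i)" using polyC' by simp
  then have "\<bar>coeff C (r - 1) * (M * M ^ s')\<bar> \<le> u * M ^ s' + int (Suc s') * v * M ^ s'"
    using low \<tau> r' by simp
  also have "\<dots> \<le> (int r * v + u) * M ^ s'"
    using v M1 r' by (simp add: algebra_simps)
  also have "\<dots> < M * M ^ s'" using M M1 by (intro mult_strict_right_mono) auto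
  finally have "\<bar>coeff C (r - 1)\<bar> * (M * M ^ s') < 1 * (M * M ^ s')" using M1 by (simp add: abs_mult)
  then have "\<bar>coeff C (r - 1)\<bar> < 1" using M1 by (subst (asm) mult_less_cancel_right_pos) auto
  then show ?thesis by simp
qed

lemma coeff_mult_top:
  fixes F G :: "int poly"
  assumes "degree F \<le> m" "degree G \<le> n"
  shows "coeff (F * G) (m + n) = coeff F m * coeff G n"
proof (cases "degree F = m \<and> degree G = n")
  case True
  then show ?thesis using coeff_mult_degree_sum[of F G] by auto
next
  case False
  then have "degree (F * G) < m + n" using assms degree_mult_le[of F G] by linarith
  moreover have "coeff F m = 0 \<or> coeff G n = 0" using False assms by (auto intro: coeff_eq_0 simp: le_less)
  ultimately show ?thesis by (auto simp: coeff_eq_0)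
qed

lemma coeff_pcompose_top:
  fixes P :: "int poly"
  assumes "degree P \<le> m" "b \<noteq> 0"
  shows "coeff (P \<circ>\<^sub>p [:a, b:]) m = coeff P m * b ^ m" "degree (P \<circ>\<^sub>p [:a, b:]) \<le> m"
proof -
  have deg: "degree (P \<circ>\<^sub>p [:a, b:]) = degree P" using assms(2) by (simp add: degree_pcompose)
  then show "degree (P \<circ>\<^sub>p [:a, b:]) \<le> m" using assms(1) by simp
  show "coeff (P \<circ>\<^sub>p [:a, b:]) m = coeff P m * b ^ m"
  proof (cases "degree P = m")
    case True
    then show ?thesis using lead_coeff_comp[of "[:a, b:]" P] deg assms(2) by simp
  next
    case False
    then show ?thesis using assms(1) deg by (simp add: coeff_eq_0)
  qed
qed

text \<open>In the difference of the two numerators, summand \<open>j\<close> has degree at most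
  \<open>k - 1 + (r - 1 - j)\<close>. Summands with \<open>j < k - 1\<close> cancel and those with
  \<open>j > k - 1\<close> do not reach degree \<open>r - 1\<close>, so coefficient
  \<open>r - 1\<close> comes from \<open>j = k - 1\<close> alone and is a nonzero multiple of
  \<open>z (k - 1) - z' (k - 1)\<close>.\<close>

lemma numer_determines:
  assumes rem: "has_rem r v (numer k r q a D z) C" "has_rem r v (numer k r q a D z') C'"
    and zero: "coeff C (r - 1) = 0" "coeff C' (r - 1) = 0"
    and eq: "\<And>j. j < k - 1 \<Longrightarrow> z j = z' j"
    and k: "1 \<le> k" "k \<le> r" and q: "q k \<noteq> 0" and D: "D \<noteq> 0"
  shows "z (k - 1) = z' (k - 1)"
proof -
  define F where "F = numer k r q a D z - numer k r q a D z'"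
  define \<Delta> where "\<Delta> = (\<lambda>j. factor k q a \<circ>\<^sub>p [:z j, D:] - factor k q a \<circ>\<^sub>p [:z' j, D:])"
  define L where "L = (\<lambda>j. \<Prod>i\<in>{j<..<r}. [:int i, 1:] :: int poly)"
  obtain d where d: "k = Suc d" using k by (cases k) auto
  have F: "F = (\<Sum>j<r. \<Delta> j * L j)"
    by (simp add: F_def numer_def \<Delta>_def L_def sum_subtractf left_diff_distrib)
  have \<Delta>: "degree (\<Delta> j) \<le> d" "coeff (\<Delta> j) d = int k * (z j - z' j) * q k * D ^ d" for j
  proof -
    let ?P = "factor k q a \<circ>\<^sub>p [:z j - z' j, 1:] - factor k q a"
    have e: "\<Delta> j = ?P \<circ>\<^sub>p [:z' j, D:]"
      by (simp add: \<Delta>_def pcompose_diff pcompose_assoc[symmetric] pcompose_pCons)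
    have P: "degree ?P \<le> d" "coeff ?P d = int (Suc d) * (z j - z' j) * coeff (factor k q a) (Suc d)"
      using coeff_pcompose_diff[of "factor k q a" d "z j - z' j"] degree_factor[of k q a] d by simp_all
    show "degree (\<Delta> j) \<le> d" unfolding e by (rule coeff_pcompose_top(2)[OF P(1) D])
    show "coeff (\<Delta> j) d = int k * (z j - z' j) * q k * D ^ d"
      unfolding e coeff_pcompose_top(1)[OF P(1) D] P(2) using coeff_factor[of k q a] d by simp
  qed
  have L: "degree (L j) = r - 1 - j" if "j < r" for j
    unfolding L_def degree_linear_prod using that by simp
  have zero_low: "\<Delta> j = 0" if "j < d" for j using eq[of j] that d by (simp add: \<Delta>_def)
  have degF: "degree F \<le> r - 1" unfolding F
  proof (rule degree_sum_le)
    fix j assume j: "j \<in> {..<r}"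
    show "degree (\<Delta> j * L j) \<le> r - 1"
    proof (cases "j < d")
      case False
      have "degree (\<Delta> j * L j) \<le> d + (r - 1 - j)"
        using degree_mult_le[of "\<Delta> j" "L j"] \<Delta>(1)[of j] L[of j] j by simp
      then show ?thesis using False j by simp
    qed (simp add: zero_low)
  qed simp
  obtain A A' where AA: "numer k r q a D z = rising r * A + C" "numer k r q a D z' = rising r * A' + C'"
    using rem by (auto simp: has_rem_def)
  have FA: "F = rising r * (A - A') + (C - C')" unfolding F_def AA by (simp add: algebra_simps)
  \<comment> \<open>\<open>F\<close> has degree below \<open>r\<close>, so both numerators have the
    same quotient and \<open>F\<close> is the difference of the remainders.\<close>
  have "A - A' = 0"
  proof (rule ccontr)
    assume nz: "A - A' \<noteq> 0"
    have "coeff (rising r * (A - A')) (r + degree (A - A')) = lead_coeff (A - A')"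
      using coeff_mult_top[of "rising r" r "A - A'" "degree (A - A')"] by (simp add: degree_rising coeff_rising_top)
    moreover have "coeff F (r + degree (A - A')) = 0" using degF k by (intro coeff_eq_0) simp
    moreover have "coeff (C - C') (r + degree (A - A')) = 0" using rem by (simp add: has_rem_def)
    ultimately have "lead_coeff (A - A') = 0" unfolding FA coeff_add by simp
    then show False using nz leading_coeff_0_iff by blast
  qed
  then have "coeff F (r - 1) = 0" unfolding FA using zero by simp
  moreover have "coeff F (r - 1) = int k * (z d - z' d) * q k * D ^ d"
  proof -
    have "coeff F (r - 1) = (\<Sum>j<r. coeff (\<Delta> j * L j) (r - 1))" unfolding F coeff_sum ..
    also have "\<dots> = (\<Sum>j<r. if j = d then int k * (z d - z' d) * q k * D ^ d else 0)"
    proof (rule sum.cong[OF refl])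
      fix j assume j: "j \<in> {..<r}"
      consider "j < d" | "j = d" | "j > d" by linarith
      then show "coeff (\<Delta> j * L j) (r - 1) = (if j = d then int k * (z d - z' d) * q k * D ^ d else 0)"
      proof cases
        case 1
        then show ?thesis by (simp add: zero_low)
      next
        case 2
        have "lead_coeff (L j) = 1" unfolding L_def by (simp add: lead_coeff_prod)
        then have "coeff (L j) (r - 1 - j) = 1" using L j by simp
        moreover have "coeff (\<Delta> j * L j) (d + (r - 1 - j)) = coeff (\<Delta> j) d * coeff (L j) (r - 1 - j)"
          using \<Delta>(1) L j by (intro coeff_mult_top) auto
        moreover have "d + (r - 1 - j) = r - 1" using 2 j by simp
        ultimately show ?thesis using 2 \<Delta>(2)[of d] by simp
      next
        case 3
        have "degree (\<Delta> j * L j) \<le> d + (r - 1 - j)"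
          using degree_mult_le[of "\<Delta> j" "L j"] \<Delta>(1)[of j] L[of j] j by simp
        then show ?thesis using 3 j by (auto intro!: coeff_eq_0)
      qed
    qed
    also have "\<dots> = int k * (z d - z' d) * q k * D ^ d" using d k by simp
    finally show ?thesis .
  qed
  ultimately show ?thesis using q D k d by simp
qed

subsection \<open>Cubes in the graph of an increasing sequence\<close>

lemma pigeonhole_card_fibre:
  assumes "finite X" "finite V" "f ` X \<subseteq> V" "X \<noteq> {}"
  shows "\<exists>v\<in>V. card X \<le> card V * card {x \<in> X. f x = v}"
proof (rule ccontr)
  assume "\<not> ?thesis"
  then have lt: "card V * card {x \<in> X. f x = v} < card X" if "v \<in> V" for v using that by auto
  have V: "V \<noteq> {}" using assms by auto
  have "card X = (\<Sum>v\<in>V. card {x \<in> X. f x = v})"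
  proof -
    have "X = (\<Union>v\<in>V. {x \<in> X. f x = v})" using assms(3) by auto
    then have "card X = card (\<Union>v\<in>V. {x \<in> X. f x = v})" by simp
    also have "\<dots> = (\<Sum>v\<in>V. card {x \<in> X. f x = v})"
      using assms by (intro card_UN_disjoint) auto
    finally show ?thesis .
  qed
  then have "card V * card X = (\<Sum>v\<in>V. card V * card {x \<in> X. f x = v})"
    by (simp add: sum_distrib_left)
  also have "\<dots> < (\<Sum>v\<in>V. card X)" using lt assms(2) V by (intro sum_strict_mono) auto
  finally show False by simp
qed

lemma few_large_steps:
  fixes a :: "nat \<Rightarrow> nat"
  assumes "\<And>i. i < m \<Longrightarrow> a i \<le> a (Suc i)"
  shows "K * card {i. i < m \<and> K < a (Suc i) - a i} + a 0 \<le> a m"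
  using assms
proof (induction m)
  case (Suc m)
  have IH: "K * card {i. i < m \<and> K < a (Suc i) - a i} + a 0 \<le> a m" using Suc by simp
  have le: "a m \<le> a (Suc m)" using Suc.prems by simp
  show ?case
  proof (cases "K < a (Suc m) - a m")
    case True
    then have "{i. i < Suc m \<and> K < a (Suc i) - a i} = insert m {i. i < m \<and> K < a (Suc i) - a i}"
      by (auto simp: less_Suc_eq)
    then show ?thesis using IH True by simp
  next
    case False
    then have "{i. i < Suc m \<and> K < a (Suc i) - a i} = {i. i < m \<and> K < a (Suc i) - a i}"
      by (auto simp: less_Suc_eq)
    then show ?thesis using IH le by simp
  qed
qed simp

lemma many_small_steps:
  fixes a :: "nat \<Rightarrow> nat"
  assumes "\<And>i. i < m \<Longrightarrow> a i \<le> a (Suc i)"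
  shows "K * m + a 0 \<le> a m + K * card {i. i < m \<and> a (Suc i) - a i \<le> K}"
proof -
  let ?L = "{i. i < m \<and> K < a (Suc i) - a i}" and ?S = "{i. i < m \<and> a (Suc i) - a i \<le> K}"
  have "card {..<m} = card (?L \<union> ?S)" by (rule arg_cong[of _ _ card]) auto
  also have "\<dots> = card ?L + card ?S" by (intro card_Un_disjoint) auto
  finally have "K * m = K * card ?L + K * card ?S" unfolding card_lessThan by (simp only: distrib_left[symmetric])
  moreover have "K * card ?L + a 0 \<le> a m" using assms by (rule few_large_steps)
  ultimately show ?thesis by linarith
qed

lemma exists_small_step:
  fixes a :: "nat \<Rightarrow> nat"
  assumes "\<And>i. i < m \<Longrightarrow> a i \<le> a (Suc i)" "m \<ge> 1" "a m \<le> a 0 + m * s"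
  shows "\<exists>i<m. a (Suc i) - a i \<le> s"
proof (rule ccontr)
  assume not: "\<not> ?thesis"
  have "n \<le> m \<Longrightarrow> a 0 + n * Suc s \<le> a n" for n
  proof (induction n)
    case (Suc n)
    then have "a 0 + n * Suc s \<le> a n" "n < m" by auto
    moreover from this(2) have "s < a (Suc n) - a n" using not not_le by blast
    ultimately show ?case by simp
  qed simp
  then have "a 0 + m * Suc s \<le> a m" by simp
  then show False using assms by simp
qed

locale increasing =
  fixes p :: "nat \<Rightarrow> nat"
  assumes p_less: "\<And>m n. 1 \<le> m \<Longrightarrow> m < n \<Longrightarrow> p m < p n"
begin

lemma p_le: "1 \<le> m \<Longrightarrow> m \<le> n \<Longrightarrow> p m \<le> p n"
  using p_less[of m n] by (cases "m = n") auto

lemma p_ge: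
  assumes "1 \<le> n" "1 \<le> p 1"
  shows "n \<le> p n"
  using assms
proof (induction n rule: dec_induct)
  case (step n)
  then show ?case using p_less[of n "Suc n"] by simp
qed simp

text \<open>Run through \<open>S\<close> in increasing order. The total rise of
  \<open>n + p n\<close>, a sum that controls both components of a step at once, is bounded; so most
  consecutive steps are at most \<open>K\<close>, and these take at most \<open>K * (K + 1)\<close>
  values.\<close>

lemma popular_difference:
  assumes S: "finite S" "S \<subseteq> {n0..n0 + R}" "card S \<ge> 2" and n0: "n0 \<ge> 1" and K: "K \<ge> 1"
    and span: "(n0 + R) + p (n0 + R) \<le> n0 + p n0 + l"
    and big: "l < K * (card S - 1)"
  shows "\<exists>\<delta> \<epsilon>. 1 \<le> \<delta> \<and> \<delta> \<le> K \<and> \<epsilon> \<le> K \<and>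
    K * (card S - 1) \<le> l + K * (K * (K + 1) * card {n \<in> S. n + \<delta> \<in> S \<and> p (n + \<delta>) = p n + \<epsilon>})"
proof -
  define xs where "xs = sorted_list_of_set S"
  define m where "m = card S - 1"
  have len: "length xs = Suc m" using S by (simp add: xs_def m_def)
  have inS: "xs ! i \<in> S" if "i \<le> m" for i
    using that len S(1) nth_mem[of i xs] by (simp add: xs_def)
  have sorted: "xs ! i < xs ! j" if "i < j" "j \<le> m" for i j
    using that len strict_sorted_list_of_set[of S] sorted_wrt_nth_less[of "(<)" xs i j] by (simp add: xs_def)
  have ge1: "1 \<le> xs ! i" if "i \<le> m" for i using inS[OF that] S(2) n0 by auto
  define a where "a = (\<lambda>i. xs ! i + p (xs ! i))"
  have step: "xs ! i < xs ! Suc i" "p (xs ! i) < p (xs ! Suc i)" if "i < m" for i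
    using sorted[of i "Suc i"] ge1[of i] that by (auto intro: p_less)
  define G where "G = {i. i < m \<and> a (Suc i) - a i \<le> K}"
  have "K * m + a 0 \<le> a m + K * card G"
    unfolding G_def by (rule many_small_steps) (use step in \<open>auto simp: a_def intro: add_mono less_imp_le\<close>)
  moreover have "a m + n0 + p n0 \<le> n0 + p n0 + l + a 0"
  proof -
    have "xs ! m \<le> n0 + R" "n0 \<le> xs ! 0" using inS[of m] inS[of 0] S(2) by auto
    then have "a m \<le> (n0 + R) + p (n0 + R)" "n0 + p n0 \<le> a 0"
      unfolding a_def using ge1[of m] n0 by (auto intro!: add_mono p_le)
    then show ?thesis using span by simp
  qed
  ultimately have cardG: "K * m \<le> l + K * card G" by simp
  have "G \<noteq> {}" using cardG big by (auto simp: m_def)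
  define f where "f = (\<lambda>i. (xs ! Suc i - xs ! i, p (xs ! Suc i) - p (xs ! i)))"
  have fG: "f ` G \<subseteq> {1..K} \<times> {0..K}"
  proof
    fix v assume "v \<in> f ` G"
    then obtain i where i: "i < m" "a (Suc i) - a i \<le> K" "v = f i" by (auto simp: G_def)
    then show "v \<in> {1..K} \<times> {0..K}" using step[OF i(1)] unfolding mem_Times_iff atLeastAtMost_iff by (simp add: f_def a_def) linarith
  qed
  obtain v where v: "v \<in> {1..K} \<times> {0..K}" "card G \<le> card ({1..K} \<times> {0..K}) * card {i \<in> G. f i = v}"
    using pigeonhole_card_fibre[OF _ _ fG \<open>G \<noteq> {}\<close>] by (auto simp: G_def)
  obtain \<delta> \<epsilon> where d: "v = (\<delta>, \<epsilon>)" by (cases v)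
  let ?S' = "{n \<in> S. n + \<delta> \<in> S \<and> p (n + \<delta>) = p n + \<epsilon>}"
  have "card {i \<in> G. f i = v} = card ((\<lambda>i. xs ! i) ` {i \<in> G. f i = v})"
  proof (rule card_image[symmetric], rule inj_onI)
    fix i j assume "i \<in> {i \<in> G. f i = v}" "j \<in> {i \<in> G. f i = v}" "xs ! i = xs ! j"
    then show "i = j" using sorted[of i j] sorted[of j i] by (cases i j rule: linorder_cases) (auto simp: G_def)
  qed
  also have "\<dots> \<le> card ?S'"
  proof (intro card_mono)
    show "finite ?S'" using S(1) by simp
    show "(\<lambda>i. xs ! i) ` {i \<in> G. f i = v} \<subseteq> ?S'"
    proof
      fix n assume "n \<in> (\<lambda>i. xs ! i) ` {i \<in> G. f i = v}"
      then obtain i where i: "i < m" "f i = v" "n = xs ! i" by (auto simp: G_def)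
      then have "n + \<delta> = xs ! Suc i" "p (xs ! Suc i) = p n + \<epsilon>"
        using step[OF i(1)] by (auto simp: f_def d)
      then show "n \<in> ?S'" using inS[of i] inS[of "Suc i"] i by auto
    qed
  qed
  finally have "card G \<le> K * (K + 1) * card ?S'"
    using v(2) by (auto simp: card_cartesian_product intro: order_trans mult_le_mono2)
  then have "K * card G \<le> K * (K * (K + 1) * card ?S')" by (rule mult_le_mono2)
  with cardG have "K * m \<le> l + K * (K * (K + 1) * card ?S')" by linarith
  then show ?thesis using v(1) d unfolding m_def by auto
qed

primrec dexp :: "nat \<Rightarrow> nat \<Rightarrow> nat" where
  "dexp a 0 = a"
| "dexp a (Suc m) = 3 * dexp a m + 5"

text \<open>In a set of density \<open>1 / Y ^ e\<close> the average step of \<open>n + p n\<close>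
  is about \<open>2 * Y ^ (e + 1)\<close> at most, so \<open>K = Y ^ (e + 2)\<close> leaves at least
  half of the steps small. The pigeonhole then costs \<open>8 * K * K \<le> Y ^ (2 * e + 5)\<close>,
  which turns the density exponent into \<open>3 * e + 5\<close>.\<close>

lemma popular_difference_density:
  assumes S: "finite S" "S \<subseteq> {n0..n0 + R}" and n0: "n0 \<ge> 1" and Y: "Y \<ge> 8"
    and span: "p (n0 + R) \<le> p n0 + R * Y"
    and dense: "R \<le> card S * Y ^ e" and R: "R > Y ^ e"
  shows "\<exists>\<delta> \<epsilon>. 1 \<le> \<delta> \<and> \<delta> \<le> Y ^ (e + 2) \<and> \<epsilon> \<le> Y ^ (e + 2) \<and>
    R \<le> card {n \<in> S. n + \<delta> \<in> S \<and> p (n + \<delta>) = p n + \<epsilon>} * Y ^ (3 * e + 5)"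
proof -
  define K where "K = Y ^ (e + 2)"
  define c where "c = card S"
  have K1: "K \<ge> 1" using Y by (simp add: K_def)
  have "c \<ge> 2"
  proof (rule ccontr)
    assume "\<not> c \<ge> 2"
    then have "c * Y ^ e \<le> 1 * Y ^ e" by (intro mult_le_mono1) simp
    then show False using dense R unfolding c_def by linarith
  qed
  have small: "4 * (2 * (R * Y)) \<le> K * c"
  proof -
    have "4 * (2 * (R * Y)) = 8 * Y * R" by simp
    also have "\<dots> \<le> Y * Y * (c * Y ^ e)" using Y dense by (intro mult_le_mono) (auto simp: c_def)
    finally show ?thesis by (simp add: K_def power_add power2_eq_square mult_ac)
  qed
  have half: "K * c \<le> 2 * (K * (c - 1))"
  proof -
    have "c \<le> 2 * (c - 1)" using \<open>c \<ge> 2\<close> by linarith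
    then have "K * c \<le> K * (2 * (c - 1))" by (rule mult_le_mono2)
    then show ?thesis by (simp only: ac_simps)
  qed
  have Kc: "0 < K * c" using K1 \<open>c \<ge> 2\<close> by simp
  have sp: "(n0 + R) + p (n0 + R) \<le> n0 + p n0 + 2 * (R * Y)"
  proof -
    have "R * 1 \<le> R * Y" using Y by (intro mult_le_mono2) simp
    then show ?thesis using span by linarith
  qed
  obtain \<delta> \<epsilon> where d: "1 \<le> \<delta>" "\<delta> \<le> K" "\<epsilon> \<le> K"
    "K * (c - 1) \<le> 2 * (R * Y) + K * (K * (K + 1) * card {n \<in> S. n + \<delta> \<in> S \<and> p (n + \<delta>) = p n + \<epsilon>})"
  proof -
    have "2 * (R * Y) < K * (c - 1)" using small half Kc by linarith
    from popular_difference[OF S \<open>c \<ge> 2\<close>[unfolded c_def] n0 K1 sp this[unfolded c_def]]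
    show thesis using that unfolding c_def by blast
  qed
  define c' where "c' = card {n \<in> S. n + \<delta> \<in> S \<and> p (n + \<delta>) = p n + \<epsilon>}"
  have "K * c \<le> K * (4 * (K * (K + 1) * c'))" using d(4) small half unfolding c'_def by linarith
  then have "c \<le> 4 * (K * (K + 1) * c')" using K1 by simp
  also have "\<dots> \<le> 4 * (K * (2 * K) * c')" using K1 by (intro mult_le_mono2 mult_le_mono1) simp
  also have "\<dots> = 8 * (K * K * c')" by simp
  also have "\<dots> \<le> Y * (K * K * c')" using Y by (intro mult_le_mono1)
  also have "\<dots> = c' * Y ^ (2 * e + 5)" unfolding K_def by (simp add: power_add power2_eq_square eval_nat_numeral mult_ac mult_2)
  finally have "c * Y ^ e \<le> c' * Y ^ (2 * e + 5) * Y ^ e" by (intro mult_le_mono1)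
  also have "\<dots> = c' * Y ^ (3 * e + 5)" by (simp add: power_add[symmetric] mult.assoc)
  finally have "R \<le> c' * Y ^ (3 * e + 5)" using dense unfolding c_def by linarith
  then show ?thesis using d(1-3) unfolding K_def c'_def by blast
qed

definition rlist :: "(nat \<times> nat) list \<Rightarrow> (real \<times> real) list" where
  "rlist ds = map (\<lambda>(a, b). (real a, real b)) ds"

text \<open>Hilbert's cube lemma by iteration: each round keeps the base points whose translate by a
  popular difference is again a base point, and so gains one direction. \<open>dexp\<close> records
  the loss of density.\<close>

lemma exists_cube:
  assumes S: "finite S" "S \<subseteq> {n0..n0 + R}" and n0: "n0 \<ge> 1" and Y: "Y \<ge> 8"
    and span: "p (n0 + R) \<le> p n0 + R * Y"
    and dense: "R \<le> card S * Y ^ e" and R: "R > Y ^ dexp e m"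
  shows "\<exists>ds T. length ds = m \<and> (\<forall>(\<delta>, \<epsilon>)\<in>set ds. 1 \<le> \<delta> \<and> \<delta> \<le> Y ^ (dexp e m + 2) \<and> \<epsilon> \<le> Y ^ (dexp e m + 2))
    \<and> T \<subseteq> S \<and> R \<le> card T * Y ^ dexp e m
    \<and> (\<forall>n\<in>T. cube_pts (rlist ds) (real n) (real (p n)) \<subseteq> (\<lambda>n. (real n, real (p n))) ` S)"
  using R
proof (induction m)
  case 0
  then show ?case using dense by (intro exI[of _ "[]"] exI[of _ S]) (auto simp: rlist_def)
next
  case (Suc m)
  have le: "dexp e m \<le> dexp e (Suc m)" by simp
  have pow: "Y ^ i \<le> Y ^ j" if "i \<le> j" for i j using Y that by (intro power_increasing) auto
  have R: "R > Y ^ dexp e m" using Suc.prems pow[OF le] by linarith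
  obtain ds T where IH: "length ds = m" "\<forall>(\<delta>, \<epsilon>)\<in>set ds. 1 \<le> \<delta> \<and> \<delta> \<le> Y ^ (dexp e m + 2) \<and> \<epsilon> \<le> Y ^ (dexp e m + 2)"
    "T \<subseteq> S" "R \<le> card T * Y ^ dexp e m"
    "\<forall>n\<in>T. cube_pts (rlist ds) (real n) (real (p n)) \<subseteq> (\<lambda>n. (real n, real (p n))) ` S"
    using Suc.IH[OF R] by blast
  have T: "finite T" "T \<subseteq> {n0..n0 + R}" using IH(3) S finite_subset by auto
  obtain \<delta> \<epsilon> where d: "1 \<le> \<delta>" "\<delta> \<le> Y ^ (dexp e m + 2)" "\<epsilon> \<le> Y ^ (dexp e m + 2)"
    "R \<le> card {n \<in> T. n + \<delta> \<in> T \<and> p (n + \<delta>) = p n + \<epsilon>} * Y ^ (3 * dexp e m + 5)"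
    using popular_difference_density[OF T n0 Y span IH(4) R] by blast
  let ?T' = "{n \<in> T. n + \<delta> \<in> T \<and> p (n + \<delta>) = p n + \<epsilon>}"
  have b: "Y ^ (dexp e m + 2) \<le> Y ^ (dexp e (Suc m) + 2)" by (rule pow) simp
  show ?case
  proof (intro exI[of _ "(\<delta>, \<epsilon>) # ds"] exI[of _ ?T'] conjI)
    show "\<forall>(\<delta>, \<epsilon>)\<in>set ((\<delta>, \<epsilon>) # ds). 1 \<le> \<delta> \<and> \<delta> \<le> Y ^ (dexp e (Suc m) + 2) \<and> \<epsilon> \<le> Y ^ (dexp e (Suc m) + 2)"
    proof
      fix x assume "x \<in> set ((\<delta>, \<epsilon>) # ds)"
      then consider "x = (\<delta>, \<epsilon>)" | "x \<in> set ds" by auto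
      then show "case x of (\<delta>, \<epsilon>) \<Rightarrow> 1 \<le> \<delta> \<and> \<delta> \<le> Y ^ (dexp e (Suc m) + 2) \<and> \<epsilon> \<le> Y ^ (dexp e (Suc m) + 2)"
        using d(1-3) IH(2) le_trans[OF _ b] by cases (simp, blast)
    qed
    show "\<forall>n\<in>?T'. cube_pts (rlist ((\<delta>, \<epsilon>) # ds)) (real n) (real (p n)) \<subseteq> (\<lambda>n. (real n, real (p n))) ` S"
    proof
      fix n assume n: "n \<in> ?T'"
      then have "cube_pts (rlist ds) (real n) (real (p n)) \<subseteq> (\<lambda>n. (real n, real (p n))) ` S"
        using IH(5)[rule_format, of n] by simp
      moreover have "cube_pts (rlist ds) (real (n + \<delta>)) (real (p (n + \<delta>))) \<subseteq> (\<lambda>n. (real n, real (p n))) ` S"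
        using n by (intro IH(5)[rule_format]) simp
      moreover have "real (n + \<delta>) = real n + real \<delta>" "real (p (n + \<delta>)) = real (p n) + real \<epsilon>" using n by auto
      ultimately show "cube_pts (rlist ((\<delta>, \<epsilon>) # ds)) (real n) (real (p n)) \<subseteq> (\<lambda>n. (real n, real (p n))) ` S"
        by (simp add: rlist_def)
    qed
  qed (use IH d in auto)
qed

text \<open>Cut the window into blocks of length \<open>r\<close>. As \<open>p\<close> rises by at
  most \<open>R * Y\<close> in total, many blocks rise by at most \<open>Y ^ 2\<close>, and their
  words take at most \<open>(Y ^ 2 + 1) ^ Suc r \<le> Y ^ (3 * r + 3)\<close> values. The last
  factor \<open>Y\<close> pays for passing from the window to the good blocks.\<close>

lemma exists_word_class:
  assumes r: "r \<ge> 1" and n0: "n0 \<ge> 1" and Y: "Y \<ge> 8" "Y \<ge> 4 * r" "R \<ge> Y"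
    and span: "p (n0 + R) \<le> p n0 + R * Y"
  shows "\<exists>S d. finite S \<and> S \<subseteq> {n0..n0 + R} \<and> R \<le> card S * Y ^ (3 * r + 4) \<and>
    d 0 = 0 \<and> (\<forall>j\<le>r. d j \<le> Y ^ 2) \<and> (\<forall>n\<in>S. \<forall>j\<le>r. p (n + j) = p n + d j)"
proof -
  define m where "m = R div r"
  define a where "a = (\<lambda>i. p (n0 + i * r))"
  define G where "G = {i. i < m \<and> a (Suc i) - a i \<le> Y ^ 2}"
  have mr: "m * r \<le> R" by (simp add: m_def)
  have mR: "R < (m + 1) * r" using div_mult_mod_eq[of R r] mod_less_divisor[of r R] r unfolding m_def by (simp only: distrib_right) linarith
  have "Y ^ 2 * m + a 0 \<le> a m + Y ^ 2 * card G"
    unfolding G_def by (rule many_small_steps) (use n0 in \<open>auto simp: a_def intro!: p_le\<close>)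
  moreover have "a m \<le> a 0 + R * Y"
    using p_le[of "n0 + m * r" "n0 + R"] mr n0 span by (simp add: a_def)
  ultimately have "Y * (Y * m) \<le> Y * (R + Y * card G)" by (simp add: power2_eq_square algebra_simps)
  then have good: "Y * m \<le> R + Y * card G" using Y by simp
  have "4 * R \<le> 4 * ((m + 1) * r)" using mR by simp
  also have "\<dots> = (4 * r) * (m + 1)" by simp
  also have "\<dots> \<le> Y * (m + 1)" using Y(2) by (rule mult_le_mono1)
  finally have "4 * R \<le> Y * m + Y" by simp
  then have "2 * R \<le> Y * card G" using good Y(3) by linarith
  then have RG: "R \<le> Y * card G" by simp
  then have "G \<noteq> {}" using Y by (auto simp: Suc_le_eq)
  define f where "f = (\<lambda>i. map (\<lambda>j. p (n0 + i * r + j) - p (n0 + i * r)) [0..<Suc r])"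
  define V where "V = {xs. set xs \<subseteq> {..Y ^ 2} \<and> length xs = Suc r}"
  have fG: "f ` G \<subseteq> V"
  proof
    fix v assume "v \<in> f ` G"
    then obtain i where i: "i < m" "a (Suc i) - a i \<le> Y ^ 2" "v = f i" by (auto simp: G_def)
    have "p (n0 + i * r + j) - p (n0 + i * r) \<le> Y ^ 2" if "j \<le> r" for j
    proof -
      have "p (n0 + i * r + j) \<le> p (n0 + i * r + r)" using n0 that by (intro p_le) auto
      then show ?thesis using i(2) by (simp add: a_def add_ac)
    qed
    then show "v \<in> V" by (auto simp: V_def i(3) f_def simp del: upt_Suc)
  qed
  have V: "finite V" "card V = (Y ^ 2 + 1) ^ Suc r"
    unfolding V_def by (auto simp: finite_lists_length_eq card_lists_length_eq)
  obtain v where v: "v \<in> V" "card G \<le> card V * card {i \<in> G. f i = v}"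
    using pigeonhole_card_fibre[OF _ V(1) fG \<open>G \<noteq> {}\<close>] by (auto simp: G_def)
  define S where "S = (\<lambda>i. n0 + i * r) ` {i \<in> G. f i = v}"
  define d where "d = (\<lambda>j. v ! j)"
  have word: "p (n0 + i * r + j) = p (n0 + i * r) + d j" if "i \<in> {i \<in> G. f i = v}" "j \<le> r" for i j
  proof -
    have "d j = p (n0 + i * r + j) - p (n0 + i * r)" using that by (auto simp: d_def f_def simp del: upt_Suc)
    moreover have "p (n0 + i * r) \<le> p (n0 + i * r + j)" using n0 by (intro p_le) auto
    ultimately show ?thesis by simp
  qed
  have cardS: "card S = card {i \<in> G. f i = v}"
    unfolding S_def using r by (intro card_image inj_onI) auto
  have "finite G" by (simp add: G_def)
  then have "card G > 0" using \<open>G \<noteq> {}\<close> by (simp add: card_gt_0_iff)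
  then have "card {i \<in> G. f i = v} \<noteq> 0" using v(2) by (intro notI) simp
  then have "{i \<in> G. f i = v} \<noteq> {}" by (intro notI) (simp only: card.empty)
  then obtain i0 where i0: "i0 \<in> {i \<in> G. f i = v}" by blast
  show ?thesis
  proof (intro exI[of _ S] exI[of _ d] conjI)
    show "finite S" by (simp add: S_def G_def)
    show "S \<subseteq> {n0..n0 + R}"
    proof
      fix n assume "n \<in> S"
      then obtain i where i: "i < m" "n = n0 + i * r" by (auto simp: S_def G_def)
      then have "i * r \<le> m * r" by (intro mult_le_mono1) simp
      then show "n \<in> {n0..n0 + R}" using i(2) mr unfolding atLeastAtMost_iff by linarith
    qed
    show "R \<le> card S * Y ^ (3 * r + 4)"
    proof -
      have "Y ^ 2 + 1 \<le> 2 * Y ^ 2" using Y by simp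
      also have "\<dots> \<le> Y * Y ^ 2" using Y by (intro mult_le_mono1) simp
      finally have "Y ^ 2 + 1 \<le> Y ^ 3" by (simp add: power3_eq_cube power2_eq_square)
      then have "card V \<le> (Y ^ 3) ^ Suc r" unfolding V(2) by (intro power_mono) auto
      also have "\<dots> = Y ^ (3 * r + 3)" by (simp only: power_mult[symmetric] mult_Suc_right add.commute)
      finally have "card G \<le> Y ^ (3 * r + 3) * card S" unfolding cardS using mult_le_mono1 v(2) le_trans by blast
      then have "R \<le> Y * (Y ^ (3 * r + 3) * card S)" by (rule le_trans[OF RG mult_le_mono2])
      also have "\<dots> = card S * Y ^ Suc (3 * r + 3)" by (simp only: power_Suc ac_simps)
      also have "Suc (3 * r + 3) = 3 * r + 4" by simp
      finally show ?thesis .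
    qed
    show "d 0 = 0" using word[OF i0, of 0] by simp
    show "\<forall>j\<le>r. d j \<le> Y ^ 2" using v(1) by (auto simp: V_def d_def subset_iff)
    show "\<forall>n\<in>S. \<forall>j\<le>r. p (n + j) = p n + d j" using word by (auto simp: S_def)
  qed
qed

end

subsection \<open>Collinear directions and periodicity\<close>

text \<open>This description does not depend on the order of the directions, so they can be sorted
  and subfamilies can be selected.\<close>

lemma cube_pts_iff:
  "(y', x') \<in> cube_pts ds y x \<longleftrightarrow>
    (\<exists>M. M \<subseteq># mset ds \<and> y' = y + (\<Sum>d\<in>#M. fst d) \<and> x' = x + (\<Sum>d\<in>#M. snd d))"
proof (induction ds arbitrary: y x)
  case Nil
  show ?case by auto
next
  case (Cons d ds)
  show ?case
  proof
    assume "(y', x') \<in> cube_pts (d # ds) y x"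
    then consider "(y', x') \<in> cube_pts ds y x" | "(y', x') \<in> cube_pts ds (y + fst d) (x + snd d)" by auto
    then show "\<exists>M. M \<subseteq># mset (d # ds) \<and> y' = y + (\<Sum>d\<in>#M. fst d) \<and> x' = x + (\<Sum>d\<in>#M. snd d)"
    proof cases
      case 1
      then obtain M where "M \<subseteq># mset ds" "y' = y + (\<Sum>d\<in>#M. fst d)" "x' = x + (\<Sum>d\<in>#M. snd d)"
        using Cons.IH by blast
      then show ?thesis by (intro exI[of _ M]) (auto simp: subset_mset.order_trans[of M "mset ds"])
    next
      case 2
      then obtain M where "M \<subseteq># mset ds" "y' = y + fst d + (\<Sum>d\<in>#M. fst d)" "x' = x + snd d + (\<Sum>d\<in>#M. snd d)"
        using Cons.IH by blast
      then show ?thesis by (intro exI[of _ "add_mset d M"]) auto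
    qed
  next
    assume "\<exists>M. M \<subseteq># mset (d # ds) \<and> y' = y + (\<Sum>d\<in>#M. fst d) \<and> x' = x + (\<Sum>d\<in>#M. snd d)"
    then obtain M where M: "M \<subseteq># add_mset d (mset ds)" "y' = y + (\<Sum>d\<in>#M. fst d)" "x' = x + (\<Sum>d\<in>#M. snd d)" by auto
    show "(y', x') \<in> cube_pts (d # ds) y x"
    proof (cases "d \<in># M")
      case True
      then obtain M' where M': "M = add_mset d M'" by (meson multi_member_split)
      then have "M' \<subseteq># mset ds" using M(1) by simp
      then have "(y', x') \<in> cube_pts ds (y + fst d) (x + snd d)"
        unfolding Cons.IH using M M' by (intro exI[of _ M']) auto
      then show ?thesis by simp
    next
      case False
      have "M \<subseteq># mset ds"
      proof (rule mset_subset_eqI)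
        fix b
        show "count M b \<le> count (mset ds) b"
          using False mset_subset_eq_count[OF M(1), of b] by (cases "b = d") (auto simp: not_in_iff)
      qed
      then have "(y', x') \<in> cube_pts ds y x"
        unfolding Cons.IH using M by (intro exI[of _ M]) auto
      then show ?thesis by simp
    qed
  qed
qed

lemma cube_pts_mono:
  assumes "mset es \<subseteq># mset ds"
  shows "cube_pts es y x \<subseteq> cube_pts ds y x"
proof
  fix z assume "z \<in> cube_pts es y x"
  moreover obtain y' x' where z: "z = (y', x')" by (cases z)
  ultimately obtain M where "M \<subseteq># mset es" "y' = y + (\<Sum>d\<in>#M. fst d)" "x' = x + (\<Sum>d\<in>#M. snd d)"
    unfolding cube_pts_iff z by blast
  moreover from this(1) have "M \<subseteq># mset ds" using assms by (rule subset_mset.order_trans)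
  ultimately show "z \<in> cube_pts ds y x" unfolding z cube_pts_iff by blast
qed

lemma mset_choice:
  "list_all2 (\<lambda>d p. d = fst p \<or> d = snd p) ds ps \<Longrightarrow> mset ds \<subseteq># mset (map fst ps @ map snd ps)"
proof (induction ds ps rule: list_all2_induct)
  case (Cons d ds p ps)
  have "add_mset d (mset ds) \<subseteq># add_mset (fst p) (add_mset (snd p) (mset (map fst ps @ map snd ps)))"
  proof (cases "d = fst p")
    case True
    then show ?thesis using Cons.IH by (simp add: subset_mset.order_trans[OF Cons.IH])
  next
    case False
    then have "d = snd p" using Cons.hyps by simp
    then have "add_mset d (mset ds) \<subseteq># add_mset (snd p) (mset (map fst ps @ map snd ps))"
      using Cons.IH by simp
    then show ?thesis by (rule subset_mset.order_trans) simp
  qed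
  then show ?case by (simp add: add_mset_commute)
qed simp

text \<open>The relations hold for every pairing of the directions. Pairing the \<open>i\<close>-th with the
  \<open>(i + k)\<close>-th in the order of slopes makes one equality yield \<open>k\<close> equal slopes.\<close>
lemma exists_collinear_directions:
  fixes ds :: "(real \<times> real) list"
  assumes len: "length ds = 2 * k" and k: "k \<ge> 1" and pos: "\<And>d. d \<in> set ds \<Longrightarrow> fst d > 0"
    and rel: "\<And>y' x'. (y', x') \<in> cube_pts ds y x \<Longrightarrow> y' * f y' x' = poly P x' + g y' x'"
    and f: "\<And>es. mset es \<subseteq># mset ds \<Longrightarrow> length es = k \<Longrightarrow> fdiff es f y x = 0"
    and g: "\<And>es. mset es \<subseteq># mset ds \<Longrightarrow> length es = k \<Longrightarrow> fdiff es g y x = 0"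
    and P: "degree P \<le> k" "coeff P k \<noteq> 0"
  shows "\<exists>es l. mset es \<subseteq># mset ds \<and> length es = k \<and> (\<forall>d\<in>set es. snd d = l * fst d)"
proof -
  define s :: "real \<times> real \<Rightarrow> real" where "s = (\<lambda>d. snd d / fst d)"
  define L where "L = sort_key s ds"
  have L: "length L = 2 * k" "mset L = mset ds" by (simp_all add: L_def len)
  define ps where "ps = zip (take k L) (drop k L)"
  have lenps: "length ps = k" by (simp add: ps_def L)
  have psL: "map fst ps @ map snd ps = L" by (simp add: ps_def L)
  have "\<exists>p\<in>set ps. fst (snd p) * snd (fst p) = fst (fst p) * snd (snd p)"
  proof (rule exists_equal_slopes[where f = f and g = g and y = y and x = x and P = P])
    have c: "cube_pts L y x = cube_pts ds y x" using cube_pts_mono[of L ds y x] cube_pts_mono[of ds L y x] L(2) by auto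
    show "y' * f y' x' = poly P x' + g y' x'" if "(y', x') \<in> cube_pts (map fst ps @ map snd ps) y x" for y' x'
      using that rel unfolding psL c by blast
    fix es assume a: "list_all2 (\<lambda>d p. d = fst p \<or> d = snd p) es ps"
    have m: "mset es \<subseteq># mset ds" "length es = k"
      using mset_choice[OF a] list_all2_lengthD[OF a] lenps unfolding psL L(2) by auto
    show "fdiff es f y x = 0" "fdiff es g y x = 0" using f[OF m] g[OF m] by auto
    show "cube_pts es y x \<subseteq> cube_pts (map fst ps @ map snd ps) y x"
      unfolding psL c by (rule cube_pts_mono[OF m(1)])
  qed (use P lenps in auto)
  then obtain p where p: "p \<in> set ps" "fst (snd p) * snd (fst p) = fst (fst p) * snd (snd p)" by blast
  then obtain i where i: "i < k" "p = ps ! i" using lenps by (auto simp: in_set_conv_nth)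
  then have pi: "p = (L ! i, L ! (k + i))" by (simp add: ps_def L)
  have inL: "L ! j \<in> set ds" if "j < 2 * k" for j
    using nth_mem[of j L] that L by (metis set_mset_mset)
  have eq: "s (L ! i) = s (L ! (k + i))"
    using p(2) pos[OF inL[of i]] pos[OF inL[of "k + i"]] i unfolding pi s_def by (simp add: field_simps)
  have mono: "s (L ! a) \<le> s (L ! b)" if "a \<le> b" "b < 2 * k" for a b
    using sorted_nth_mono[of "map s L" a b] that L by (simp add: L_def)
  define es where "es = take k (drop i L)"
  show ?thesis
  proof (intro exI[of _ es] exI[of _ "s (L ! i)"] conjI ballI)
    show "length es = k" using i by (simp add: es_def L)
    have "mset L = mset (take i L) + mset es + mset (drop k (drop i L))"
      by (simp only: es_def mset_append[symmetric] append_take_drop_id append_assoc)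
    then show "mset es \<subseteq># mset ds" unfolding L(2)[symmetric] by simp
    fix d assume "d \<in> set es"
    then obtain j where j: "j < k" "d = L ! (i + j)" using i by (auto simp: es_def in_set_conv_nth L)
    have "s d = s (L ! i)"
      using mono[of i "i + j"] mono[of "i + j" "k + i"] eq i j by simp
    moreover have "fst d > 0" using pos[OF inL[of "i + j"]] i j by simp
    ultimately show "snd d = s (L ! i) * fst d" by (auto simp: s_def field_simps)
  qed
qed

section \<open>Integer solutions of the recurrence\<close>

locale prime_recurrence = increasing p for p +
  fixes k :: nat and q :: "nat \<Rightarrow> int" and t :: "nat \<Rightarrow> int" and E0 N1 :: nat
  assumes p_prime: "\<And>n. n \<ge> 1 \<Longrightarrow> prime (p n)"
    and k: "k \<ge> 1" and qk: "q k \<noteq> 0"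
    and t_rec: "\<And>n. n \<ge> 1 \<Longrightarrow> t (Suc n) = int n * t n - (\<Sum>e\<le>k. q e * int (p n) ^ e)"
    and t_bound: "\<And>n. n \<ge> N1 \<Longrightarrow> \<bar>t n\<bar> \<le> int n ^ E0"
begin

definition Q :: "nat \<Rightarrow> int" where "Q n = (\<Sum>e\<le>k. q e * int (p n) ^ e)"

text \<open>The arithmetic side of truncation: modulo a product of \<open>r\<close> consecutive
  integers, the first \<open>r\<close> terms amount to the comparatively small
  \<open>- t (M + r)\<close>.\<close>

lemma unroll:
  assumes "M \<ge> 1"
  shows "(\<Prod>i<r. int M + int i) * t M = (\<Sum>j<r. Q (M + j) * (\<Prod>i\<in>{j<..<r}. int M + int i)) + t (M + r)"
proof (induction r)
  case 0
  then show ?case by simp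
next
  case (Suc r)
  have ins: "{j<..<Suc r} = insert r {j<..<r}" if "j < r" for j using that by auto
  have "(\<Prod>i<Suc r. int M + int i) * t M = (int M + int r) * ((\<Prod>i<r. int M + int i) * t M)" by simp
  also have "\<dots> = (\<Sum>j<r. Q (M + j) * ((int M + int r) * (\<Prod>i\<in>{j<..<r}. int M + int i))) + (int M + int r) * t (M + r)"
    unfolding Suc.IH by (simp add: distrib_left sum_distrib_left mult_ac)
  also have "(\<Sum>j<r. Q (M + j) * ((int M + int r) * (\<Prod>i\<in>{j<..<r}. int M + int i))) =
      (\<Sum>j<r. Q (M + j) * (\<Prod>i\<in>{j<..<Suc r}. int M + int i))"
    by (intro sum.cong refl) (simp add: ins)
  also have "(int M + int r) * t (M + r) = Q (M + r) + t (M + Suc r)"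
    using t_rec[of "M + r"] assms by (simp add: Q_def)
  also have "Q (M + r) = Q (M + r) * (\<Prod>i\<in>{r<..<Suc r}. int M + int i)"
  proof -
    have "{r<..<Suc r} = {}" by auto
    then show ?thesis by simp
  qed
  finally show ?case by simp
qed

text \<open>The analytic side of the same truncation; its main part becomes \<open>approx\<close>
  once the gaps are fixed.\<close>

lemma unroll_real:
  assumes "M \<ge> 1"
  shows "real_of_int (t M) = (\<Sum>j<r. real_of_int (Q (M + j)) * (\<Prod>i\<le>j. 1 / (real M + real i)))
    + real_of_int (t (M + r)) * (\<Prod>i<r. 1 / (real M + real i))"
proof (induction r)
  case 0
  then show ?case by simp
next
  case (Suc r)
  have "real (M + r) * real_of_int (t (M + r)) = real_of_int (Q (M + r)) + real_of_int (t (M + Suc r))"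
    using t_rec[of "M + r"] assms by (simp add: Q_def)
  then have "real_of_int (t (M + r)) = (real_of_int (Q (M + r)) + real_of_int (t (M + Suc r))) * (1 / (real M + real r))"
    using assms by (simp add: field_simps)
  then have "real_of_int (t (M + r)) * (\<Prod>i<r. 1 / (real M + real i)) =
      (real_of_int (Q (M + r)) + real_of_int (t (M + Suc r))) * (\<Prod>i\<le>r. 1 / (real M + real i))"
    by (simp add: lessThan_Suc_atMost[symmetric])
  note last = this
  have "(\<Prod>i<Suc r. 1 / (real M + real i)) = (\<Prod>i\<le>r. 1 / (real M + real i))"
    by (simp only: lessThan_Suc_atMost)
  then show ?case unfolding Suc.IH last sum.lessThan_Suc distrib_right add.assoc by (simp only:)
qed

text \<open>The arithmetic progression \<open>p n + i D\<close> contains a multiple of \<open>D + 1\<close>, since \<open>D \<equiv> -1\<close>.\<close>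
lemma no_period:
  assumes n: "n \<ge> 1" "D + 1 < p n" and D: "D \<ge> 1"
    and per: "\<And>j. j \<le> a * D \<Longrightarrow> p (n + a + j) = p (n + j) + D"
  shows False
proof -
  have ap: "i \<le> D + 1 \<Longrightarrow> p (n + a * i) = p n + i * D" for i
  proof (induction i)
    case (Suc i)
    have "p (n + a + a * i) = p (n + a * i) + D" using Suc.prems by (intro per) simp
    then show ?case using Suc by (simp add: algebra_simps)
  qed simp
  define i where "i = p n mod (D + 1)"
  have i: "i \<le> D" unfolding i_def using mod_less_divisor[of "D + 1" "p n"] by simp
  have "p n + i * D = p n div (D + 1) * (D + 1) + (i + i * D)"
    unfolding i_def using div_mult_mod_eq[of "p n" "D + 1"] by simp
  also have "\<dots> = (p n div (D + 1) + i) * (D + 1)" by (simp add: algebra_simps)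
  finally have "D + 1 dvd p n + i * D" by (simp only: dvd_triv_right)
  moreover have "prime (p n + i * D)"
    using ap[of i] i p_prime[of "n + a * i"] n by simp
  ultimately have "D + 1 = 1 \<or> D + 1 = p n + i * D" using prime_nat_iff by blast
  then show False using D n(2) by auto
qed

text \<open>By \<open>unroll\<close>, the value of \<open>numer\<close> at \<open>M\<close> is
  \<open>- a ^ k * t (M + r)\<close> modulo that of \<open>rising r\<close>. The choice of
  \<open>r\<close> makes this error at most of order \<open>M ^ (r - 2)\<close>, as
  \<open>has_rem_top_coeff_zero\<close> requires.\<close>

lemma top_coeff_zero:
  fixes B :: int
  assumes r: "r = E0 + k + 3" and M: "M \<ge> 1" "M \<ge> r" "M \<ge> N1"
    and B: "rising_norm r + 1 \<le> B" "2 \<le> B" "int r \<le> B"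
    and q: "\<And>e. e \<le> k \<Longrightarrow> \<bar>q e\<bar> \<le> B" and a: "\<bar>a\<bar> \<le> B" "\<bar>D\<bar> \<le> B"
    and z: "\<And>j. z j = a * int (p (M + j)) - D * int M" "\<And>j. j < r \<Longrightarrow> \<bar>z j\<bar> \<le> B"
    and large: "int M > B ^ (5 + 3 * k + 2 * r)"
  shows "\<exists>C. has_rem r (B ^ (3 + 3 * k + 2 * r)) (numer k r q a D z) C \<and> coeff C (r - 1) = 0"
proof -
  obtain C where C: "has_rem r (B ^ (3 + 3 * k + 2 * r)) (numer k r q a D z) C"
    using ex_has_rem_numer[of r B k q a D z] r B q a z(2) by auto
  have pfac: "poly (factor k q a \<circ>\<^sub>p [:z j, D:]) (int M) = a ^ k * Q (M + j)" for j
  proof -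
    have "z j + int M * D = a * int (p (M + j))" by (simp add: z(1) mult.commute)
    then have "poly (factor k q a \<circ>\<^sub>p [:z j, D:]) (int M) = (\<Sum>e\<le>k. q e * a ^ (k - e) * (a * int (p (M + j))) ^ e)"
      unfolding factor_pcompose by (simp add: poly_sum)
    also have "\<dots> = (\<Sum>e\<le>k. a ^ k * (q e * int (p (M + j)) ^ e))"
    proof (intro sum.cong refl)
      fix e assume "e \<in> {..k}"
      then have "a ^ k = a ^ (k - e) * a ^ e" by (simp add: power_add[symmetric])
      then show "q e * a ^ (k - e) * (a * int (p (M + j))) ^ e = a ^ k * (q e * int (p (M + j)) ^ e)"
        by (simp add: power_mult_distrib)
    qed
    finally show ?thesis by (simp add: Q_def sum_distrib_left)
  qed
  have "poly (numer k r q a D z) (int M) = (\<Sum>j<r. a ^ k * Q (M + j) * (\<Prod>i\<in>{j<..<r}. int M + int i))"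
    unfolding numer_def poly_sum poly_mult pfac poly_prod by (simp add: add.commute)
  also have "\<dots> = a ^ k * (\<Sum>j<r. Q (M + j) * (\<Prod>i\<in>{j<..<r}. int M + int i))"
    by (simp add: sum_distrib_left mult.assoc)
  also have "\<dots> = a ^ k * (poly (rising r) (int M) * t M - t (M + r))"
    using unroll[OF M(1), of r] by (simp add: poly_rising)
  finally have num: "poly (numer k r q a D z) (int M) = poly (rising r) (int M) * (a ^ k * t M) - a ^ k * t (M + r)"
    by (simp add: algebra_simps)
  have "coeff C (r - 1) = 0"
  proof (rule has_rem_top_coeff_zero[OF C _ _ _ num])
    show "2 \<le> r" "0 \<le> B ^ (k + E0)" using r B by auto
    have "int r * B ^ (3 + 3 * k + 2 * r) + B ^ (k + E0) \<le> B * B ^ (3 + 3 * k + 2 * r) + B ^ (4 + 3 * k + 2 * r)"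
      using B r by (intro add_mono mult_right_mono power_increasing) auto
    also have "\<dots> = 2 * B ^ (4 + 3 * k + 2 * r)" by (simp add: eval_nat_numeral)
    also have "\<dots> \<le> B * B ^ (4 + 3 * k + 2 * r)" using B by (intro mult_right_mono) auto
    also have "\<dots> = B ^ (5 + 3 * k + 2 * r)" by (simp add: eval_nat_numeral)
    finally show "int r * B ^ (3 + 3 * k + 2 * r) + B ^ (k + E0) < int M" using large by linarith
    have "\<bar>t (M + r)\<bar> \<le> int (M + r) ^ E0" using M by (intro t_bound) simp
    also have "\<dots> \<le> (B * int M) ^ E0"
    proof (intro power_mono)
      have "int (M + r) \<le> 2 * int M" using M by simp
      also have "\<dots> \<le> B * int M" using B by (intro mult_right_mono) auto
      finally show "int (M + r) \<le> B * int M" .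
    qed simp
    finally have t: "\<bar>t (M + r)\<bar> \<le> B ^ E0 * int M ^ E0" by (simp add: power_mult_distrib)
    have "\<bar>a ^ k * t (M + r)\<bar> = \<bar>a\<bar> ^ k * \<bar>t (M + r)\<bar>" by (simp add: abs_mult power_abs)
    also have "\<dots> \<le> B ^ k * (B ^ E0 * int M ^ E0)"
      using t a B by (intro mult_mono power_mono) auto
    also have "\<dots> \<le> B ^ k * (B ^ E0 * int M ^ (r - 2))"
      using B M r by (intro mult_left_mono power_increasing) auto
    finally show "\<bar>a ^ k * t (M + r)\<bar> \<le> B ^ (k + E0) * int M ^ (r - 2)" by (simp add: power_add mult.assoc)
  qed
  then show ?thesis using C by blast
qed

text \<open>Choose \<open>M\<close> with \<open>M + (k - 1) = n + j\<close> and compare the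
  numerators at \<open>M\<close> and \<open>M + a\<close>. A period changes both terms of
  \<open>z\<close> by \<open>a * D\<close>, so by induction the first \<open>k - 1\<close> entries
  agree, and \<open>numer_determines\<close> passes this on to the next entry, which is the claim
  for \<open>j\<close>.\<close>

lemma period_propagates:
  fixes B :: int and a D n J :: nat
  assumes r: "r = E0 + k + 3" and n: "n \<ge> 1" "n \<ge> r" "n \<ge> N1" and D: "D \<ge> 1"
    and B: "rising_norm r + 1 \<le> B" "2 \<le> B" "int r \<le> B"
    and q: "\<And>e. e \<le> k \<Longrightarrow> \<bar>q e\<bar> \<le> B" and a: "int a \<le> B" "int D \<le> B"
    and z: "\<And>M j. n \<le> M \<Longrightarrow> M \<le> n + a + J \<Longrightarrow> j < r \<Longrightarrow> \<bar>int a * int (p (M + j)) - int D * int M\<bar> \<le> B"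
    and large: "int n > B ^ (5 + 3 * k + 2 * r)"
    and init: "\<And>j. j \<le> r \<Longrightarrow> p (n + a + j) = p (n + j) + D"
  shows "j \<le> J \<Longrightarrow> p (n + a + j) = p (n + j) + D"
proof (induction j rule: less_induct)
  case (less j)
  show ?case
  proof (cases "j \<le> r")
    case True
    then show ?thesis by (rule init)
  next
    case False
    define M where "M = n + (j - (k - 1))"
    have j: "k - 1 \<le> j" using False r by simp
    have M: "M + (k - 1) = n + j" "n \<le> M" "M \<le> n + J" using j less.prems by (auto simp: M_def)
    define z1 where "z1 = (\<lambda>i. int a * int (p (M + i)) - int D * int M)"
    define z2 where "z2 = (\<lambda>i. int a * int (p (M + a + i)) - int D * int (M + a))"
    have l: "int M > B ^ (5 + 3 * k + 2 * r)" "int (M + a) > B ^ (5 + 3 * k + 2 * r)" using large M by linarith+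
    obtain C1 where C1: "has_rem r (B ^ (3 + 3 * k + 2 * r)) (numer k r q (int a) (int D) z1) C1" "coeff C1 (r - 1) = 0"
      using top_coeff_zero[OF r _ _ _ B q, of M "int a" "int D" z1] n M a l z by (auto simp: z1_def)
    obtain C2 where C2: "has_rem r (B ^ (3 + 3 * k + 2 * r)) (numer k r q (int a) (int D) z2) C2" "coeff C2 (r - 1) = 0"
      using top_coeff_zero[OF r _ _ _ B q, of "M + a" "int a" "int D" z2] n M a l z[of "M + a"] by (auto simp: z2_def)
    have "z2 (k - 1) = z1 (k - 1)"
    proof (rule numer_determines[OF C2(1) C1(1) C2(2) C1(2)])
      fix i assume i: "i < k - 1"
      have "p (n + a + (j - (k - 1) + i)) = p (n + (j - (k - 1) + i)) + D"
        using i j less.prems by (intro less.IH) auto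
      then have "p (M + a + i) = p (M + i) + D" by (simp add: M_def add_ac)
      then show "z2 i = z1 i" by (simp add: z1_def z2_def algebra_simps)
    qed (use k qk D r in auto)
    then have "int a * int (p (M + a + (k - 1))) = int a * (int (p (M + (k - 1))) + int D)"
      by (simp add: z1_def z2_def algebra_simps)
    moreover have "a \<noteq> 0" using init[of 0] D by (intro notI) simp
    ultimately have eq: "int (p (M + a + (k - 1))) = int (p (M + (k - 1))) + int D" by simp
    have "M + a + (k - 1) = n + a + j" using M(1) by simp
    from eq[unfolded this M(1)] have "int (p (n + a + j)) = int (p (n + j) + D)" by simp
    then show ?thesis by (simp only: of_nat_eq_iff)
  qed
qed

end

section \<open>From a cube of points to the contradiction\<close>

context prime_recurrence
begin

text \<open>At every corner \<open>approx\<close> differs from \<open>t\<close> by at most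
  \<open>B ^ E0 / n ^ (k + 3)\<close>, which is where the \<open>k + 3\<close> in \<open>r\<close>
  comes from. With \<open>symb_approx\<close> the integral difference of \<open>t\<close> is below
  1, hence 0. Fed back, this improves the bound for the difference of \<open>approx\<close> from
  order \<open>1 / n\<close> to the size of the truncation error. The cases \<open>h = 0\<close> and
  \<open>h = 1\<close> serve the two sides of the recurrence.\<close>

lemma fdiff_vanish:
  fixes B :: real
  assumes r: "r = E0 + k + 3" and h: "h \<le> 1"
    and S: "\<And>m j. m \<in> S \<Longrightarrow> j \<le> r \<Longrightarrow> p (m + j) = p m + d j"
    and SN: "\<And>m. m \<in> S \<Longrightarrow> N1 \<le> m \<and> r + 1 \<le> m"
    and B: "2 \<le> B" "B \<le> real n"
    and q: "\<And>e. e \<le> k \<Longrightarrow> \<bar>real_of_int (q e)\<bar> \<le> B" and d: "\<And>j. j \<le> r \<Longrightarrow> real (d j) \<le> B"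
    and pts: "cube_pts ds (real n) (real (p n)) \<subseteq> (\<lambda>m. (real m, real (p m))) ` S"
    and ds: "dirs B ds" "length ds = k" and pn: "real (p n) \<le> B * real n"
    and large: "B ^ (1 + k * (2 + 2 * k) + Suc k + r * (4 ^ k + k) + k * Suc k + r + 2) \<le> real n"
      "B ^ (k + E0 + 2) \<le> real n"
  shows "fdiff ds (\<lambda>y x. real_of_int (t (nat \<lfloor>y\<rfloor> + h))) (real n) (real (p n)) = 0"
    "\<bar>fdiff ds (approx k r (\<lambda>e. real_of_int (q e)) (\<lambda>j. real (d (j + h))) (real h)) (real n) (real (p n))\<bar>
      \<le> B ^ (k + E0) * real n powr (- 2 - real k)"
proof -
  interpret cone B "real n" by unfold_locales (use B in auto)
  define Ea where "Ea = 1 + k * (2 + 2 * k) + Suc k + r * (4 ^ k + k) + k * Suc k + r"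
  \<comment> \<open>The floor makes \<open>T\<close> integral at all real arguments, as
    \<open>fdiff_Ints\<close> asks; the corners themselves have natural coordinates.\<close>
  define T where "T = (\<lambda>(y::real) (x::real). real_of_int (t (nat \<lfloor>y\<rfloor> + h)))"
  define F where "F = approx k r (\<lambda>e. real_of_int (q e)) (\<lambda>j. real (d (j + h))) (real h)"
  have n1: "real n \<ge> 1" using B by simp
  have tail: "\<bar>T y' x' - F y' x'\<bar> \<le> B ^ E0 / real n ^ (k + 3)"
    if c: "(y', x') \<in> cube_pts ds (real n) (real (p n))" for y' x'
  proof -
    obtain m where m: "m \<in> S" "y' = real m" "x' = real (p m)" using c pts by auto
    have mn: "real n \<le> real m" using cube_pts_ge[OF c ds(1)] m by simp
    have mN: "N1 \<le> m" "r + 1 \<le> m" using SN[OF m(1)] by auto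
    have "F y' x' = (\<Sum>j<r. real_of_int (Q (m + h + j)) * (\<Prod>i\<le>j. 1 / (real (m + h) + real i)))"
      unfolding F_def approx_def
    proof (intro sum.cong refl arg_cong2[of _ _ _ _ "(*)"])
      fix j assume j: "j \<in> {..<r}"
      have "p (m + h + j) = p m + d (j + h)" using S[OF m(1), of "j + h"] j h by (simp add: add_ac)
      then show "(\<Sum>e\<le>k. real_of_int (q e) * (x' + real (d (j + h))) ^ e) = real_of_int (Q (m + h + j))"
        by (simp add: Q_def m(3))
    qed (simp add: m(2))
    moreover have "T y' x' = real_of_int (t (m + h))" by (simp add: T_def m(2))
    ultimately have e1: "T y' x' - F y' x' = real_of_int (t (m + h + r)) * (\<Prod>i<r. 1 / (real (m + h) + real i))"
      using unroll_real[of "m + h" r] mN by simp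
    have e2: "\<bar>real_of_int (t (m + h + r))\<bar> \<le> (2 * real m) ^ E0"
    proof -
      have "\<bar>t (m + h + r)\<bar> \<le> int (m + h + r) ^ E0" using mN by (intro t_bound) simp
      also have "\<dots> \<le> int (2 * m) ^ E0" using mN h by (intro power_mono) auto
      finally have "real_of_int \<bar>t (m + h + r)\<bar> \<le> real_of_int (int (2 * m) ^ E0)" by (simp only: of_int_le_iff)
      then show ?thesis by simp
    qed
    have e3: "\<bar>\<Prod>i<r. 1 / (real (m + h) + real i)\<bar> \<le> (\<Prod>i<r. 1 / real m)"
      unfolding abs_prod using mN by (intro prod_mono) (auto intro!: divide_left_mono)
    have "\<bar>T y' x' - F y' x'\<bar> \<le> (2 * real m) ^ E0 * (\<Prod>i<r. 1 / real m)"
      unfolding e1 abs_mult using e2 e3 by (intro mult_mono) auto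
    also have "\<dots> = 2 ^ E0 / real m ^ (k + 3)"
      using mN by (simp add: r power_mult_distrib power_add power_one_over divide_simps)
    also have "\<dots> \<le> B ^ E0 / real n ^ (k + 3)"
      using B mn n1 by (intro frac_le power_mono) auto
    finally show ?thesis .
  qed
  define b where "b = B ^ (k + E0) / real n ^ (k + 3)"
  have "\<bar>fdiff ds (\<lambda>y x. T y x - F y x) (real n) (real (p n))\<bar> \<le> 2 ^ length ds * (B ^ E0 / real n ^ (k + 3))"
    using tail by (rule fdiff_abs_le)
  also have "\<dots> \<le> B ^ k * (B ^ E0 / real n ^ (k + 3))"
    using B ds(2) by (intro mult_right_mono) (auto intro: power_mono)
  also have "\<dots> = b" by (simp add: b_def power_add)
  finally have diff: "\<bar>fdiff ds T (real n) (real (p n)) - fdiff ds F (real n) (real (p n))\<bar> \<le> b"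
    unfolding fdiff_diff .
  have "symb k (int k - 1) Ea F" unfolding F_def Ea_def
    using q d h by (intro symb_approx) auto
  from symbD[OF this, of ds "real n" "real (p n)"]
  have "\<bar>fdiff ds F (real n) (real (p n))\<bar> \<le> B ^ Ea * real n powr (- 1)"
    using ds pn by simp
  also have "\<dots> \<le> 1 / 4"
  proof -
    have "4 * B ^ Ea \<le> B ^ 2 * B ^ Ea" using B power_mono[of 2 B 2] by (intro mult_right_mono) auto
    also have "\<dots> = B ^ (Ea + 2)" by (simp only: power_add mult.commute)
    also have "\<dots> \<le> real n" using large(1) by (simp only: Ea_def)
    finally show ?thesis using n1 by (simp add: powr_minus_divide field_simps)
  qed
  moreover have b: "b \<le> 1 / 4"
  proof -
    have "4 * B ^ (k + E0) \<le> B ^ 2 * B ^ (k + E0)" using B power_mono[of 2 B 2] by (intro mult_right_mono) auto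
    also have "\<dots> = B ^ (k + E0 + 2)" by (simp only: power_add ac_simps)
    also note large(2)
    also have "real n \<le> real n ^ (k + 3)" using n1 by (intro self_le_power) auto
    finally show ?thesis using n1 by (simp add: b_def field_simps)
  qed
  ultimately have "\<bar>fdiff ds T (real n) (real (p n))\<bar> < 1" using diff by linarith
  moreover have "fdiff ds T (real n) (real (p n)) \<in> \<int>" by (rule fdiff_Ints) (simp add: T_def)
  ultimately have zero: "fdiff ds T (real n) (real (p n)) = 0" using Ints_nonzero_abs_less1 by blast
  then show "fdiff ds (\<lambda>y x. real_of_int (t (nat \<lfloor>y\<rfloor> + h))) (real n) (real (p n)) = 0" by (simp add: T_def)
  have "\<bar>fdiff ds F (real n) (real (p n))\<bar> \<le> b" using diff zero by simp
  also have "b \<le> B ^ (k + E0) * real n powr (- 2 - real k)"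
  proof -
    have "real n powr (- 2 - real k) = real n powr (- real (k + 2))" by simp
    also have "\<dots> = 1 / real n powr real (k + 2)" by (rule powr_minus_divide)
    also have "real n powr real (k + 2) = real n ^ (k + 2)" using n1 by (intro powr_realpow) simp
    finally have "real n powr (- 2 - real k) = 1 / real n ^ (k + 2)" .
    moreover have "1 / real n ^ (k + 3) \<le> 1 / real n ^ (k + 2)"
      using n1 by (intro divide_left_mono power_increasing) auto
    ultimately show ?thesis unfolding b_def using B by (simp add: divide_inverse mult_left_mono)
  qed
  finally show "\<bar>fdiff ds (approx k r (\<lambda>e. real_of_int (q e)) (\<lambda>j. real (d (j + h))) (real h)) (real n) (real (p n))\<bar>
      \<le> B ^ (k + E0) * real n powr (- 2 - real k)" unfolding F_def .
qed

lemma growth_contradiction: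
  assumes growth: "\<And>d. \<exists>K>0. \<forall>n\<ge>1. real (p n) ^ d \<le> K * real n ^ Suc d"
  shows False
proof -
  define r where "r = E0 + k + 3"
  define A where "A = dexp (3 * r + 4) (2 * k)"
  \<comment> \<open>The window length \<open>R = Y ^ \<rho>\<close> has to exceed
    \<open>a + a * D + r\<close> for a direction \<open>(a, D)\<close>, whose entries are at most
    \<open>Y ^ (A + 2)\<close>.\<close>
  define \<rho> where "\<rho> = 2 * A + 6"
  define \<beta> where "\<beta> = \<rho> + 2"
  define E6 where "E6 = k + 1 + (1 + 3 * k + (Suc r * (4 ^ k + k) + k * (r + 2)) + r * Suc k * Suc k)"
  define E2 where "E2 = E6 + 1"
  define Ea where "Ea = 1 + k * (2 + 2 * k) + Suc k + r * (4 ^ k + k) + k * Suc k + r"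
  \<comment> \<open>One summand for each demand on the size of \<open>X = Bn ^ W\<close>:
    \<open>period_propagates\<close> with the bound \<open>B2\<close>, the two conditions of
    \<open>fdiff_vanish\<close> around that of \<open>line_bound\<close>, and a final 2 for
    \<open>B ^ 2\<close>.\<close>
  define W where "W = (E2 + 4) * (5 + 3 * k + 2 * r) + (Ea + 2) + (k + E0 + E6 + 2) + (k + E0 + 2) + 2"
  define \<Delta> where "\<Delta> = \<beta> * W"
  obtain K where K: "K > 0" "\<And>n. n \<ge> 1 \<Longrightarrow> real (p n) ^ (2 * \<Delta>) \<le> K * real n ^ Suc (2 * \<Delta>)"
    using growth[of "2 * \<Delta>"] by blast
  \<comment> \<open>Only now, with \<open>K\<close> fixed by the exponents, is the base chosen; it
    dominates all constants of the problem.\<close>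
  define Y where "Y = 8 + 4 * r + N1 + (\<Sum>e\<le>k. nat \<bar>q e\<bar>) + nat (rising_norm r + 1) + nat \<lceil>K * 3 ^ Suc (2 * \<Delta>)\<rceil>"
  have Y8: "Y \<ge> 8" "Y \<ge> 4 * r" "Y \<ge> N1" by (auto simp: Y_def)
  have Yq: "\<bar>q e\<bar> \<le> int Y" if "e \<le> k" for e
  proof -
    have "nat \<bar>q e\<bar> \<le> (\<Sum>e\<le>k. nat \<bar>q e\<bar>)" using that by (intro member_le_sum) auto
    also have "\<dots> \<le> Y" unfolding Y_def by linarith
    finally show ?thesis by linarith
  qed
  have "nat (rising_norm r + 1) \<le> Y" unfolding Y_def by linarith
  then have Yn: "rising_norm r + 1 \<le> int Y" by linarith
  have YK: "K * 3 ^ Suc (2 * \<Delta>) \<le> real Y"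
  proof -
    have "K * 3 ^ Suc (2 * \<Delta>) \<le> real (nat \<lceil>K * 3 ^ Suc (2 * \<Delta>)\<rceil>)" by (rule real_nat_ceiling_ge)
    also have "\<dots> \<le> real Y" unfolding Y_def of_nat_le_iff by (rule le_add2)
    finally show ?thesis .
  qed
  have Ypow: "Y ^ i \<le> Y ^ j" if "i \<le> j" for i j using Y8 that by (intro power_increasing) auto
  define Bn where "Bn = Y ^ \<beta>"
  define B where "B = real Bn"
  define R where "R = Y ^ \<rho>"
  define X where "X = Y ^ \<Delta>"
  have XB: "X = Bn ^ W" by (simp add: X_def Bn_def \<Delta>_def power_mult)
  have Bn2: "Bn \<ge> 2"
  proof -
    have "Y ^ 1 \<le> Bn" unfolding Bn_def by (rule Ypow) (simp add: \<beta>_def)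
    then show ?thesis using Y8 by simp
  qed
  have YB: "Y \<le> Bn" unfolding Bn_def using Ypow[of 1 \<beta>] by (simp add: \<beta>_def)
  have Wpos: "W \<ge> 1" by (simp add: W_def)
  have B: "2 \<le> B" using Bn2 by (simp add: B_def)
  have BX: "B ^ e \<le> real n" if "e \<le> W" "X \<le> n" for e n
  proof -
    have "Bn ^ e \<le> Bn ^ W" using that Bn2 by (intro power_increasing) auto
    then have "Bn ^ e \<le> n" using that XB by simp
    then show ?thesis unfolding B_def by (metis of_nat_le_iff of_nat_power)
  qed
  have Bpow: "B ^ i \<le> B ^ j" if "i \<le> j" for i j using B that by (intro power_increasing) auto

  \<comment> \<open>The loss \<open>K * 3 ^ Suc (2 * \<Delta>) * X\<close> is at most
    \<open>X * X = Y ^ (2 * \<Delta>)\<close>, which is a single factor \<open>Y\<close> after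
    extracting the root of order \<open>2 * \<Delta>\<close>.\<close>
  have pX: "p (3 * X) \<le> X * Y"
  proof -
    have X0: "X > 0" using Y8 by (simp add: X_def)
    have "real (p (3 * X)) ^ (2 * \<Delta>) \<le> K * real (3 * X) ^ Suc (2 * \<Delta>)"
      by (rule K(2)) (use X0 in simp)
    also have "\<dots> = (K * 3 ^ Suc (2 * \<Delta>)) * (real X * real X ^ (2 * \<Delta>))"
      by (simp only: of_nat_mult power_mult_distrib power_Suc of_nat_numeral ac_simps)
    also have "\<dots> \<le> real X * (real X * real X ^ (2 * \<Delta>))"
    proof (intro mult_right_mono)
      have "Y ^ 1 \<le> X" unfolding X_def using Wpos by (intro Ypow) (simp add: \<Delta>_def \<beta>_def)
      then show "K * 3 ^ Suc (2 * \<Delta>) \<le> real X" using YK by simp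
    qed auto
    also have "real X * (real X * real X ^ (2 * \<Delta>)) = (real X * real Y) ^ (2 * \<Delta>)"
    proof -
      have "real X * real X = real Y ^ (2 * \<Delta>)" by (simp add: X_def mult_2 power_add)
      then show ?thesis by (simp only: power_mult_distrib mult.assoc[symmetric]) (simp add: mult.commute)
    qed
    finally have "real (p (3 * X)) ^ (2 * \<Delta>) \<le> (real X * real Y) ^ (2 * \<Delta>)" .
    moreover have "2 * \<Delta> > 0" using Wpos by (simp add: \<Delta>_def \<beta>_def)
    ultimately have "real (p (3 * X)) \<le> real X * real Y" by (simp add: power_mono_iff)
    then show ?thesis by (metis of_nat_le_iff of_nat_mult)
  qed

  have R\<Delta>: "\<rho> \<le> \<Delta>" using Wpos mult_le_mono2[of 1 W \<beta>] by (simp add: \<Delta>_def \<beta>_def)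
  define m where "m = Y ^ (\<Delta> - \<rho>)"
  have mR: "m * R = X" using R\<Delta> by (simp add: m_def R_def X_def power_add[symmetric])
  have X1: "X \<ge> 1" using Y8 by (simp add: X_def Suc_le_eq)
  \<comment> \<open>Windows of length \<open>2 * R\<close> fill the indices from \<open>X\<close> to
    \<open>3 * X\<close>, and one of them has at most average rise. The base point will be taken in
    its first half, which leaves \<open>R\<close> indices for the period to unfold.\<close>
  have "\<exists>i<m. p (X + Suc i * (2 * R)) - p (X + i * (2 * R)) \<le> R * Y"
  proof (rule exists_small_step[of m "\<lambda>i. p (X + i * (2 * R))"])
    fix i show "p (X + i * (2 * R)) \<le> p (X + Suc i * (2 * R))" using X1 by (intro p_le) auto
  next
    show "m \<ge> 1" using Y8 by (simp add: m_def Suc_le_eq)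
    have "m * (2 * R) = 2 * X" using mR by (simp only: mult.left_commute[of m])
    then have e: "X + m * (2 * R) = 3 * X" by simp
    have e2: "m * (R * Y) = X * Y" by (simp only: mult.assoc[symmetric] mR)
    have "p (X + m * (2 * R)) \<le> m * (R * Y)" unfolding e e2 by (rule pX)
    then show "p (X + m * (2 * R)) \<le> p (X + 0 * (2 * R)) + m * (R * Y)" by simp
  qed
  then obtain i where i: "i < m" "p (X + Suc i * (2 * R)) - p (X + i * (2 * R)) \<le> R * Y" by blast
  define n0 where "n0 = X + i * (2 * R)"
  have n0: "X \<le> n0" "1 \<le> n0" using X1 by (auto simp: n0_def)
  have n0R: "n0 + 2 * R \<le> 3 * X"
  proof -
    have "Suc i * (2 * R) \<le> m * (2 * R)" using i by (intro mult_le_mono1) simp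
    also have "\<dots> = 2 * X" using mR by (simp only: mult.left_commute[of m])
    finally show ?thesis by (simp add: n0_def)
  qed
  have span2: "p (n0 + 2 * R) \<le> p n0 + R * Y" using i(2) by (simp add: n0_def add_ac)
  have span: "p (n0 + R) \<le> p n0 + R * Y" using p_le[of "n0 + R" "n0 + 2 * R"] span2 n0 by simp
  have RY: "R \<ge> Y" unfolding R_def using Ypow[of 1 \<rho>] by (simp add: \<rho>_def)

  obtain S d where S: "finite S" "S \<subseteq> {n0..n0 + R}" "R \<le> card S * Y ^ (3 * r + 4)"
    "d 0 = 0" "\<forall>j\<le>r. d j \<le> Y ^ 2" "\<forall>n\<in>S. \<forall>j\<le>r. p (n + j) = p n + d j"
    using exists_word_class[of r n0 Y R] Y8 n0 RY span by (auto simp: r_def)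
  have RA: "R > Y ^ dexp (3 * r + 4) (2 * k)"
    unfolding R_def A_def[symmetric] using Y8 by (intro power_strict_increasing) (auto simp: \<rho>_def)
  obtain nds T where T: "length nds = 2 * k"
    "\<forall>(\<delta>, \<epsilon>)\<in>set nds. 1 \<le> \<delta> \<and> \<delta> \<le> Y ^ (A + 2) \<and> \<epsilon> \<le> Y ^ (A + 2)"
    "T \<subseteq> S" "R \<le> card T * Y ^ A"
    "\<forall>n\<in>T. cube_pts (rlist nds) (real n) (real (p n)) \<subseteq> (\<lambda>n. (real n, real (p n))) ` S"
    using exists_cube[OF S(1,2) n0(2) Y8(1) span S(3) RA] unfolding A_def by blast
  have "R > 0" using RY Y8 by simp
  then have "card T \<noteq> 0" using T(4) by (intro notI) simp
  then obtain n where nT: "n \<in> T" by fastforce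
  then have nS: "n \<in> S" using T(3) by blast
  then have n: "n0 \<le> n" "n \<le> n0 + R" "X \<le> n" using S(2) n0 by auto
  define ds where "ds = rlist nds"
  have cube: "cube_pts ds (real n) (real (p n)) \<subseteq> (\<lambda>n. (real n, real (p n))) ` S"
    using T(5) nT by (simp add: ds_def)
  have lends: "length ds = 2 * k" by (simp add: ds_def rlist_def T(1))
  have AB: "Y ^ (A + 2) \<le> Bn" "Y ^ 2 \<le> Bn" "2 * R \<le> Bn" "R * Y \<le> Bn"
  proof -
    show "Y ^ (A + 2) \<le> Bn" unfolding Bn_def by (rule Ypow) (simp add: \<beta>_def \<rho>_def)
    show "Y ^ 2 \<le> Bn" unfolding Bn_def by (rule Ypow) (simp add: \<beta>_def \<rho>_def)
    have RY': "R * Y = Y ^ Suc \<rho>" by (simp add: R_def)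
    show RYB: "R * Y \<le> Bn" unfolding RY' Bn_def by (rule Ypow) (simp add: \<beta>_def)
    have "R * 2 \<le> R * Y" using Y8 by (intro mult_le_mono2) simp
    then show "2 * R \<le> Bn" using RYB by linarith
  qed
  have dirsds: "dirs B ds"
    unfolding dirs_def
  proof
    fix z assume "z \<in> set ds"
    then obtain \<delta> \<epsilon> where z: "(\<delta>, \<epsilon>) \<in> set nds" "z = (real \<delta>, real \<epsilon>)" by (auto simp: ds_def rlist_def)
    then have "1 \<le> \<delta>" "\<delta> \<le> Bn" "\<epsilon> \<le> Bn" using T(2) AB by fastforce+
    then show "1 \<le> fst z \<and> fst z \<le> B \<and> 0 \<le> snd z \<and> snd z \<le> B" by (simp add: z B_def)
  qed
  have subdirs: "dirs B es" if "mset es \<subseteq># mset ds" for es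
    using dirsds set_mset_mono[OF that] by (auto simp: dirs_def)
  have nB: "B \<le> real n" using BX[of 1 n] n Wpos by simp
  have qB: "\<bar>real_of_int (q e)\<bar> \<le> B" if "e \<le> k" for e
  proof -
    have "\<bar>q e\<bar> \<le> int Bn" using Yq[OF that] YB by simp
    then have "real_of_int \<bar>q e\<bar> \<le> real_of_int (int Bn)" by (simp only: of_int_le_iff)
    then show ?thesis by (simp add: B_def)
  qed
  have dB: "real (d j) \<le> B" if "j \<le> r" for j using S(5) that AB by (force simp: B_def)
  have pnB: "real (p n) \<le> B * real n"
  proof -
    have "p n \<le> p (3 * X)" using n n0 n0R by (intro p_le) auto
    also have "\<dots> \<le> X * Y" by (rule pX)
    also have "\<dots> \<le> n * Bn" using n YB by (intro mult_le_mono)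
    finally show ?thesis unfolding B_def by (metis mult.commute of_nat_le_iff of_nat_mult)
  qed
  have YX: "Y \<le> X" unfolding X_def using Ypow[of 1 \<Delta>] Wpos by (simp add: \<Delta>_def \<beta>_def)
  have SN: "N1 \<le> m \<and> r + 1 \<le> m" if "m \<in> S" for m
  proof -
    have "Y \<le> m" using that S(2) n0 YX by auto
    then show ?thesis using Y8 by auto
  qed
  have large: "B ^ (1 + k * (2 + 2 * k) + Suc k + r * (4 ^ k + k) + k * Suc k + r + 2) \<le> real n"
    "B ^ (k + E0 + 2) \<le> real n"
    using BX[of "Ea + 2" n] BX[of "k + E0 + 2" n] n by (auto simp: W_def Ea_def)
  have vanish: "fdiff es (\<lambda>y x. real_of_int (t (nat \<lfloor>y\<rfloor> + h))) (real n) (real (p n)) = 0"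
    "\<bar>fdiff es (approx k r (\<lambda>e. real_of_int (q e)) (\<lambda>j. real (d (j + h))) (real h)) (real n) (real (p n))\<bar>
      \<le> B ^ (k + E0) * real n powr (- 2 - real k)"
    if es: "mset es \<subseteq># mset ds" "length es = k" and h: "h \<le> 1" for es h
  proof -
    have pts: "cube_pts es (real n) (real (p n)) \<subseteq> (\<lambda>m. (real m, real (p m))) ` S"
      using cube_pts_mono[OF es(1)] cube by blast
    have w: "p (m + j) = p m + d j" if "m \<in> S" "j \<le> r" for m j using S(6) that by blast
    show "fdiff es (\<lambda>y x. real_of_int (t (nat \<lfloor>y\<rfloor> + h))) (real n) (real (p n)) = 0"
      "\<bar>fdiff es (approx k r (\<lambda>e. real_of_int (q e)) (\<lambda>j. real (d (j + h))) (real h)) (real n) (real (p n))\<bar>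
        \<le> B ^ (k + E0) * real n powr (- 2 - real k)"
      by (rule fdiff_vanish[OF r_def h w SN B nB qB dB pts subdirs[OF es(1)] es(2) pnB large]; assumption)+
  qed

  define P where "P = (\<Sum>e\<le>k. monom (real_of_int (q e)) e)"
  have degP: "degree P \<le> k"
    unfolding P_def by (intro degree_sum_le) (auto intro: order_trans[OF degree_monom_le])
  have coeffP: "coeff P k \<noteq> 0"
  proof -
    have "coeff P k = (\<Sum>e\<le>k. if e = k then real_of_int (q e) else 0)"
      unfolding P_def coeff_sum by (intro sum.cong) auto
    then show ?thesis using qk by simp
  qed
  have polyP: "poly P (real (p m)) = real_of_int (Q m)" for m
    by (simp add: P_def poly_sum poly_monom Q_def)
  obtain es l where es: "mset es \<subseteq># mset ds" "length es = k" "\<forall>d\<in>set es. snd d = l * fst d"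
  proof -
    have "\<exists>es l. mset es \<subseteq># mset ds \<and> length es = k \<and> (\<forall>d\<in>set es. snd d = l * fst d)"
    proof (rule exists_collinear_directions[OF lends k _ _ _ _ degP coeffP])
      show "fst d > 0" if "d \<in> set ds" for d using dirsds that by (force simp: dirs_def)
      show "y' * real_of_int (t (nat \<lfloor>y'\<rfloor> + 0)) = poly P x' + real_of_int (t (nat \<lfloor>y'\<rfloor> + 1))"
        if c: "(y', x') \<in> cube_pts ds (real n) (real (p n))" for y' x'
      proof -
        obtain m where m: "m \<in> S" "y' = real m" "x' = real (p m)" using c cube by auto
        have "m \<ge> 1" using SN[OF m(1)] by simp
        then have "int m * t m = Q m + t (Suc m)" using t_rec[of m] by (simp add: Q_def)
        then have "real_of_int (int m * t m) = real_of_int (Q m + t (Suc m))" by (rule arg_cong)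
        then show ?thesis by (simp add: m polyP)
      qed
      show "fdiff es (\<lambda>y x. real_of_int (t (nat \<lfloor>y\<rfloor> + 0))) (real n) (real (p n)) = 0"
        "fdiff es (\<lambda>y x. real_of_int (t (nat \<lfloor>y\<rfloor> + 1))) (real n) (real (p n)) = 0"
        if "mset es \<subseteq># mset ds" "length es = k" for es
        using vanish(1)[OF that, of 0] vanish(1)[OF that, of 1] by auto
    qed
    then show ?thesis using that by blast
  qed
  \<comment> \<open>Any of the collinear directions represents the slope as \<open>D / a\<close>.
    Since \<open>n + a\<close> is a corner and so lies in \<open>S\<close>, the next
    \<open>r\<close> gaps at \<open>n\<close> and at \<open>n + a\<close> agree, which starts the
    periodicity.\<close>
  have "es \<noteq> []" using es(2) k by auto
  then have hd: "hd es \<in> set es" by simp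
  then have "hd es \<in> set ds" using set_mset_mono[OF es(1)] by auto
  then obtain a D where aD: "(a, D) \<in> set nds" "hd es = (real a, real D)" by (auto simp: ds_def rlist_def)
  have aY: "1 \<le> a" "a \<le> Y ^ (A + 2)" "D \<le> Y ^ (A + 2)" using T(2) aD(1) by auto
  have aB: "a \<le> Bn" "D \<le> Bn" using aY AB by auto
  have lD: "real D = l * real a" using es(3) hd aD(2) by auto
  have "mset [hd es] \<subseteq># mset es" using hd by simp
  then have "cube_pts [hd es] (real n) (real (p n)) \<subseteq> (\<lambda>n. (real n, real (p n))) ` S"
    using cube_pts_mono[of "[hd es]" es] cube_pts_mono[OF es(1)] cube by blast
  then have "(real n + real a, real (p n) + real D) \<in> (\<lambda>n. (real n, real (p n))) ` S" by (simp add: aD(2))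
  then obtain n' where n': "n' \<in> S" "real n + real a = real n'" "real (p n) + real D = real (p n')" by auto
  then have n'a: "n' = n + a" "p n' = p n + D" by linarith+
  have "p n < p (n + a)" using aY n n0 by (intro p_less) auto
  then have D1: "D \<ge> 1" using n'a by simp
  have init: "p (n + a + j) = p (n + j) + D" if "j \<le> r" for j
    using S(6) nS n'(1) that n'a by auto
  have l: "0 \<le> l" "l \<le> B"
  proof -
    have l: "l = real D / real a" using lD aY by simp
    then show "0 \<le> l" by simp
    have "real D / real a \<le> real D" using aY by (simp add: divide_le_eq mult_le_cancel_left1)
    then show "l \<le> B" using l aB by (simp add: B_def)
  qed
  have w: "\<bar>real (p n) - l * real n\<bar> \<le> B ^ E2"
  proof -
    interpret cone B "real n" by unfold_locales (use B nB in auto)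
    have "\<bar>real (p n) - l * real n\<bar> \<le> B ^ (k + 1 + (1 + 3 * k + (Suc r * (4 ^ k + k) + k * (r + 2)) + r * Suc k * Suc k) + 1)"
    proof (rule line_bound[where q = "\<lambda>e. real_of_int (q e)" and d = "\<lambda>j. real (d j)" and E = "k + E0" and ds = es])
      show "\<bar>fdiff es (approx k r (\<lambda>e. real_of_int (q e)) (\<lambda>j. real (d j)) 0) (real n) (real (p n))\<bar>
          \<le> B ^ (k + E0) * real n powr (- 2 - real k)"
        using vanish(2)[OF es(1,2), of 0] by simp
      show "B ^ (k + E0 + (k + 1 + (1 + 3 * k + (Suc r * (4 ^ k + k) + k * (r + 2)) + r * Suc k * Suc k)) + 2) \<le> real n"
        using BX[of "k + E0 + E6 + 2" n] n by (auto simp: W_def E6_def)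
      show "real k * B \<le> real n"
      proof -
        have "k \<le> Bn" using Y8 YB by (simp add: r_def)
        then have "real k * B \<le> B ^ 2" using B by (simp add: B_def power2_eq_square)
        also have "\<dots> \<le> real n" using n by (intro BX) (auto simp: W_def)
        finally show ?thesis .
      qed
      have "1 \<le> \<bar>q k\<bar>" using qk by linarith
      then have "real_of_int 1 \<le> real_of_int \<bar>q k\<bar>" by (simp only: of_int_le_iff)
      then show "1 \<le> \<bar>real_of_int (q k)\<bar>" by simp
      show "real (p n) \<le> B * real n" by (rule pnB)
      show "dirs B es" by (rule subdirs[OF es(1)])
      show "1 \<le> r" by (simp add: r_def)
      show "0 \<le> real (d j) \<and> real (d j) \<le> B" if "j < r" for j using dB[of j] that by simp
      show "snd d = l * fst d" if "d \<in> set es" for d using es(3) that by blast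
      show "\<bar>real_of_int (q e)\<bar> \<le> B" if "e \<le> k" for e using that by (rule qB)
    qed (use es k l S(4) in auto)
    then show ?thesis by (simp only: E2_def E6_def)
  qed

  define J where "J = a * D"
  have range: "n + a + J + r \<le> n0 + 2 * R"
  proof -
    have "a * D \<le> Y ^ (A + 2) * Y ^ (A + 2)" using aY by (intro mult_le_mono)
    also have "\<dots> = Y ^ (A + 2 + (A + 2))" by (rule power_add[symmetric])
    also have "A + 2 + (A + 2) = 2 * A + 4" by simp
    finally have 1: "J \<le> Y ^ (2 * A + 4)" by (simp add: J_def)
    have 2: "a \<le> Y ^ (2 * A + 4)" using aY(2) Ypow[of "A + 2" "2 * A + 4"] by linarith
    have 3: "r \<le> Y ^ (2 * A + 4)" using Y8(2) Ypow[of 1 "2 * A + 4"] by simp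
    have "a + J + r \<le> 8 * Y ^ (2 * A + 4)" using 1 2 3 by linarith
    also have "\<dots> \<le> Y * Y ^ (2 * A + 4)" using Y8(1) by (rule mult_le_mono1)
    also have "\<dots> = Y ^ Suc (2 * A + 4)" by (rule power_Suc[symmetric])
    also have "\<dots> \<le> R" unfolding R_def by (rule Ypow) (simp add: \<rho>_def)
    finally show ?thesis using n by linarith
  qed
  define B2 where "B2 = int Bn ^ (E2 + 4)"
  have B2: "int Bn \<le> B2" unfolding B2_def using Bn2 self_le_power[of "int Bn" "E2 + 4"] by simp
  \<comment> \<open>Within the window the index and the prime each move by at most \<open>B\<close>,
    so the bound on \<open>p n - l * n\<close> extends to all \<open>M + j\<close>.\<close>
  have z: "\<bar>int a * int (p (M + j)) - int D * int M\<bar> \<le> B2" if M: "n \<le> M" "M \<le> n + a + J" "j < r" for M j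
  proof -
    define u where "u = p (M + j) - p n"
    have u: "p (M + j) = p n + u" using p_le[of n "M + j"] M n n0 by (simp add: u_def)
    have "p (M + j) \<le> p (n0 + 2 * R)" using M range n0 n by (intro p_le) auto
    moreover have "p n0 \<le> p n" using n n0 by (intro p_le)
    ultimately have uB: "real u \<le> B" using span2 AB(4) by (simp add: u_def B_def)
    have MB: "real M - real n \<le> B" using M range n AB(3) by (simp add: B_def)
    have "real_of_int (int a * int (p (M + j)) - int D * int M) =
        real a * (real (p n) - l * real n) + real a * real u - real D * (real M - real n)"
      unfolding u using lD by (simp add: algebra_simps)
    also have "\<bar>\<dots>\<bar> \<le> B * B ^ E2 + B * B + B * B"
    proof -
      have "\<bar>real a * (real (p n) - l * real n)\<bar> \<le> B * B ^ E2"
        unfolding abs_mult using w aB by (intro mult_mono) (auto simp: B_def)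
      moreover have "\<bar>real a * real u\<bar> \<le> B * B"
        unfolding abs_mult using uB aB by (intro mult_mono) (auto simp: B_def)
      moreover have "\<bar>real D * (real M - real n)\<bar> \<le> B * B"
        unfolding abs_mult using MB aB M by (intro mult_mono) (auto simp: B_def)
      ultimately show ?thesis by linarith
    qed
    also have "\<dots> \<le> 4 * B ^ (E2 + 2)"
    proof -
      have "B ^ Suc E2 \<le> B ^ (E2 + 2)" "B ^ 2 \<le> B ^ (E2 + 2)" by (rule Bpow, simp)+
      moreover have "0 \<le> B ^ (E2 + 2)" using B by simp
      moreover have "B ^ Suc E2 = B * B ^ E2" "B ^ 2 = B * B" by (simp_all add: power2_eq_square)
      ultimately show ?thesis by linarith
    qed
    also have "\<dots> \<le> B ^ 2 * B ^ (E2 + 2)" using B power_mono[of 2 B 2] by (intro mult_right_mono) auto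
    also have "\<dots> = B ^ (2 + (E2 + 2))" by (rule power_add[symmetric])
    also have "2 + (E2 + 2) = E2 + 4" by simp
    also have "B ^ (E2 + 4) = real_of_int B2" by (simp add: B2_def B_def)
    finally have "real_of_int \<bar>int a * int (p (M + j)) - int D * int M\<bar> \<le> real_of_int B2" by simp
    then show ?thesis by (simp only: of_int_le_iff)
  qed
  have largeB2: "int n > B2 ^ (5 + 3 * k + 2 * r)"
  proof -
    define e where "e = (E2 + 4) * (5 + 3 * k + 2 * r)"
    have "Bn ^ e < Bn ^ W" using Bn2 by (intro power_strict_increasing) (auto simp: W_def e_def)
    then have "Bn ^ e < n" using XB n by linarith
    then have "int (Bn ^ e) < int n" by (simp only: of_nat_less_iff)
    then show ?thesis by (simp add: B2_def e_def power_mult)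
  qed
  have "p (n + a + j) = p (n + j) + D" if "j \<le> J" for j
  proof (rule period_propagates[OF r_def _ _ _ D1 _ _ _ _ _ _ z largeB2 init that])
    show "1 \<le> n" "r \<le> n" "N1 \<le> n" using SN[OF nS] by auto
    show "rising_norm r + 1 \<le> B2" "2 \<le> B2" "int r \<le> B2" using Yn YB B2 Bn2 Y8 by linarith+
    show "int a \<le> B2" "int D \<le> B2" using aB B2 by linarith+
    show "\<bar>q e\<bar> \<le> B2" if "e \<le> k" for e using Yq[OF that] YB B2 by linarith
  qed
  moreover have "D + 1 < p n"
  proof -
    have "B ^ 2 \<le> real n" using n by (intro BX) (auto simp: W_def)
    moreover have "2 * B \<le> B ^ 2" using B by (simp add: power2_eq_square)
    moreover have "real D \<le> B" using aB by (simp add: B_def)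
    moreover have "real n \<le> real (p n)" using p_ge[of n] p_prime[of 1] prime_ge_1_nat[of "p 1"] n n0 by simp
    moreover have "real 8 \<le> B" using Y8(1) YB by (simp add: B_def)
    ultimately have "real (D + 1) < real (p n)" by simp
    then show ?thesis by (simp only: of_nat_less_iff)
  qed
  ultimately show False using no_period[of n D a] D1 n n0 unfolding J_def by auto
qed

end

subsection \<open>Linear independence\<close>

interpretation primes: increasing nth_prime
  by unfold_locales (rule nth_prime_less)

lemma nth_prime_ge: "n \<ge> 1 \<Longrightarrow> n \<le> nth_prime n"
  using primes.p_ge[of n] nth_prime_ge_2[of 1] by simp

lemma summable_power_fact: "summable (\<lambda>n. real (Suc n) ^ s / fact (Suc n))"
proof (rule summable_comparison_test')
  show "summable (\<lambda>n. real (nth_prime (Suc n)) ^ s / fact (Suc n))" by (rule summable_prime_sum)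
  fix n :: nat
  have "real (Suc n) ^ s \<le> real (nth_prime (Suc n)) ^ s"
    using nth_prime_ge[of "Suc n"] by (intro power_mono) (simp_all only: of_nat_le_iff)
  then show "norm (real (Suc n) ^ s / fact (Suc n)) \<le> real (nth_prime (Suc n)) ^ s / fact (Suc n)"
    by (simp add: divide_right_mono del: fact_Suc of_nat_Suc)
qed

definition prime_poly :: "nat \<Rightarrow> (nat \<Rightarrow> int) \<Rightarrow> nat \<Rightarrow> int" where
  "prime_poly k q n = (\<Sum>e\<le>k. q e * int (nth_prime n) ^ e)"

text \<open>Integrality is built in by using the recurrence as definition. The start
  \<open>m\<close> at 1 is the assumed value of the series, and the value at 0 is a dummy;
  \<open>scaled_tail_eq\<close> recovers the factorial times the remainder of the series.\<close>

primrec scaled_tail :: "nat \<Rightarrow> (nat \<Rightarrow> int) \<Rightarrow> int \<Rightarrow> nat \<Rightarrow> int" where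
  "scaled_tail k q m 0 = 0"
| "scaled_tail k q m (Suc n) = (if n = 0 then m else int n * scaled_tail k q m n - prime_poly k q n)"

lemma scaled_tail_eq:
  "real_of_int (scaled_tail k q m (Suc n)) =
    fact n * (real_of_int m - (\<Sum>i<n. real_of_int (prime_poly k q (Suc i)) / fact (Suc i)))"
proof (induction n)
  case (Suc n)
  have "real_of_int (scaled_tail k q m (Suc (Suc n))) =
      real (Suc n) * real_of_int (scaled_tail k q m (Suc n)) - real_of_int (prime_poly k q (Suc n))"
    by simp
  also have "\<dots> = fact (Suc n) * (real_of_int m - (\<Sum>i<n. real_of_int (prime_poly k q (Suc i)) / fact (Suc i)))
      - fact (Suc n) * (real_of_int (prime_poly k q (Suc n)) / fact (Suc n))"
    unfolding Suc by simp
  finally show ?case by (simp only: sum.lessThan_Suc right_diff_distrib diff_diff_eq distrib_left)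
qed simp

lemma prime_poly_bound: "\<exists>C>0. \<forall>n\<ge>1. real_of_int \<bar>prime_poly k q n\<bar> \<le> C * real n ^ (2 * k)"
proof -
  obtain K where K: "K > 0" "\<And>n. n \<ge> 1 \<Longrightarrow> real (nth_prime n) ^ 1 \<le> K * real n ^ Suc 1"
    using nth_prime_power_bound[of 1] by blast
  define C where "C = (\<Sum>e\<le>k. real_of_int \<bar>q e\<bar> * K ^ e) + 1"
  have "real_of_int \<bar>prime_poly k q n\<bar> \<le> C * real n ^ (2 * k)" if n: "n \<ge> 1" for n
  proof -
    have p: "real (nth_prime n) \<le> K * real n ^ 2" using K(2)[OF n] by (simp add: power2_eq_square)
    have "real_of_int \<bar>prime_poly k q n\<bar> = \<bar>\<Sum>e\<le>k. real_of_int (q e) * real (nth_prime n) ^ e\<bar>"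
      by (simp add: prime_poly_def)
    also have "\<dots> \<le> (\<Sum>e\<le>k. \<bar>real_of_int (q e) * real (nth_prime n) ^ e\<bar>)" by (rule sum_abs)
    also have "\<dots> \<le> (\<Sum>e\<le>k. real_of_int \<bar>q e\<bar> * K ^ e * real n ^ (2 * k))"
    proof (rule sum_mono)
      fix e assume e: "e \<in> {..k}"
      have "real (nth_prime n) ^ e \<le> (K * real n ^ 2) ^ e" using p by (intro power_mono) auto
      also have "\<dots> = K ^ e * real n ^ (2 * e)" by (simp add: power_mult_distrib power_mult)
      also have "\<dots> \<le> K ^ e * real n ^ (2 * k)"
        using K(1) n e by (intro mult_left_mono power_increasing) auto
      finally have "\<bar>real_of_int (q e)\<bar> * real (nth_prime n) ^ e \<le> \<bar>real_of_int (q e)\<bar> * (K ^ e * real n ^ (2 * k))"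
        by (intro mult_left_mono) auto
      then show "\<bar>real_of_int (q e) * real (nth_prime n) ^ e\<bar> \<le> real_of_int \<bar>q e\<bar> * K ^ e * real n ^ (2 * k)"
        by (simp add: abs_mult mult.assoc)
    qed
    also have "\<dots> = (C - 1) * real n ^ (2 * k)" by (simp add: C_def sum_distrib_right)
    also have "\<dots> \<le> C * real n ^ (2 * k)" by (intro mult_right_mono) auto
    finally show ?thesis .
  qed
  moreover have "C > 0" unfolding C_def using K(1) by (intro add_nonneg_pos sum_nonneg) auto
  ultimately show ?thesis by blast
qed

text \<open>By the relation, \<open>scaled_tail\<close> is a factorial times a tail of a convergent
  series. The inequalities \<open>fact n * fact (Suc j) \<le> fact (n + Suc j)\<close> and
  \<open>Suc (j + n) \<le> Suc n * Suc j\<close> separate \<open>n\<close> from \<open>j\<close> in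
  each term, leaving a power of \<open>Suc n\<close> times a convergent series in
  \<open>j\<close>.\<close>

lemma scaled_tail_bound:
  assumes rel: "(\<Sum>e\<le>k. real_of_int (q e) * prime_sum e) = real_of_int m"
  shows "\<exists>C>0. \<forall>n\<ge>1. real_of_int \<bar>scaled_tail k q m n\<bar> \<le> C * real n ^ (2 * k)"
proof -
  define g where "g = (\<lambda>i. real_of_int (prime_poly k q (Suc i)) / fact (Suc i))"
  have g: "g sums real_of_int m"
  proof -
    have "(\<lambda>i. \<Sum>e\<le>k. real_of_int (q e) * (real (nth_prime (Suc i)) ^ e / fact (Suc i))) sums
        (\<Sum>e\<le>k. real_of_int (q e) * prime_sum e)"
      unfolding prime_sum_def by (intro sums_sum sums_mult summable_sums summable_prime_sum)
    moreover have "(\<lambda>i. \<Sum>e\<le>k. real_of_int (q e) * (real (nth_prime (Suc i)) ^ e / fact (Suc i))) = g"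
      by (simp add: g_def prime_poly_def sum_divide_distrib del: fact_Suc)
    ultimately show ?thesis using rel by simp
  qed
  obtain C where C: "C > 0" "\<And>n. n \<ge> 1 \<Longrightarrow> real_of_int \<bar>prime_poly k q n\<bar> \<le> C * real n ^ (2 * k)"
    using prime_poly_bound by blast
  define h where "h = (\<lambda>j. real (Suc j) ^ (2 * k) / fact (Suc j))"
  have h: "summable h" unfolding h_def by (rule summable_power_fact)
  have h0: "0 \<le> h j" for j by (simp add: h_def del: fact_Suc of_nat_Suc)
  have bound: "real_of_int \<bar>scaled_tail k q m (Suc n)\<bar> \<le> (C * (suminf h + 1)) * real (Suc n) ^ (2 * k)" for n
  proof -
    have "(\<lambda>j. g (j + n)) sums (real_of_int m - (\<Sum>i<n. g i))"
      using g sums_split_initial_segment by blast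
    then have s: "(\<lambda>j. fact n * g (j + n)) sums real_of_int (scaled_tail k q m (Suc n))"
      unfolding scaled_tail_eq g_def[symmetric] by (rule sums_mult)
    have le: "norm (fact n * g (j + n)) \<le> C * real (Suc n) ^ (2 * k) * h j" for j
    proof -
      have "fact n * fact (Suc j) \<le> (fact (n + Suc j) :: real)"
      proof -
        have "fact n * fact (Suc j) dvd (fact (n + Suc j) :: nat)" by (rule fact_fact_dvd_fact)
        then have "fact n * fact (Suc j) \<le> (fact (n + Suc j) :: nat)" by (intro dvd_imp_le) auto
        then have "real (fact n * fact (Suc j)) \<le> real (fact (n + Suc j))" by (simp only: of_nat_le_iff)
        then show ?thesis by (simp del: fact_Suc)
      qed
      then have f: "fact n / fact (Suc (j + n)) \<le> (1 / fact (Suc j) :: real)"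
        by (simp add: field_simps add.commute del: fact_Suc)
      have "Suc (j + n) \<le> Suc n * Suc j" by simp
      then have "real (Suc (j + n)) \<le> real (Suc n) * real (Suc j)" by (metis of_nat_le_iff of_nat_mult)
      then have "real (Suc (j + n)) ^ (2 * k) \<le> (real (Suc n) * real (Suc j)) ^ (2 * k)"
        by (intro power_mono) auto
      then have "C * real (Suc (j + n)) ^ (2 * k) \<le> C * (real (Suc n) * real (Suc j)) ^ (2 * k)"
        using C(1) by (intro mult_left_mono) auto
      then have p: "real_of_int \<bar>prime_poly k q (Suc (j + n))\<bar> \<le> C * (real (Suc n) * real (Suc j)) ^ (2 * k)"
        using C(2)[of "Suc (j + n)"] by linarith
      have "norm (fact n * g (j + n)) = real_of_int \<bar>prime_poly k q (Suc (j + n))\<bar> * (fact n / fact (Suc (j + n)))"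
        by (simp add: g_def abs_mult del: fact_Suc)
      also have "\<dots> \<le> (C * (real (Suc n) * real (Suc j)) ^ (2 * k)) * (1 / fact (Suc j))"
        using p f C(1) by (intro mult_mono) (auto simp del: fact_Suc of_nat_Suc)
      also have "\<dots> = C * real (Suc n) ^ (2 * k) * h j"
        by (simp add: h_def power_mult_distrib del: fact_Suc of_nat_Suc)
      finally show ?thesis .
    qed
    have sm: "summable (\<lambda>j. C * real (Suc n) ^ (2 * k) * h j)" using h by (rule summable_mult)
    have "\<bar>real_of_int (scaled_tail k q m (Suc n))\<bar> = norm (\<Sum>j. fact n * g (j + n))"
      using sums_unique[OF s] by simp
    also have "\<dots> \<le> (\<Sum>j. C * real (Suc n) ^ (2 * k) * h j)"
      by (rule norm_suminf_le[OF le sm])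
    also have "\<dots> = C * real (Suc n) ^ (2 * k) * suminf h" using h by (rule suminf_mult)
    also have "\<dots> \<le> C * real (Suc n) ^ (2 * k) * (suminf h + 1)"
      using C(1) by (intro mult_left_mono mult_nonneg_nonneg) auto
    finally show ?thesis by (simp add: mult_ac del: of_nat_Suc)
  qed
  have "suminf h \<ge> 0" using h h0 by (rule suminf_nonneg)
  then have "C * (suminf h + 1) > 0" using C(1) by simp
  moreover have "real_of_int \<bar>scaled_tail k q m n\<bar> \<le> (C * (suminf h + 1)) * real n ^ (2 * k)" if "n \<ge> 1" for n
    using bound[of "n - 1"] that by simp
  ultimately show ?thesis by blast
qed

lemma no_integer_relation:
  assumes rel: "(\<Sum>e\<le>k. real_of_int (q e) * prime_sum e) = real_of_int m" and qk: "q k \<noteq> 0"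
  shows False
proof -
  let ?t = "scaled_tail k q m"
  have rec: "?t (Suc n) = int n * ?t n - (\<Sum>e\<le>k. q e * int (nth_prime n) ^ e)" if "n \<ge> 1" for n
    using that by (simp add: prime_poly_def)
  obtain C where C: "C > 0" "\<And>n. n \<ge> 1 \<Longrightarrow> real_of_int \<bar>?t n\<bar> \<le> C * real n ^ (2 * k)"
    using scaled_tail_bound[OF rel] by blast
  show False
  proof (cases "k = 0")
    case True
    \<comment> \<open>For \<open>k = 0\<close> the scaled tails are bounded, so the recurrence
      forces them to be 0 for large \<open>n\<close>, and then \<open>q 0 = 0\<close>.\<close>
    have zero: "?t n = 0" if n: "real n > C + \<bar>real_of_int (q 0)\<bar>" "n \<ge> 1" for n
    proof (rule ccontr)
      assume "?t n \<noteq> 0"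
      then have "1 \<le> \<bar>?t n\<bar>" by linarith
      then have "int n * 1 \<le> int n * \<bar>?t n\<bar>" by (intro mult_left_mono) auto
      also have "\<dots> = \<bar>int n * ?t n\<bar>" by (simp add: abs_mult)
      also have "int n * ?t n = ?t (Suc n) + q 0" using rec[OF n(2)] True by simp
      also have "\<bar>?t (Suc n) + q 0\<bar> \<le> \<bar>?t (Suc n)\<bar> + \<bar>q 0\<bar>" by (rule abs_triangle_ineq)
      finally have "real_of_int (int n * 1) \<le> real_of_int (\<bar>?t (Suc n)\<bar> + \<bar>q 0\<bar>)" by (simp only: of_int_le_iff)
      moreover have "real_of_int \<bar>?t (Suc n)\<bar> \<le> C" using C(2)[of "Suc n"] unfolding True by simp
      ultimately show False using n(1) by (simp del: scaled_tail.simps)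
    qed
    obtain n where "real n > C + \<bar>real_of_int (q 0)\<bar>" using reals_Archimedean2 by blast
    then have n: "real n > C + \<bar>real_of_int (q 0)\<bar>" "n \<ge> 1" "real (Suc n) > C + \<bar>real_of_int (q 0)\<bar>"
      using C(1) by (auto simp: Suc_le_eq intro: Nat.gr0I)
    then show False using zero[of n] zero[of "Suc n"] rec[of n] True qk by simp
  next
    case False
    \<comment> \<open>From \<open>N1\<close> on, the constant \<open>C\<close> is at most
      \<open>n\<close> and is absorbed by raising the exponent \<open>2 * k\<close> by one.\<close>
    define N1 where "N1 = nat \<lceil>C\<rceil> + 1"
    interpret prime_recurrence nth_prime k q ?t "2 * k + 1" N1
    proof
      show "prime (nth_prime n)" if "n \<ge> 1" for n using that by (rule nth_prime_prime)
      show "k \<ge> 1" "q k \<noteq> 0" using False qk by auto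
      show "?t (Suc n) = int n * ?t n - (\<Sum>e\<le>k. q e * int (nth_prime n) ^ e)" if "n \<ge> 1" for n
        using that by (rule rec)
      show "\<bar>?t n\<bar> \<le> int n ^ (2 * k + 1)" if n: "N1 \<le> n" for n
      proof -
        have "n \<ge> 1" using n by (simp add: N1_def)
        have "C \<le> real (nat \<lceil>C\<rceil>)" by (rule real_nat_ceiling_ge)
        also have "\<dots> \<le> real n" unfolding of_nat_le_iff using n by (simp only: N1_def)
        finally have "C * real n ^ (2 * k) \<le> real n * real n ^ (2 * k)" by (intro mult_right_mono) auto
        then have "real_of_int \<bar>?t n\<bar> \<le> real_of_int (int n ^ (2 * k + 1))" using C(2)[OF \<open>n \<ge> 1\<close>] by simp
        then show ?thesis by (simp only: of_int_le_iff)
      qed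
    qed
    show False using nth_prime_power_bound by (rule growth_contradiction)
  qed
qed

text \<open>Clear denominators and let \<open>k\<close> be the largest index of a power sum with
  nonzero coefficient: \<open>no_integer_relation\<close> excludes it. So only the coefficient of
  the number 1, which sits at index 0, could remain.\<close>

lemma rational_relation_trivial:
  fixes u :: "nat \<Rightarrow> rat"
  assumes rel: "(\<Sum>i<n. real_of_rat (u i) * case_nat 1 prime_sum i) = 0"
  shows "\<forall>i<n. u i = 0"
proof -
  define v where "v = (\<lambda>i. if i < n then u i else 0)"
  define b where "b = (\<Prod>i<n. snd (quotient_of (v i)))"
  have b: "b > 0" unfolding b_def by (intro prod_pos) (simp add: quotient_of_denom_pos')
  have "\<exists>c. of_int b * v i = of_int c" for i
  proof (cases "i < n")
    case True
    obtain a d where ad: "quotient_of (v i) = (a, d)" by (cases "quotient_of (v i)")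
    have v: "v i = of_int a / of_int d" using quotient_of_div[OF ad] .
    have d: "d > 0" using quotient_of_denom_pos[OF ad] .
    have "snd (quotient_of (v i)) dvd b" unfolding b_def using True by (intro dvd_prodI) auto
    then obtain e where e: "b = d * e" unfolding ad snd_conv by blast
    have "of_int b * v i = of_int (e * a)" unfolding e v using d by simp
    then show ?thesis by blast
  next
    case False
    then show ?thesis by (intro exI[of _ 0]) (simp add: v_def)
  qed
  then obtain c where c: "\<And>i. of_int b * v i = of_int (c i)" by metis
  have c0: "c i = 0 \<longleftrightarrow> v i = 0" for i
  proof -
    have "c i = 0 \<longleftrightarrow> of_int b * v i = 0" unfolding c by simp
    then show ?thesis using b by simp
  qed
  have creal: "real_of_int b * real_of_rat (v i) = real_of_int (c i)" for i
    using arg_cong[OF c[of i], of real_of_rat] by (simp add: of_rat_mult)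
  have sum0: "(\<Sum>i<N. real_of_int (c i) * case_nat 1 prime_sum i) = 0" if "n \<le> N" for N
  proof -
    have "(\<Sum>i<N. real_of_int (c i) * case_nat 1 prime_sum i) = (\<Sum>i<n. real_of_int (c i) * case_nat 1 prime_sum i)"
      using that c0 by (intro sum.mono_neutral_right) (auto simp: v_def)
    also have "\<dots> = real_of_int b * (\<Sum>i<n. real_of_rat (u i) * case_nat 1 prime_sum i)"
      unfolding sum_distrib_left creal[symmetric] by (intro sum.cong) (auto simp: v_def)
    finally show ?thesis using rel by simp
  qed
  have high: "c (Suc e) = 0" for e
  proof (rule ccontr)
    assume ne: "c (Suc e) \<noteq> 0"
    define k where "k = Max {e. c (Suc e) \<noteq> 0}"
    have fin: "finite {e. c (Suc e) \<noteq> 0}"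
      by (rule finite_subset[of _ "{..<n}"]) (auto simp: c0 v_def split: if_splits)
    have kin: "c (Suc k) \<noteq> 0" using Max_in[OF fin] ne unfolding k_def by blast
    have kmax: "c (Suc e) = 0" if "k < e" for e using Max_ge[OF fin, of e] that unfolding k_def by force
    \<comment> \<open>The limit lies beyond both \<open>n\<close>, where the given relation ends,
      and \<open>k\<close>, where the nonzero coefficients end.\<close>
    have "0 = (\<Sum>i<Suc (k + n + 1). real_of_int (c i) * case_nat 1 prime_sum i)"
      by (rule sum0[symmetric]) simp
    also have "\<dots> = real_of_int (c 0) + (\<Sum>e<k + n + 1. real_of_int (c (Suc e)) * prime_sum e)"
      by (subst sum.lessThan_Suc_shift) simp
    also have "(\<Sum>e<k + n + 1. real_of_int (c (Suc e)) * prime_sum e) = (\<Sum>e\<le>k. real_of_int (c (Suc e)) * prime_sum e)"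
      using kmax by (intro sum.mono_neutral_right) auto
    finally have "(\<Sum>e\<le>k. real_of_int (c (Suc e)) * prime_sum e) = real_of_int (- c 0)" by simp
    then show False using no_integer_relation[of "\<lambda>e. c (Suc e)" k "- c 0"] kin by blast
  qed
  have "(\<Sum>i<Suc n. real_of_int (c i) * case_nat 1 prime_sum i) = real_of_int (c 0)"
    by (subst sum.lessThan_Suc_shift) (simp add: high)
  then have "c 0 = 0" using sum0[of "Suc n"] by simp
  then have "c i = 0" for i using high by (cases i) auto
  then have "v i = 0" for i using c0 by simp
  then show ?thesis unfolding v_def by meson
qed

theorem theorem3:
  shows "inj (case_nat 1 prime_sum) \<and>
         rat_real.independent (range (case_nat 1 prime_sum))"
proof
  let ?f = "case_nat 1 prime_sum :: nat \<Rightarrow> real"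
  show inj: "inj ?f"
  proof (rule injI, rule ccontr)
    fix i j assume eq: "?f i = ?f j" and ne: "i \<noteq> j"
    \<comment> \<open>A repeated value would be a relation with coefficients 1 and -1. It has to be
      excluded separately because independence only concerns the set of values.\<close>
    define u :: "nat \<Rightarrow> rat" where "u = (\<lambda>l. (if l = i then 1 else 0) - (if l = j then 1 else 0))"
    have "(\<Sum>l<Suc (i + j). real_of_rat (u l) * ?f l) =
        (\<Sum>l<Suc (i + j). (if l = i then ?f l else 0) - (if l = j then ?f l else 0))"
      by (intro sum.cong) (auto simp: u_def of_rat_diff)
    also have "\<dots> = ?f i - ?f j" unfolding sum_subtractf by (simp only: sum.delta finite_lessThan) simp
    finally have "\<forall>l<Suc (i + j). u l = 0" using eq by (intro rational_relation_trivial) simp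
    then have "u i = 0" by simp
    then show False using ne by (simp add: u_def)
  qed
  show "rat_real.independent (range ?f)"
  proof
    assume "rat_real.dependent (range ?f)"
    then obtain V u where V: "finite V" "V \<subseteq> range ?f" "(\<Sum>v\<in>V. real_of_rat (u v) * v) = 0" "\<exists>v\<in>V. u v \<noteq> 0"
      unfolding rat_real.dependent_explicit by blast
    define I where "I = ?f -` V"
    have I: "finite I" "?f ` I = V"
      unfolding I_def using V inj by (auto intro: finite_vimageI)
    obtain n where n: "I \<subseteq> {..<n}" using I(1) finite_nat_iff_bounded by blast
    have "(\<Sum>i<n. real_of_rat (if i \<in> I then u (?f i) else 0) * ?f i) = (\<Sum>i\<in>I. real_of_rat (u (?f i)) * ?f i)"
      using n by (intro sum.mono_neutral_cong_right) auto
    also have "\<dots> = (\<Sum>v\<in>?f ` I. real_of_rat (u v) * v)"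
      using inj by (subst sum.reindex) (auto intro: inj_on_subset)
    also have "\<dots> = 0" using V(3) I(2) by simp
    finally have "\<forall>i<n. (if i \<in> I then u (?f i) else 0) = 0" by (rule rational_relation_trivial)
    then have "\<forall>i\<in>I. u (?f i) = 0" using n by force
    then show False using V(4) I(2) by blast
  qed
qed

end
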